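(* Let $n,r\geq 1$ be integers. Suppose that $f\in\mathbb{Z}[x]$ has degree $nr$, $m\geq 2$ is an integer, and $f(x)\equiv(x^n-1)^r\mod m$. If $g$ is a factor of $f$ over $\mathbb{Z}$ having no cyclotomic factors, then $$\mu(g)\geq c\cdot\left(\frac{\deg g}{n2^r}\right),$$ where $c$ is the unique positive real number satisfying $c\,e^{c/2}\log 3=\log(3/2)\log 2$ (so $c=.22823\ldots$).
   Context: Congruence of polynomials in $\mathbb{Z}[x]$ modulo $m$ means that all coefficients of the difference are divisible by $m$. "No cyclotomic factors" means that no cyclotomic polynomial divides $g$. The logarithmic Weil height of an algebraic number $\alpha$ in a number field $K$ is $h(\alpha)=\sum_v\log^+|\alpha|_v$, the sum over all places $v$ of $K$, where $\log^+t=\max\{0,\log t\}$, $|\cdot|_v=\|\cdot\|_v^{[K_v:\mathbb{Q}_p]/[K:\mathbb{Q}]}$, and, for $v$ dividing the place $p$ of $\mathbb{Q}$, $\|\cdot\|_v$ is the absolute value on $K_v$ extending the usual absolute value on $\mathbb{Q}_p$ ($\mathbb{Q}_\infty=\mathbb{R}$). This is independent of $K$. For $g\in\mathbb{Z}[x]$ with roots $\alpha_1,\ldots,\alpha_d$ (in $\overline{\mathbb{Q}}$, listed with multiplicity, $d=\deg g$), the logarithmic Mahler measure is defined here as $\mu(g)=\sum_{k=1}^d h(\alpha_k)$. *)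

theory Defs
  imports
    "HOL-Algebra.Algebraic_Closure_Type"
    "HOL-Algebra.Generated_Fields"
    "HOL-Computational_Algebra.Computational_Algebra"
    "HOL-Analysis.Analysis"
begin

hide_const (open) Divisibility.prime Polynomials.degree Polynomials.lead_coeff

section \<open>Number fields and their places\<close>

text \<open>
  Number fields are realised as subfields \<open>K\<close> of the complex numbers that are finite-dimensional
  over \<open>\<rat>\<close>. In this way \<open>\<rat>(\<alpha>)\<close> makes sense for every algebraic \<open>\<alpha>\<close>.
\<close>

abbreviation complex_ring :: "complex ring" where
  "complex_ring \<equiv> ring_of_type_algebra"

definition number_field_degree :: "complex set \<Rightarrow> nat" where
  "number_field_degree K = ring.dim complex_ring \<rat> K"

definition padic_abs :: "nat \<Rightarrow> rat \<Rightarrow> real" where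
  "padic_abs p q = (if q = 0 then 0 else
     (let (a, b) = quotient_of q
      in real p powi (int (multiplicity (int p) b) - int (multiplicity (int p) a))))"

definition absolute_value_on :: "complex set \<Rightarrow> (complex \<Rightarrow> real) \<Rightarrow> bool" where
  "absolute_value_on K v \<longleftrightarrow>
     (\<forall>x\<in>K. v x \<ge> 0) \<and>
     (\<forall>x\<in>K. v x = 0 \<longleftrightarrow> x = 0) \<and>
     (\<forall>x\<in>K. \<forall>y\<in>K. v (x * y) = v x * v y) \<and>
     (\<forall>x\<in>K. \<forall>y\<in>K. v (x + y) \<le> v x + v y)"

text \<open>
  A place of \<open>K\<close> is represented by the unique absolute value in its class whose restriction to
  \<open>\<rat>\<close> is the usual absolute value or the usual p-adic one for some prime p. Values outside \<open>K\<close> are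
  fixed by \<^const>\<open>extensional\<close>, so that no place is counted twice.
\<close>

definition places :: "complex set \<Rightarrow> (complex \<Rightarrow> real) set" where
  "places K = {v. v \<in> extensional K \<and> absolute_value_on K v \<and>
     ((\<forall>q::rat. v (of_rat q) = \<bar>of_rat q\<bar>) \<or>
      (\<exists>p. prime p \<and> (\<forall>q. v (of_rat q) = padic_abs p q)))}"

section \<open>Completions and local degrees\<close>

text \<open>
  The completion \<open>K\<^sub>v\<close> is the ring of \<open>v\<close>-Cauchy sequences in \<open>K\<close>, with pointwise operations,
  modulo the ideal of null sequences.
\<close>

definition cauchy_ring :: "complex set \<Rightarrow> (complex \<Rightarrow> real) \<Rightarrow> (nat \<Rightarrow> complex) ring" where
  "cauchy_ring K v = \<lparr>
     carrier = {s. range s \<subseteq> K \<and> (\<forall>e>0. \<exists>N. \<forall>i\<ge>N. \<forall>j\<ge>N. v (s i - s j) < e)},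
     monoid.mult = (\<lambda>s t i. s i * t i),
     one = (\<lambda>_. 1),
     ring.zero = (\<lambda>_. 0),
     add = (\<lambda>s t i. s i + t i)\<rparr>"

definition null_ideal :: "complex set \<Rightarrow> (complex \<Rightarrow> real) \<Rightarrow> (nat \<Rightarrow> complex) set" where
  "null_ideal K v = {s \<in> carrier (cauchy_ring K v). (\<lambda>i. v (s i)) \<longlonglongrightarrow> 0}"

definition completion :: "complex set \<Rightarrow> (complex \<Rightarrow> real) \<Rightarrow> (nat \<Rightarrow> complex) set ring" where
  "completion K v = cauchy_ring K v Quot null_ideal K v"

text \<open>
  The copy of \<open>\<rat>\<^sub>p\<close> (of \<open>\<real>\<close> if \<open>v\<close> is archimedean) inside \<open>K\<^sub>v\<close>: the classes of Cauchy
  sequences of rationals.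
\<close>

definition rat_completion :: "complex set \<Rightarrow> (complex \<Rightarrow> real) \<Rightarrow> (nat \<Rightarrow> complex) set set" where
  "rat_completion K v =
     {null_ideal K v +>\<^bsub>cauchy_ring K v\<^esub> s | s. s \<in> carrier (cauchy_ring K v) \<and> range s \<subseteq> \<rat>}"

definition local_degree :: "complex set \<Rightarrow> (complex \<Rightarrow> real) \<Rightarrow> nat" where
  "local_degree K v =
     ring.dim (completion K v) (rat_completion K v) (carrier (completion K v))"

section \<open>Weil height and Mahler measure\<close>

definition normalized_abs :: "complex set \<Rightarrow> (complex \<Rightarrow> real) \<Rightarrow> complex \<Rightarrow> real" where
  "normalized_abs K v x = v x powr (real (local_degree K v) / real (number_field_degree K))"

text \<open>The library has \<open>ln 0 = 0\<close>, so \<open>log_plus 0 = 0\<close> as required.\<close>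

definition log_plus :: "real \<Rightarrow> real" where
  "log_plus t = max 0 (ln t)"

definition weil_height_in :: "complex set \<Rightarrow> complex \<Rightarrow> real" where
  "weil_height_in K \<alpha> = (\<Sum>\<^sub>\<infinity>v\<in>places K. log_plus (normalized_abs K v \<alpha>))"

text \<open>
  The height of an algebraic number does not depend on the number field containing it that is
  used to compute it; here it is taken in \<open>\<rat>(\<alpha>)\<close>.
\<close>

definition weil_height :: "complex \<Rightarrow> real" where
  "weil_height \<alpha> = weil_height_in (generate_field complex_ring {\<alpha>}) \<alpha>"

text \<open>
  The sum of the heights of the roots, with multiplicity (\<^const>\<open>proots\<close> is a multiset). For
  non-primitive \<open>g\<close> the usual logarithmic Mahler measure is larger by the logarithm of the
  content of \<open>g\<close>.
\<close>

definition log_mahler_measure :: "int poly \<Rightarrow> real" where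
  "log_mahler_measure g = (\<Sum>\<alpha>\<in>#proots (map_poly of_int g :: complex poly). weil_height \<alpha>)"

section \<open>Cyclotomic polynomials\<close>

definition cyclotomic :: "int poly \<Rightarrow> bool" where
  "cyclotomic P \<longleftrightarrow> (\<exists>k\<ge>1. (map_poly of_int P :: complex poly) =
     (\<Prod>j | j \<in> {1..k} \<and> coprime j k. [:- cis (2 * pi * real j / real k), 1:]))"

section \<open>The constant\<close>

lemma mahler_const_ex1:
  "\<exists>!c::real. c > 0 \<and> c * exp (c / 2) * ln 3 = ln (3 / 2) * ln 2"
proof -
  define F where "F = (\<lambda>c::real. c * exp (c / 2) * ln 3)"
  have mono: "F x < F y" if "0 \<le> x" "x < y" for x y
    using that unfolding F_def by (intro mult_strict_right_mono mult_strict_mono) auto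
  have rhs: "0 < ln (3 / 2) * ln (2::real)" by simp
  have "ln (3 / 2) * ln 2 \<le> ln 3 * (1::real)"
    using ln_2_less_1 by (intro mult_mono) auto
  also have "\<dots> \<le> F 1" by (simp add: F_def)
  finally have "\<exists>x\<ge>0. x \<le> 1 \<and> F x = ln (3 / 2) * ln 2"
    using rhs by (intro IVT') (auto simp: F_def intro!: continuous_intros)
  then obtain c where c: "0 \<le> c" "F c = ln (3 / 2) * ln 2" by blast
  have "c \<noteq> 0" using c rhs by (auto simp: F_def)
  hence "c > 0" using c by simp
  moreover have "c' = c" if "c' > 0" "F c' = ln (3 / 2) * ln 2" for c'
    using mono[of c c'] mono[of c' c] that c by (cases c c' rule: linorder_cases) auto
  ultimately have "\<exists>!c. c > 0 \<and> F c = ln (3 / 2) * ln 2" using c(2) by metis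
  thus ?thesis unfolding F_def .
qed

definition mahler_const :: real where
  "mahler_const = (THE c. c > 0 \<and> c * exp (c / 2) * ln 3 = ln (3 / 2) * ln 2)"

lemma mahler_const:
  "mahler_const > 0" "mahler_const * exp (mahler_const / 2) * ln 3 = ln (3 / 2) * ln 2"
  using theI'[OF mahler_const_ex1] unfolding mahler_const_def by auto

lemma mahler_const_bounds: "mahler_const \<in> {0.22823<..<0.22824}"
proof -
  define F where "F = (\<lambda>c::real. c * exp (c / 2) * ln 3)"
  have mono: "F x \<le> F y" if "0 \<le> x" "x \<le> y" for x y
    using that unfolding F_def by (intro mult_right_mono mult_mono) auto
  have Fc: "F mahler_const = ln (3 / 2) * ln 2" using mahler_const(2) unfolding F_def .
  have l2: "0.69314717 \<le> ln (2::real)" "ln (2::real) \<le> 0.69314719"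
    using ln_approx_bounds[of 2 8] by (simp_all add: eval_nat_numeral)
  have l32: "0.40546510 \<le> ln (3 / 2::real)" "ln (3 / 2::real) \<le> 0.40546511"
    using ln_approx_bounds[of "3 / 2" 6] by (simp_all add: eval_nat_numeral)
  have "ln (3 / 2 * 2::real) = ln (3 / 2) + ln 2" by (rule ln_mult_pos) auto
  hence l3: "1.09861227 \<le> ln (3::real)" "ln (3::real) \<le> 1.0986123" using l2 l32 by auto
  have e1: "exp (0.22823 / 2::real) \<le> 1.120882"
  proof -
    obtain t :: real where t: "\<bar>t\<bar> \<le> \<bar>0.22823 / 2\<bar>"
      "exp (0.22823 / 2) = (\<Sum>m<6. (0.22823 / 2) ^ m / fact m) + exp t / fact 6 * (0.22823 / 2) ^ 6"
      using Maclaurin_exp_le by blast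
    have "exp t \<le> exp 1" using t(1) by simp
    hence "exp t \<le> 3" using exp_le by linarith
    thus ?thesis unfolding t(2) by (simp add: eval_nat_numeral fact_numeral)
  qed
  have e2: "1.120886 \<le> exp (0.22824 / 2::real)"
  proof -
    obtain t :: real where t:
      "exp (0.22824 / 2) = (\<Sum>m<6. (0.22824 / 2) ^ m / fact m) + exp t / fact 6 * (0.22824 / 2) ^ 6"
      using Maclaurin_exp_le by blast
    have "1.120886 \<le> (\<Sum>m<6. (0.22824 / 2) ^ m / fact m :: real)"
      by (simp add: eval_nat_numeral fact_numeral)
    thus ?thesis unfolding t by (rule add_increasing2[rotated]) simp
  qed
  have "F 0.22823 \<le> 0.22823 * 1.120882 * 1.0986123"
    unfolding F_def using e1 l3 by (intro mult_mono) auto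
  also have "\<dots> < 0.40546510 * (0.69314717::real)" by simp
  also have "\<dots> \<le> F mahler_const" unfolding Fc using l2 l32 by (intro mult_mono) auto
  finally have lower: "0.22823 < mahler_const" using mono[of mahler_const "0.22823"] mahler_const(1) by force
  have "F mahler_const \<le> 0.40546511 * 0.69314719"
    unfolding Fc using l2 l32 by (intro mult_mono) auto
  hence "F mahler_const < 0.22824 * 1.120886 * 1.09861227" by simp
  also have "\<dots> \<le> F 0.22824" unfolding F_def using e2 l3 by (intro mult_mono) auto
  finally have "mahler_const < 0.22824" using mono[of "0.22824" mahler_const] by force
  with lower show ?thesis by simp
qed

end

theory Submission
  imports Defs "Jordan_Normal_Form.Char_Poly" "HOL-Number_Theory.Cong"
begin

text \<open>
  Let \<open>\<alpha>\<close> be a root of \<open>g\<close> and let \<open>p\<close> be a prime dividing \<open>m\<close>. Modulo \<open>p\<close>, the polynomial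
  \<open>x\<^sup>N - 1\<close> with \<open>N = n q\<close> and \<open>q \<ge> r\<close> a power of \<open>p\<close> is a multiple of \<open>f\<close>, so
  \<open>\<alpha>\<^sup>N - 1 = p H(\<alpha>)\<close> for some integer polynomial \<open>H\<close> of degree at most \<open>N\<close>. The product
  formula for \<open>H(\<alpha>)\<close>, which is nonzero as \<open>\<alpha>\<close> is not a root of unity, gives
  \<open>h(\<alpha>) \<ge> log (p/2) / N\<close>. Using \<open>x\<^sup>2\<^sup>N - 1\<close> for \<open>p = 2\<close> and \<open>(x\<^sup>n - 1)\<^sup>r\<close> for large \<open>p\<close>, one gets
  \<open>h(\<alpha>) \<ge> c / (n 2\<^sup>r)\<close> in all cases.

  The product formula is only needed for the rational norm of \<open>H(\<alpha>)\<close>. Fix an extension of each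
  p-adic absolute value to the algebraic numbers. Composing it with the embeddings of
  \<open>\<rat>(\<alpha>)\<close> gives places, and the local degree of each of them is at least the number of embeddings
  inducing it. This bounds \<open>h(\<alpha>)\<close> from below by the local heights of the conjugates of \<open>\<alpha>\<close>.
\<close>

section \<open>Algebraic numbers\<close>

text \<open>The height is an \<open>infsum\<close>, which is 0 for a family that is not summable. A
  lower bound therefore requires that \<alpha> be large at only finitely many places, which comes
  from the Artin-Whaples approximation argument. Equality between local degrees and numbers of
  embeddings would involve factoring the minimal polynomial over the p-adic numbers; for a lower
  bound the inequality suffices, and interpolation at conjugates gives it.

  The reason for passing from (x^n - 1)^r to x^N - 1 is the archimedean side: the former costs r log
  2 in the product formula, which exceeds the gain log p unless p > 2^r, while the latter costs only
  log 2. At p = 2 gain and cost cancel; there x^(2N) - 1 is divisible by 4 at the roots of f, and a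
  gain reappears.

  The hypothesis on g speaks of polynomials, whereas the argument wants its roots not to be roots of
  unity. The bridge is that the minimal polynomial of a root of unity is cyclotomic and divides g
  over the integers.\<close>

interpretation CR: cring complex_ring
  by (rule cring_from_type_algebra)

lemma complex_ring_field: "Ring.field complex_ring"
  by (rule field_from_type_algebra)

lemma complex_ring_domain: "domain complex_ring"
  using complex_ring_field by (simp add: Ring.field_def)

lemma complex_ring_simps [simp]:
  "carrier complex_ring = UNIV" "x \<otimes>\<^bsub>complex_ring\<^esub> y = x * y" "x \<oplus>\<^bsub>complex_ring\<^esub> y = x + y"
  "\<one>\<^bsub>complex_ring\<^esub> = 1" "\<zero>\<^bsub>complex_ring\<^esub> = 0"
  by (simp_all add: ring_of_type_algebra_def)

lemma complex_ring_minus [simp]: "\<ominus>\<^bsub>complex_ring\<^esub> x = - x"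
  by (rule CR.minus_equality) auto

lemma complex_ring_inv [simp]: "x \<noteq> 0 \<Longrightarrow> inv\<^bsub>complex_ring\<^esub> x = inverse x"
  by (rule CR.comm_inv_char) auto

lemma complex_ring_pow [simp]: "x [^]\<^bsub>complex_ring\<^esub> (n::nat) = x ^ n"
  by (induction n) (auto simp: CR.nat_pow_Suc)

lemma complex_ring_subfieldI:
  assumes "1 \<in> K" "\<And>x. x \<in> K \<Longrightarrow> - x \<in> K" "\<And>x y. x \<in> K \<Longrightarrow> y \<in> K \<Longrightarrow> x * y \<in> K"
    "\<And>x y. x \<in> K \<Longrightarrow> y \<in> K \<Longrightarrow> x + y \<in> K" "\<And>x. x \<in> K \<Longrightarrow> x \<noteq> 0 \<Longrightarrow> inverse x \<in> K"
  shows "subfield K complex_ring"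
  by (intro field.subfieldI'[OF complex_ring_field] CR.subringI) (auto simp: assms)

lemma Rats_subfield: "subfield \<rat> complex_ring"
  by (rule complex_ring_subfieldI) auto

locale complex_subfield =
  fixes F :: "complex set"
  assumes subfield: "subfield F complex_ring"
begin

lemma F_zero [simp]: "0 \<in> F" and F_one [simp]: "1 \<in> F"
  and F_minus: "x \<in> F \<Longrightarrow> - x \<in> F"
  and F_mult: "x \<in> F \<Longrightarrow> y \<in> F \<Longrightarrow> x * y \<in> F"
  and F_add: "x \<in> F \<Longrightarrow> y \<in> F \<Longrightarrow> x + y \<in> F"
  using subringE(2,3,5-7)[OF subfieldE(1)[OF subfield]] by simp_all

lemma F_diff: "x \<in> F \<Longrightarrow> y \<in> F \<Longrightarrow> x - y \<in> F"
  using F_add[of x "- y"] F_minus by simp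

lemma F_inverse: "x \<in> F \<Longrightarrow> inverse x \<in> F"
  using CR.subfield_m_inv(1)[OF subfield, of x] by (cases "x = 0") auto

lemma F_power: "x \<in> F \<Longrightarrow> x ^ n \<in> F"
  by (induction n) (auto intro: F_mult)

lemma F_power_int: "x \<in> F \<Longrightarrow> x powi k \<in> F"
  by (auto simp: power_int_def intro: F_power F_inverse)

lemma F_sum: "(\<And>i. i \<in> I \<Longrightarrow> f i \<in> F) \<Longrightarrow> (\<Sum>i\<in>I. f i) \<in> F"
  by (induction I rule: infinite_finite_induct) (auto intro: F_add)

lemma F_prod: "(\<And>i. i \<in> I \<Longrightarrow> f i \<in> F) \<Longrightarrow> (\<Prod>i\<in>I. f i) \<in> F"
  by (induction I rule: infinite_finite_induct) (auto intro: F_mult)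

lemma F_nat [simp]: "of_nat n \<in> F"
  by (induction n) (auto intro: F_add)

lemma F_int [simp]: "of_int n \<in> F"
  by (cases n rule: int_cases2) (auto intro: F_minus)

lemma F_rat [simp]: "of_rat q \<in> F"
proof (cases q)
  case (Fract a b)
  hence "(of_rat q :: complex) = of_int a * inverse (of_int b)"
    by (simp add: of_rat_rat divide_inverse)
  thus ?thesis by (simp add: F_mult F_inverse)
qed

end

text \<open>The list polynomials of the algebraic closure theory start with the leading coefficient,
  those of \<open>Poly\<close> with the constant term; hence \<open>rev\<close>.\<close>

lemma complex_ring_eval: "CR.eval q x = poly (Poly (rev q)) x"
  by (induction q) (auto simp: Poly_append poly_monom)

text \<open>Gives access to the fact that the elements algebraic over a subfield form a field, and
  so to the closure of algebraic numbers under the field operations.\<close>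

lemma algebraic_over_Rats_iff: "(CR.algebraic over \<rat>) x \<longleftrightarrow> algebraic x"
proof
  assume "(CR.algebraic over \<rat>) x"
  then obtain p where p: "p \<in> carrier (univ_poly complex_ring \<rat>)" "p \<noteq> []" "CR.eval p x = \<zero>\<^bsub>complex_ring\<^esub>"
    using domain.algebraicE[OF complex_ring_domain subfieldE(1)[OF Rats_subfield], of x] by auto
  have *: "set p \<subseteq> \<rat>" "hd p \<noteq> 0"
    using p(1,2) unfolding univ_poly_def polynomial_def by auto
  define q where "q = Poly (rev p)"
  have "coeff q i \<in> \<rat>" for i
    using *(1) unfolding q_def coeff_Poly_eq by (auto simp: nth_default_def rev_nth subset_iff)
  moreover have "q \<noteq> 0"
    using *(2) p(2) unfolding q_def Poly_eq_0 by (metis hd_rev last_replicate rev_is_Nil_conv rev_rev_ident replicate_0)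
  moreover have "poly q x = 0" using p(3) unfolding q_def by (simp add: complex_ring_eval)
  ultimately show "algebraic x" unfolding algebraic_altdef by blast
next
  assume "algebraic x"
  then obtain q where q: "\<forall>i. coeff q i \<in> \<rat>" "q \<noteq> 0" "poly q x = 0"
    unfolding algebraic_altdef by blast
  define p where "p = rev (coeffs q)"
  have "p \<in> carrier (univ_poly complex_ring \<rat>)"
    using q(1,2) by (auto simp: p_def univ_poly_def polynomial_def hd_rev last_coeffs_eq_coeff_degree coeffs_def)
  moreover have "p \<noteq> []" using q by (simp add: p_def)
  moreover have "CR.eval p x = \<zero>\<^bsub>complex_ring\<^esub>" using q by (simp add: complex_ring_eval p_def)
  ultimately show "(CR.algebraic over \<rat>) x" by (rule CR.algebraicI)
qed

lemma algebraic_subfield: "subfield {x::complex. algebraic x} complex_ring"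
  using field.subfield_of_algebraics[OF complex_ring_field Rats_subfield] by (simp add: algebraic_over_Rats_iff)

interpretation Alg: complex_subfield "{x. algebraic x}"
  by (rule complex_subfield.intro[OF algebraic_subfield])

lemmas algebraic_add = Alg.F_add[unfolded mem_Collect_eq]
  and algebraic_mult = Alg.F_mult[unfolded mem_Collect_eq]
  and algebraic_diff = Alg.F_diff[unfolded mem_Collect_eq]
  and algebraic_power = Alg.F_power[unfolded mem_Collect_eq]
  and algebraic_sum = Alg.F_sum[unfolded mem_Collect_eq]
  and algebraic_prod = Alg.F_prod[unfolded mem_Collect_eq]

section \<open>Absolute values on subfields of the complex numbers\<close>

locale absolute_value_field = complex_subfield +
  fixes v :: "complex \<Rightarrow> real"
  assumes absolute_value: "absolute_value_on F v"
begin

lemma v_nonneg: "x \<in> F \<Longrightarrow> v x \<ge> 0"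
  and v_eq_0: "x \<in> F \<Longrightarrow> v x = 0 \<longleftrightarrow> x = 0"
  and v_mult: "x \<in> F \<Longrightarrow> y \<in> F \<Longrightarrow> v (x * y) = v x * v y"
  and v_triangle: "x \<in> F \<Longrightarrow> y \<in> F \<Longrightarrow> v (x + y) \<le> v x + v y"
  using absolute_value unfolding absolute_value_on_def by auto

lemma v_0 [simp]: "v 0 = 0" using v_eq_0[of 0] by simp
lemma v_1 [simp]: "v 1 = 1" using v_mult[of 1 1] v_eq_0[of 1] by simp

lemma v_minus [simp]:
  assumes "x \<in> F" shows "v (- x) = v x"
proof -
  have m1: "- 1 \<in> F" using F_minus F_one by blast
  have "v (- 1) * v (- 1) = 1" using v_mult[OF m1 m1] by simp
  hence "v (- 1) = 1" using v_nonneg[OF m1] by (metis abs_of_nonneg abs_mult_self_eq mult_1 power2_eq_square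
        power2_eq_iff_nonneg zero_le_one)
  thus ?thesis using v_mult[OF m1 assms] by simp
qed

lemma v_diff: "x \<in> F \<Longrightarrow> y \<in> F \<Longrightarrow> v (x - y) \<le> v x + v y"
  using v_triangle[of x "- y"] F_minus by simp

lemma v_diff_commute: "x \<in> F \<Longrightarrow> y \<in> F \<Longrightarrow> v (x - y) = v (y - x)"
  using v_minus[of "x - y"] F_diff by simp

lemma v_diff_triangle: "x \<in> F \<Longrightarrow> y \<in> F \<Longrightarrow> z \<in> F \<Longrightarrow> v (x - z) \<le> v (x - y) + v (y - z)"
  using v_triangle[of "x - y" "y - z"] F_diff by simp

lemma v_power: "x \<in> F \<Longrightarrow> v (x ^ n) = v x ^ n"
  by (induction n) (auto simp: v_mult F_power)

lemma v_inverse: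
  assumes "x \<in> F" shows "v (inverse x) = inverse (v x)"
proof (cases "x = 0")
  case False
  hence "v x * v (inverse x) = 1" using v_mult[OF assms F_inverse[OF assms]] by simp
  thus ?thesis by (metis inverse_unique)
qed simp

lemma v_sum: "(\<And>i. i \<in> I \<Longrightarrow> f i \<in> F) \<Longrightarrow> v (\<Sum>i\<in>I. f i) \<le> (\<Sum>i\<in>I. v (f i))"
proof (induction I rule: infinite_finite_induct)
  case (insert a I)
  hence "v (f a + (\<Sum>i\<in>I. f i)) \<le> v (f a) + v (\<Sum>i\<in>I. f i)" by (intro v_triangle F_sum) auto
  thus ?case using insert by simp
qed auto

lemma v_prod: "(\<And>i. i \<in> I \<Longrightarrow> f i \<in> F) \<Longrightarrow> v (\<Prod>i\<in>I. f i) = (\<Prod>i\<in>I. v (f i))"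
  by (induction I rule: infinite_finite_induct) (auto simp: v_mult F_prod)

lemma v_power_int: "x \<in> F \<Longrightarrow> v (x powi k) = v x powi k"
  by (auto simp: power_int_def v_power F_inverse v_inverse)

text \<open>The power trick: the binomial theorem bounds the value of \<open>(x + y) ^ n\<close> by
  \<open>(n + 1) * M ^ n\<close> with \<open>M = max (v x) (v y)\<close>. If
  \<open>v (x + y)\<close> exceeded \<open>M\<close>, the ratio \<open>t > 1\<close> would satisfy
  \<open>t ^ n \<le> n + 1\<close> for all \<open>n\<close>.\<close>

lemma v_ultrametric:
  assumes int: "\<And>n::nat. v (of_nat n) \<le> 1" and xy: "x \<in> F" "y \<in> F"
  shows "v (x + y) \<le> max (v x) (v y)"
proof (rule ccontr)
  define M where "M = max (v x) (v y)"
  assume "\<not> v (x + y) \<le> max (v x) (v y)"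
  hence gt: "v (x + y) > M" unfolding M_def not_le .
  have M0: "M \<ge> 0" unfolding M_def using v_nonneg xy by (auto simp: le_max_iff_disj)
  have "M \<noteq> 0"
  proof
    assume "M = 0"
    hence "v x = 0" "v y = 0" using v_nonneg[OF xy(1)] v_nonneg[OF xy(2)] unfolding M_def by linarith+
    hence "x = 0" "y = 0" using v_eq_0 xy by auto
    thus False using gt \<open>M = 0\<close> by simp
  qed
  hence Mpos: "M > 0" using M0 by simp
  define t where "t = v (x + y) / M"
  have t: "t > 1" using gt Mpos by (simp add: t_def)
  have le: "t ^ n \<le> real n + 1" for n
  proof -
      have "v (x + y) ^ n = v (\<Sum>k\<le>n. of_nat (n choose k) * x ^ k * y ^ (n - k))"
      using v_power[OF F_add[OF xy], of n] by (simp add: binomial_ring)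
    also have "\<dots> \<le> (\<Sum>k\<le>n. v (of_nat (n choose k) * x ^ k * y ^ (n - k)))"
      using xy by (intro v_sum F_mult F_power) auto
    also have "\<dots> = (\<Sum>k\<le>n. v (of_nat (n choose k)) * v x ^ k * v y ^ (n - k))"
      using xy by (intro sum.cong refl) (simp add: v_mult F_mult F_power v_power)
    also have "\<dots> \<le> (\<Sum>k\<le>n. 1 * M ^ k * M ^ (n - k))"
      using int M0 v_nonneg xy by (intro sum_mono mult_mono power_mono mult_nonneg_nonneg) (auto simp: M_def)
    also have "\<dots> = (\<Sum>k\<le>n. M ^ n)" by (intro sum.cong refl) (simp flip: power_add)
    also have "\<dots> = (real n + 1) * M ^ n" by simp
    finally show ?thesis using Mpos by (simp add: t_def power_divide divide_le_eq)
  qed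
  have lim: "(\<lambda>n. of_nat n / t ^ n) \<longlonglongrightarrow> 0" using t by (intro lim_n_over_pown) auto
  have lim2: "(\<lambda>n. (1 / t) ^ n) \<longlonglongrightarrow> 0" using t by (intro LIMSEQ_power_zero) auto
  have "(\<lambda>n. of_nat n / t ^ n + (1 / t) ^ n) \<longlonglongrightarrow> 0 + 0" by (rule tendsto_add[OF lim lim2])
  moreover have "of_nat n / t ^ n + (1 / t) ^ n \<ge> 1" for n
    using le[of n] t by (simp add: power_divide field_simps)
  ultimately have "0 + 0 \<ge> (1::real)" by (intro LIMSEQ_le_const) auto
  thus False by simp
qed

end

section \<open>The p-adic absolute value on the rationals\<close>

lemma padic_abs_of_int: "padic_abs p (of_int a) = (if a = 0 then 0 else real p powi (- int (multiplicity (int p) a)))"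
  by (simp add: padic_abs_def)

lemma padic_abs_self: "prime p \<Longrightarrow> padic_abs p (of_nat p) = inverse (real p)"
  using padic_abs_of_int[of p "int p"] multiplicity_self[of "int p"] prime_gt_0_nat[of p]
  by (simp add: power_int_minus)

lemma padic_abs_other:
  assumes "prime p" "prime q" "p \<noteq> q"
  shows "padic_abs p (of_nat q) = 1"
proof -
  have "\<not> int p dvd int q" using assms by (metis int_dvd_int_iff primes_dvd_imp_eq)
  thus ?thesis using padic_abs_of_int[of p "int q"] prime_gt_0_nat[OF assms(2)]
    by (simp add: not_dvd_imp_multiplicity_0)
qed

lemma padic_abs_int_le_one: "prime p \<Longrightarrow> padic_abs p (of_int k) \<le> 1"
  using padic_abs_of_int[of p k] prime_gt_1_nat[of p] by (auto simp: power_int_minus inverse_le_1_iff)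

locale padic_value = absolute_value_field +
  fixes p :: nat
  assumes prime_p: "prime p"
    and v_rat: "v (of_rat q) = padic_abs p q"
begin

lemma v_int: "v (of_int k) \<le> 1"
  using v_rat[of "of_int k"] padic_abs_int_le_one[OF prime_p] by simp

lemma ultrametric: "x \<in> F \<Longrightarrow> y \<in> F \<Longrightarrow> v (x + y) \<le> max (v x) (v y)"
  using v_int[of "int n" for n] by (intro v_ultrametric) auto

lemma v_sum_le:
  "(\<And>i. i \<in> I \<Longrightarrow> f i \<in> F) \<Longrightarrow> (\<And>i. i \<in> I \<Longrightarrow> v (f i) \<le> B) \<Longrightarrow> B \<ge> 0 \<Longrightarrow> v (\<Sum>i\<in>I. f i) \<le> B"
proof (induction I rule: infinite_finite_induct)
  case (insert i I)
  hence "v (f i + sum f I) \<le> max (v (f i)) (v (sum f I))" by (intro ultrametric F_sum) auto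
  also have "\<dots> \<le> B" using insert by auto
  finally show ?case using insert by simp
qed auto

end

section \<open>Extending the p-adic absolute value to the algebraic numbers\<close>

text \<open>A subring of the complex numbers that is maximal among those not containing \<open>1/p\<close> is a
  valuation ring, whose valuation has rank one on the algebraic numbers.\<close>

locale maximal_subring =
  fixes p :: nat and A :: "complex set"
  assumes prime_p: "prime p"
    and one_mem: "1 \<in> A"
    and diff_mem: "x \<in> A \<Longrightarrow> y \<in> A \<Longrightarrow> x - y \<in> A"
    and mult_mem: "x \<in> A \<Longrightarrow> y \<in> A \<Longrightarrow> x * y \<in> A"
    and inverse_p_notin: "inverse (of_nat p) \<notin> A"
    and maximal: "\<lbrakk>1 \<in> B; \<And>x y. x \<in> B \<Longrightarrow> y \<in> B \<Longrightarrow> x - y \<in> B;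
      \<And>x y. x \<in> B \<Longrightarrow> y \<in> B \<Longrightarrow> x * y \<in> B; A \<subseteq> B; inverse (of_nat p) \<notin> B\<rbrakk> \<Longrightarrow> B = A"

text \<open>Zorn's lemma for the subrings without 1/p, a nonempty family because
  \<open>\<int>\<close> belongs to it.\<close>

lemma ex_maximal_subring:
  assumes "prime p"
  shows "\<exists>A. maximal_subring p A"
proof -
  define good where "good = (\<lambda>A::complex set. 1 \<in> A \<and> (\<forall>x\<in>A. \<forall>y\<in>A. x - y \<in> A) \<and>
    (\<forall>x\<in>A. \<forall>y\<in>A. x * y \<in> A) \<and> inverse (of_nat p) \<notin> A)"
  have "inverse (of_nat p :: complex) \<notin> \<int>"
  proof
    assume "inverse (of_nat p :: complex) \<in> \<int>"
    then obtain k where k: "inverse (of_nat p :: complex) = of_int k" by (auto elim: Ints_cases)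
    have "p \<ge> 2" using assms prime_ge_2_nat by blast
    hence "(of_int (k * int p) :: complex) = of_int 1"
      using k by (simp add: field_simps)
    hence "k * int p = 1" by (rule of_int_eq_iff[THEN iffD1])
    thus False using \<open>p \<ge> 2\<close> by (simp add: zmult_eq_1_iff)
  qed
  hence Z: "good \<int>" by (auto simp: good_def)
  have "\<exists>U\<in>{U. good U}. \<forall>V\<in>{U. good U}. U \<subseteq> V \<longrightarrow> V = U"
  proof (rule subset_Zorn_nonempty)
    show "{U. good U} \<noteq> {}" using Z by auto
  next
    fix Ch assume C: "Ch \<noteq> {}" "subset.chain ({U. good U}) Ch"
    have cover: "\<exists>V\<in>Ch. x \<in> V \<and> y \<in> V" if xy: "x \<in> \<Union> Ch" "y \<in> \<Union> Ch" for x y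
    proof -
      obtain V W where XY: "V \<in> Ch" "W \<in> Ch" "x \<in> V" "y \<in> W" using xy by blast
      hence "V \<subseteq> W \<or> W \<subseteq> V" using C(2) unfolding subset.chain_def by blast
      thus ?thesis using XY by blast
    qed
    have g: "good V" if "V \<in> Ch" for V using C(2) that unfolding subset.chain_def by blast
    have "x - y \<in> \<Union> Ch" "x * y \<in> \<Union> Ch" if "x \<in> \<Union> Ch" "y \<in> \<Union> Ch" for x y
      using cover[OF that] g unfolding good_def by blast+
    moreover have "1 \<in> \<Union> Ch" using C(1) g unfolding good_def by blast
    moreover have "inverse (of_nat p) \<notin> \<Union> Ch" using g unfolding good_def by blast
    ultimately show "\<Union> Ch \<in> {U. good U}" unfolding good_def by blast
  qed
  then obtain M where M: "good M" "\<And>V. good V \<Longrightarrow> M \<subseteq> V \<Longrightarrow> V = M" by blast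
  have "maximal_subring p M"
  proof
    show "B = M" if "1 \<in> B" "\<And>x y. x \<in> B \<Longrightarrow> y \<in> B \<Longrightarrow> x - y \<in> B"
      "\<And>x y. x \<in> B \<Longrightarrow> y \<in> B \<Longrightarrow> x * y \<in> B" "M \<subseteq> B" "inverse (of_nat p) \<notin> B" for B
      using M(2)[of B] that unfolding good_def by blast
  qed (use M(1) assms in \<open>auto simp: good_def\<close>)
  thus ?thesis by blast
qed

context maximal_subring
begin

abbreviation P :: complex where "P \<equiv> of_nat p"

lemma p_pos [simp]: "p > 0"
  using prime_p by (auto dest: prime_gt_0_nat)

lemma P_nonzero: "P \<noteq> 0"
  by simp

lemma P_powi_add: "P powi a * P powi b = P powi (a + b)"
  by (rule power_int_add[symmetric]) simp

lemma zero_mem: "0 \<in> A" using diff_mem[OF one_mem one_mem] by simp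
lemma minus_mem: "x \<in> A \<Longrightarrow> - x \<in> A" using diff_mem[OF zero_mem] by simp
lemma add_mem: "x \<in> A \<Longrightarrow> y \<in> A \<Longrightarrow> x + y \<in> A" using diff_mem[OF _ minus_mem, of x y] by simp
lemma sum_mem: "(\<And>i. i \<in> I \<Longrightarrow> f i \<in> A) \<Longrightarrow> (\<Sum>i\<in>I. f i) \<in> A"
  by (induction I rule: infinite_finite_induct) (auto intro: zero_mem add_mem)
lemma power_mem: "x \<in> A \<Longrightarrow> x ^ n \<in> A"
  by (induction n) (auto intro: one_mem mult_mem)
lemma of_nat_mem: "of_nat n \<in> A"
  by (induction n) (auto intro: zero_mem one_mem add_mem)
lemma of_int_mem: "of_int n \<in> A"
  by (cases n) (auto intro: of_nat_mem minus_mem diff_mem one_mem)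

text \<open>Maximality in usable form: the ring generated by \<open>A\<close> and \<open>x\<close>
  is strictly larger than \<open>A\<close>, so it contains 1/p.\<close>

lemma adjoin:
  assumes "x \<notin> A"
  obtains f where "\<And>i. coeff f i \<in> A" "poly f x = inverse P"
proof -
  define B where "B = {poly f x | f. \<forall>i. coeff f i \<in> A}"
  have sub: "A \<subseteq> B"
  proof
    fix a assume a: "a \<in> A"
    have "poly [:a:] x = a" "\<forall>i. coeff [:a:] i \<in> A"
      using a zero_mem by (auto simp: coeff_pCons split: nat.splits)
    thus "a \<in> B" unfolding B_def by force
  qed
  have "inverse P \<in> B"
  proof (rule ccontr)
    assume notin: "inverse P \<notin> B"
    have "B = A"
    proof (rule maximal)
      show "1 \<in> B" using sub one_mem by blast
      show "y - z \<in> B" if yz: "y \<in> B" "z \<in> B" for y z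
      proof -
        obtain f g where f: "y = poly f x" "\<forall>i. coeff f i \<in> A" "z = poly g x" "\<forall>i. coeff g i \<in> A"
          using yz unfolding B_def by blast
        hence "y - z = poly (f - g) x" "\<forall>i. coeff (f - g) i \<in> A" by (auto intro: diff_mem)
        thus ?thesis unfolding B_def by blast
      qed
      show "y * z \<in> B" if yz: "y \<in> B" "z \<in> B" for y z
      proof -
        obtain f g where f: "y = poly f x" "\<forall>i. coeff f i \<in> A" "z = poly g x" "\<forall>i. coeff g i \<in> A"
          using yz unfolding B_def by blast
        hence "y * z = poly (f * g) x" "\<forall>i. coeff (f * g) i \<in> A"
          by (auto simp: coeff_mult intro!: sum_mem mult_mem)
        thus ?thesis unfolding B_def by blast
      qed
    qed (use sub notin in auto)
    moreover have "x \<in> B"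
    proof -
      have "poly [:0, 1:] x = x" "\<forall>i. coeff [:0, 1::complex:] i \<in> A"
        using zero_mem one_mem by (auto simp: coeff_pCons split: nat.splits)
      thus ?thesis unfolding B_def by force
    qed
    ultimately show False using assms by blast
  qed
  thus ?thesis using that unfolding B_def by force
qed

lemma one_minus_power:
  assumes "a \<in> A"
  obtains b where "b \<in> A" "(1 - P * a) ^ n = 1 - P * b"
proof -
  have "\<exists>b\<in>A. (1 - P * a) ^ n = 1 - P * b"
  proof (induction n)
    case 0
    thus ?case using zero_mem by (intro bexI[of _ 0]) auto
  next
    case (Suc n)
    then obtain b where b: "b \<in> A" "(1 - P * a) ^ n = 1 - P * b" by blast
    have "(1 - P * a) ^ Suc n = (1 - P * a) * (1 - P * b)" using b(2) by simp
    also have "\<dots> = 1 - P * (a + b - P * a * b)" by (simp add: algebra_simps)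
    finally have "(1 - P * a) ^ Suc n = 1 - P * (a + b - P * a * b)" .
    moreover have "a + b - P * a * b \<in> A"
      using assms b by (intro diff_mem add_mem mult_mem of_nat_mem) auto
    ultimately show ?case by blast
  qed
  thus ?thesis using that by blast
qed

text \<open>That is, \<open>p\<close> lies in the Jacobson radical of the maximal subring.\<close>

lemma inverse_one_minus_mem:
  assumes a: "a \<in> A"
  shows "1 - P * a \<noteq> 0" "inverse (1 - P * a) \<in> A"
proof -
  define u where "u = 1 - P * a"
  have u0: "u \<noteq> 0"
  proof
    assume "u = 0"
    hence "a * P = 1" by (simp add: u_def algebra_simps)
    hence "a = inverse P" by (simp add: eq_divide_eq inverse_eq_divide)
    thus False using a inverse_p_notin by simp
  qed
  have uA: "u \<in> A" using a unfolding u_def by (intro diff_mem one_mem mult_mem of_nat_mem)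
  show "1 - P * a \<noteq> 0" using u0 by (simp add: u_def)
  show "inverse (1 - P * a) \<in> A" unfolding u_def[symmetric]
  proof (rule ccontr)
    assume "inverse u \<notin> A"
    then obtain f where f: "\<And>i. coeff f i \<in> A" "poly f (inverse u) = inverse P" using adjoin by blast
    define n where "n = degree f"
    \<comment> \<open>Multiplying by \<open>u ^ n\<close> clears the powers of 1/u, so
      \<open>u ^ n\<close> / p lies in \<open>A\<close>. Since \<open>u ^ n\<close> is 1 modulo p,
      so does 1/p.\<close>
    have "u ^ n * poly f (inverse u) = (\<Sum>i\<le>n. coeff f i * u ^ (n - i))"
      unfolding poly_altdef n_def sum_distrib_left
    proof (intro sum.cong refl)
      fix i assume i: "i \<in> {..degree f}"
      have "u ^ degree f = u ^ (degree f - i) * u ^ i" using i by (simp flip: power_add)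
      thus "u ^ degree f * (coeff f i * inverse u ^ i) = coeff f i * u ^ (degree f - i)"
        using u0 by (simp add: field_simps)
    qed
    also have "\<dots> \<in> A" using f uA by (intro sum_mem mult_mem power_mem) auto
    finally have *: "u ^ n * inverse P \<in> A" using f by simp
    obtain b where b: "b \<in> A" "u ^ n = 1 - P * b"
      using one_minus_power[OF a, of n] unfolding u_def by blast
    have "inverse P = u ^ n * inverse P + b" using b by (simp add: field_simps)
    thus False using * b add_mem inverse_p_notin by metis
  qed
qed

text \<open>By Bezout some multiple of \<open>u\<close> has the form 1 - p t, which is invertible
  because p lies in the Jacobson radical.\<close>

lemma inverse_coprime_mem:
  assumes "coprime u (int p)"
  shows "inverse (of_int u) \<in> A"
proof -
  obtain s t where "s * u + t * int p = 1" using bezout_int[of u "int p"] assms by auto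
  hence "of_int (s * u + t * int p) = (1::complex)" by (metis of_int_1)
  hence st: "of_int s * of_int u = 1 - P * of_int t" by (simp add: algebra_simps)
  have "inverse (1 - P * of_int t) \<in> A" "1 - P * of_int t \<noteq> 0"
    using inverse_one_minus_mem of_int_mem by auto
  moreover have "inverse (of_int u) = of_int s * inverse (1 - P * of_int t)"
    using calculation(2) unfolding st[symmetric] by (auto simp: field_simps)
  ultimately show ?thesis using mult_mem of_int_mem by metis
qed

text \<open>The relation for 1/x, divided by the unit \<open>1 - P * coeff g 0\<close>, turns into a
  monic polynomial \<open>Q\<close> over \<open>A\<close> with root \<open>x\<close> and the degree
  of \<open>f\<close>. Subtracting a multiple of \<open>Q\<close> removes the leading term of
  \<open>f\<close> without changing the value at \<open>x\<close>.\<close>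

lemma reduce_degree:
  assumes x0: "x \<noteq> 0"
    and f: "\<And>i. coeff f i \<in> A" "poly f x = inverse P"
    and g: "\<And>i. coeff g i \<in> A" "poly g (inverse x) = inverse P"
    and le: "degree g \<le> degree f"
  obtains f' where "\<And>i. coeff f' i \<in> A" "poly f' x = inverse P" "degree f' < degree f"
proof -
  define n where "n = degree f"
  define m where "m = degree g"
  define u where "u = 1 - P * coeff g 0"
  have u: "u \<noteq> 0" "inverse u \<in> A" unfolding u_def using inverse_one_minus_mem g(1) by auto
  define h where "h = (\<lambda>i. P * coeff g i * inverse u)"
  have hA: "h i \<in> A" for i unfolding h_def using g u by (intro mult_mem of_nat_mem) auto
  have n0: "n > 0"
  proof (rule ccontr)
    assume "\<not> n > 0"
    then obtain c where "f = [:c:]" unfolding n_def by (auto elim: degree_eq_zeroE)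
    thus False using f(1)[of 0] f(2) inverse_p_notin by auto
  qed
  have "1 = P * poly g (inverse x)" unfolding g(2) by (rule right_inverse[OF P_nonzero, symmetric])
  also have "poly g (inverse x) = coeff g 0 + (\<Sum>i=1..m. coeff g i * inverse x ^ i)"
    unfolding poly_altdef m_def[symmetric] by (simp add: sum.atMost_shift sum.atLeast1_atMost_eq)
  finally have "u = (\<Sum>i=1..m. P * coeff g i * inverse x ^ i)"
    by (simp add: u_def algebra_simps sum_distrib_left)
  hence "1 = (\<Sum>i=1..m. P * coeff g i * inverse x ^ i) * inverse u" using u by simp
  also have "\<dots> = (\<Sum>i=1..m. h i * inverse x ^ i)"
    unfolding h_def sum_distrib_right by (intro sum.cong) auto
  finally have one: "1 = (\<Sum>i=1..m. h i * inverse x ^ i)" .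
  \<comment> \<open>This is \<open>x ^ n\<close> times the relation \<open>one\<close>. No exponent
    is truncated, as \<open>m \<le> n\<close>, and \<open>Q\<close> is monic because
    \<open>n > 0\<close> keeps every \<open>n - i\<close> with \<open>i \<ge> 1\<close> below
    \<open>n\<close>.\<close>
  define Q where "Q = monom 1 n - (\<Sum>i=1..m. monom (h i) (n - i))"
  have Q0: "poly Q x = 0"
  proof -
    have "x ^ n = x ^ n * (\<Sum>i=1..m. h i * inverse x ^ i)" using one by simp
    also have "\<dots> = (\<Sum>i=1..m. h i * x ^ (n - i))"
      unfolding sum_distrib_left
    proof (intro sum.cong refl)
      fix i assume i: "i \<in> {1..m}"
      hence "x ^ n = x ^ (n - i) * x ^ i" using le by (simp add: m_def n_def flip: power_add)
      thus "x ^ n * (h i * inverse x ^ i) = h i * x ^ (n - i)" using x0 by (simp add: field_simps)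
    qed
    finally show ?thesis by (simp add: Q_def poly_sum poly_monom)
  qed
  have QA: "coeff Q i \<in> A" for i
    unfolding Q_def using hA zero_mem one_mem by (auto simp: coeff_sum intro!: diff_mem minus_mem sum_mem)
  have Qn: "coeff Q n = 1"
  proof -
    have "coeff (monom (h i) (n - i)) n = 0" if "i \<in> {1..m}" for i using that n0 by auto
    thus ?thesis by (simp add: Q_def coeff_sum)
  qed
  have Qdeg: "coeff Q i = 0" if "i > n" for i
  proof -
    have "coeff (monom (h j) (n - j)) i = 0" for j using that by simp
    thus ?thesis using that by (simp add: Q_def coeff_sum)
  qed
  define f' where "f' = f - smult (coeff f n) Q"
  show ?thesis
  proof
    show "coeff f' i \<in> A" for i using f QA unfolding f'_def by (auto intro!: diff_mem mult_mem)
    show "poly f' x = inverse P" using f(2) Q0 by (simp add: f'_def)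
    have "coeff f' i = 0" if "i \<ge> n" for i
    proof (cases "i = n")
      case False
      hence "i > n" using that by simp
      thus ?thesis using Qdeg by (simp add: f'_def n_def coeff_eq_0)
    qed (simp add: f'_def Qn)
    hence "degree f' \<le> n - 1" using n0 by (intro degree_le) auto
    thus "degree f' < degree f" using n0 n_def by linarith
  qed
qed

text \<open>Descent on the sum of the two degrees: if neither \<open>x\<close> nor 1/x were in
  \<open>A\<close>, both would admit a polynomial with value 1/p, and the longer of the two could
  always be shortened by means of the other.\<close>

lemma valuation_ring:
  assumes "x \<notin> A" shows "inverse x \<in> A"
proof (rule ccontr)
  assume inv: "inverse x \<notin> A"
  have x0: "x \<noteq> 0" using assms zero_mem by auto
  have False if "\<And>i. coeff f i \<in> A" "poly f x = inverse P" "\<And>i. coeff g i \<in> A"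
    "poly g (inverse x) = inverse P" for f g
    using that
  proof (induction "degree f + degree g" arbitrary: f g rule: less_induct)
    case less
    show ?case
    proof (cases "degree g \<le> degree f")
      case True
      then obtain f' where f': "\<And>i. coeff f' i \<in> A" "poly f' x = inverse P" "degree f' < degree f"
        using reduce_degree[OF x0, of f g] less.prems by blast
      show ?thesis using less.hyps[of f' g] f' less.prems(3,4) by simp
    next
      case False
      then obtain g' where g': "\<And>i. coeff g' i \<in> A" "poly g' (inverse x) = inverse P" "degree g' < degree g"
        using reduce_degree[of "inverse x" g f] less.prems x0 by auto
      show ?thesis using less.hyps[of f g'] g' less.prems(1,2) by simp
    qed
  qed
  moreover obtain f where "\<And>i. coeff f i \<in> A" "poly f x = inverse P" using adjoin[OF assms] by blast
  moreover obtain g where "\<And>i. coeff g i \<in> A" "poly g (inverse x) = inverse P" using adjoin[OF inv] by blast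
  ultimately show False by blast
qed

text \<open>The part of integral closedness that makes the cut below independent of the fraction
  representing a rational.\<close>

lemma power_memD:
  assumes "z ^ k \<in> A" "k \<ge> 1"
  shows "z \<in> A"
proof (rule ccontr)
  assume z: "z \<notin> A"
  hence z0: "z \<noteq> 0" using zero_mem by auto
  have "z ^ k * inverse z ^ (k - 1) \<in> A"
    by (intro mult_mem[OF assms(1)] power_mem valuation_ring[OF z])
  also have "z ^ k * inverse z ^ (k - 1) = z"
    using assms(2) z0 by (cases k) (auto simp: power_inverse)
  finally show False using z by simp
qed

text \<open>The source of rank one. Dividing an integer relation with leading coefficient
  \<open>a\<close> by \<open>x ^ (d - 1)\<close> expresses \<open>a\<close> x as a polynomial in 1/x
  over \<open>A\<close>, and 1/x lies in \<open>A\<close>. The part of \<open>a\<close> prime to p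
  is a unit, so only a power of p remains as denominator.\<close>

lemma algebraic_bounded:
  assumes "algebraic x"
  obtains N where "x * P ^ N \<in> A"
proof (cases "x \<in> A")
  case True
  thus ?thesis using that[of 0] by simp
next
  case False
  hence ix: "inverse x \<in> A" and x0: "x \<noteq> 0" using valuation_ring zero_mem by auto
  obtain f where f: "\<forall>i. coeff f i \<in> \<int>" "f \<noteq> 0" "poly f x = 0"
    using assms unfolding algebraic_def by blast
  define d where "d = degree f"
  have d0: "d \<noteq> 0"
  proof
    assume "d = 0"
    then obtain c where "f = [:c:]" unfolding d_def by (auto elim: degree_eq_zeroE)
    thus False using f by auto
  qed
  obtain a where a: "coeff f d = of_int a" using f(1) by (metis Ints_cases)
  have a0: "a \<noteq> 0" using a f(2) unfolding d_def by (metis leading_coeff_0_iff of_int_0)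
  have cA: "coeff f i \<in> A" for i using f(1) of_int_mem by (metis Ints_cases)
  have "0 = poly f x * inverse x ^ (d - 1)" using f by simp
  also have "\<dots> = (\<Sum>i\<le>d. coeff f i * x ^ i * inverse x ^ (d - 1))"
    unfolding poly_altdef d_def by (simp add: sum_distrib_right)
  also have "{..d} = insert d {..<d}" by auto
  also have "(\<Sum>i\<in>insert d {..<d}. coeff f i * x ^ i * inverse x ^ (d - 1)) =
      of_int a * x ^ d * inverse x ^ (d - 1) + (\<Sum>i<d. coeff f i * x ^ i * inverse x ^ (d - 1))"
    by (simp add: a)
  also have "of_int a * x ^ d * inverse x ^ (d - 1) = of_int a * x"
    using d0 x0 by (cases d) (auto simp: field_simps)
  also have "(\<Sum>i<d. coeff f i * x ^ i * inverse x ^ (d - 1)) = (\<Sum>i<d. coeff f i * inverse x ^ (d - 1 - i))"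
  proof (intro sum.cong refl)
    fix i assume "i \<in> {..<d}"
    hence "inverse x ^ (d - 1) = inverse x ^ (d - 1 - i) * inverse x ^ i" by (simp flip: power_add)
    thus "coeff f i * x ^ i * inverse x ^ (d - 1) = coeff f i * inverse x ^ (d - 1 - i)"
      using x0 by (simp add: field_simps)
  qed
  finally have "of_int a * x = - (\<Sum>i<d. coeff f i * inverse x ^ (d - 1 - i))"
    by (simp add: eq_neg_iff_add_eq_0)
  also have "\<dots> \<in> A" using cA ix by (intro minus_mem sum_mem mult_mem power_mem)
  finally have ax: "of_int a * x \<in> A" .
  have "prime (int p)" using prime_p by simp
  then obtain u where u: "a = int p ^ multiplicity (int p) a * u" "\<not> int p dvd u"
    using a0 by (metis multiplicity_decompose' not_prime_unit)
  hence "coprime u (int p)" using \<open>prime (int p)\<close> by (metis coprime_commute prime_imp_coprime)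
  hence "inverse (of_int u) * (of_int a * x) \<in> A" using ax inverse_coprime_mem mult_mem by blast
  moreover have "(of_int u :: complex) \<noteq> 0" using u by auto
  moreover have "(of_int a :: complex) = P ^ multiplicity (int p) a * of_int u"
    using arg_cong[OF u(1), of "of_int :: int \<Rightarrow> complex"] by simp
  ultimately have "x * P ^ multiplicity (int p) a \<in> A" by (simp add: field_simps)
  thus ?thesis using that by blast
qed

text \<open>The order of \<open>x\<close>, normalised so that \<open>p\<close> has order 1, is the supremum of the following
  lower cut.\<close>

definition S :: "complex \<Rightarrow> real set" where
  "S x = {real_of_int a / real b | a b. b \<ge> 1 \<and> x ^ b * P powi (- a) \<in> A}"

text \<open>For equal fractions a/b and a'/b', the power with exponent b' of the first element is
  the power with exponent b of the second; \<open>power_memD\<close> then extracts the root.\<close>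

lemma S_iff:
  assumes "b \<ge> 1"
  shows "real_of_int a / real b \<in> S x \<longleftrightarrow> x ^ b * P powi (- a) \<in> A"
proof
  assume "real_of_int a / real b \<in> S x"
  then obtain a' b' where *: "real_of_int a / real b = real_of_int a' / real b'" "b' \<ge> 1"
    "x ^ b' * P powi (- a') \<in> A" unfolding S_def by blast
  have "real_of_int a * real b' = real_of_int a' * real b" using * assms by (simp add: field_simps)
  hence "real_of_int (a * int b') = real_of_int (a' * int b)" by simp
  hence eq: "a * int b' = a' * int b" by linarith
  have "(x ^ b * P powi (- a)) ^ b' = x ^ (b * b') * P powi (- (a * int b'))"
    by (simp add: power_mult_distrib power_mult power_int_power')
  also have "\<dots> = (x ^ b' * P powi (- a')) ^ b"
    unfolding eq by (simp add: power_mult_distrib power_int_power' mult.commute flip: power_mult)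
  also have "\<dots> \<in> A" using * power_mem by blast
  finally show "x ^ b * P powi (- a) \<in> A" using power_memD *(2) by blast
next
  assume "x ^ b * P powi (- a) \<in> A"
  thus "real_of_int a / real b \<in> S x" using assms unfolding S_def by blast
qed

lemma P_powi_mem: "P powi k \<in> A \<longleftrightarrow> k \<ge> 0"
proof
  show "P powi k \<in> A" if "k \<ge> 0"
    using that power_mem of_nat_mem by (simp add: power_int_def)
  show "k \<ge> 0" if k: "P powi k \<in> A"
  proof (rule ccontr)
    assume "\<not> k \<ge> 0"
    hence "P powi k * P ^ nat (- k - 1) = P powi (- 1)"
      by (subst power_int_of_nat[symmetric], subst power_int_add[symmetric]) auto
    hence "inverse P \<in> A" using k power_mem of_nat_mem mult_mem
      by (metis power_int_minus power_int_1_right)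
    thus False using inverse_p_notin by simp
  qed
qed

lemma common_denominator:
  assumes "q \<in> \<rat>" "r \<in> (\<rat> :: real set)"
  obtains a c b where "b \<ge> 1" "q = real_of_int a / real b" "r = real_of_int c / real b"
proof -
  obtain a b where q: "b > 0" "q = real_of_int a / real_of_int b" using assms(1) by (auto elim: Rats_cases')
  obtain c d where r: "d > 0" "r = real_of_int c / real_of_int d" using assms(2) by (auto elim: Rats_cases')
  have bd: "b * d > 0" using q r by simp
  show ?thesis
  proof (rule that)
    show "nat (b * d) \<ge> 1" using bd by linarith
    show "q = real_of_int (a * d) / real (nat (b * d))" "r = real_of_int (c * b) / real (nat (b * d))"
      using q r bd by (auto simp: field_simps)
  qed
qed

lemma S_Rats: "S x \<subseteq> \<rat>" unfolding S_def by auto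

lemma S_down:
  assumes "q \<in> S x" "r \<in> \<rat>" "r \<le> q"
  shows "r \<in> S x"
proof -
  obtain a c b where b: "b \<ge> 1" "q = real_of_int a / real b" "r = real_of_int c / real b"
    using common_denominator[of q r] assms S_Rats by (metis subsetD)
  hence "x ^ b * P powi (- a) \<in> A" "c \<le> a" using S_iff assms by (auto simp: divide_le_cancel)
  hence "x ^ b * P powi (- a) * P powi (a - c) \<in> A" using P_powi_mem mult_mem by auto
  also have "x ^ b * P powi (- a) * P powi (a - c) = x ^ b * P powi (- c)"
    by (simp add: mult.assoc P_powi_add)
  finally show ?thesis using b S_iff by simp
qed

lemma S_add:
  assumes "q \<in> S x" "r \<in> S y"
  shows "q + r \<in> S (x * y)"
proof -
  obtain a c b where b: "b \<ge> 1" "q = real_of_int a / real b" "r = real_of_int c / real b"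
    using common_denominator[of q r] assms S_Rats by (metis subsetD)
  hence "(x ^ b * P powi (- a)) * (y ^ b * P powi (- c)) \<in> A" using S_iff assms mult_mem by auto
  also have "(x ^ b * P powi (- a)) * (y ^ b * P powi (- c)) = (x * y) ^ b * P powi (- (a + c))"
    using P_powi_add[of "- a" "- c"] by (simp add: power_mult_distrib)
  finally show ?thesis using b S_iff[of b "a + c"] by (simp add: add_divide_distrib)
qed

text \<open>One of x/y and y/x lies in \<open>A\<close>. If it is x/y, then x + y is y times the
  element 1 + x/y of \<open>A\<close>.\<close>

lemma S_plus:
  assumes "q \<in> S x" "q \<in> S y"
  shows "q \<in> S (x + y)"
proof -
  have *: "q \<in> S (x + y)" if q: "q \<in> S x" "q \<in> S y" and z: "inverse y * x \<in> A" and y0: "y \<noteq> 0" for x y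
  proof -
    obtain a b where b: "b \<ge> 1" "q = real_of_int a / real b" using q(1) unfolding S_def by blast
    hence "y ^ b * P powi (- a) * (1 + inverse y * x) ^ b \<in> A"
      using q z S_iff[OF b(1)] unfolding b(2) by (intro mult_mem[of "y ^ b * P powi (- a)"] power_mem add_mem one_mem) auto
    also have "y ^ b * P powi (- a) * (1 + inverse y * x) ^ b = (y * (1 + inverse y * x)) ^ b * P powi (- a)"
      by (simp add: power_mult_distrib)
    also have "y * (1 + inverse y * x) = x + y" using y0 by (simp add: field_simps)
    finally show ?thesis using b S_iff by simp
  qed
  show ?thesis
  proof (cases "x = 0 \<or> y = 0")
    case True
    thus ?thesis using assms by auto
  next
    case False
    show ?thesis
    proof (cases "inverse y * x \<in> A")
      case True
      thus ?thesis using * assms False by blast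
    next
      case False2: False
      hence "inverse x * y \<in> A" using valuation_ring[of "inverse y * x"] by (simp add: mult.commute)
      thus ?thesis using *[of y x] assms False by (simp add: add.commute)
    qed
  qed
qed

lemma S_or:
  assumes "q \<in> \<rat>"
  shows "q \<in> S x \<or> - q \<in> S (inverse x)"
proof -
  obtain a b where b: "b \<ge> 1" "q = real_of_int a / real b"
    using common_denominator[of q q] assms by blast
  have "inverse (x ^ b * P powi (- a)) = inverse x ^ b * P powi (- (- a))"
    by (simp add: power_inverse power_int_minus)
  hence "x ^ b * P powi (- a) \<in> A \<or> inverse x ^ b * P powi (- (- a)) \<in> A"
    using valuation_ring by metis
  thus ?thesis using b S_iff[of b a x] S_iff[of b "- a" "inverse x"] by simp
qed

lemma S_nonempty:
  assumes "algebraic x"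
  shows "S x \<noteq> {}"
proof -
  obtain N where "x * P ^ N \<in> A" using algebraic_bounded assms by blast
  hence "real_of_int (- int N) / real 1 \<in> S x" by (subst S_iff) auto
  thus ?thesis by blast
qed

text \<open>Any \<open>r\<close> in the cut of 1/x gives the upper bound \<open>- r\<close>: the sum
  \<open>q + r\<close> lies in the cut of 1, which consists of nonpositive numbers since 1/p is not
  in \<open>A\<close>.\<close>

lemma S_bdd:
  assumes "algebraic x" "x \<noteq> 0"
  shows "bdd_above (S x)"
proof -
  obtain r where r: "r \<in> S (inverse x)" using S_nonempty[of "inverse x"] assms by blast
  have "q \<le> - r" if "q \<in> S x" for q
  proof -
    have "q + r \<in> S 1" using S_add[OF that r] assms by simp
    then obtain a b where "b \<ge> 1" "q + r = real_of_int a / real b" "P powi (- a) \<in> A" unfolding S_def by auto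
    hence "q + r \<le> 0" using P_powi_mem by (simp add: divide_le_0_iff)
    thus ?thesis by simp
  qed
  thus ?thesis by (auto simp: bdd_above_def)
qed

section \<open>The order function and the absolute value built from it\<close>

definition s :: "complex \<Rightarrow> real" where "s x = Sup (S x)"

lemma S_le_s: "algebraic x \<Longrightarrow> x \<noteq> 0 \<Longrightarrow> q \<in> S x \<Longrightarrow> q \<le> s x"
  unfolding s_def using cSup_upper[OF _ S_bdd] by blast

lemma less_s_imp_S:
  assumes "algebraic x" "q \<in> \<rat>" "q < s x" shows "q \<in> S x"
proof -
  obtain r where "r \<in> S x" "q < r"
    using less_cSupE[OF assms(3)[unfolded s_def] S_nonempty[OF assms(1)]] by blast
  thus ?thesis using S_down assms(2) by auto
qed

lemma le_realI:
  assumes "\<And>q. q \<in> \<rat> \<Longrightarrow> q < x \<Longrightarrow> q \<le> (y::real)"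
  shows "x \<le> y"
proof (rule ccontr)
  assume "\<not> x \<le> y"
  then obtain q where "q \<in> \<rat>" "y < q" "q < x" using Rats_dense_in_real[of y x] by auto
  thus False using assms[of q] by simp
qed

lemma s_add_le:
  assumes "algebraic x" "x \<noteq> 0" "algebraic y" "y \<noteq> 0"
  shows "s x + s y \<le> s (x * y)"
proof -
  have xy: "algebraic (x * y)" "x * y \<noteq> 0" using assms by (auto intro: algebraic_mult)
  have *: "q + s y \<le> s (x * y)" if q: "q \<in> \<rat>" "q < s x" for q
  proof -
    have "s y \<le> s (x * y) - q"
      by (rule le_realI) (use S_le_s[OF xy S_add[OF less_s_imp_S[OF assms(1) q] less_s_imp_S[OF assms(3)]]]
        in force)
    thus ?thesis by simp
  qed
  have "s x \<le> s (x * y) - s y" by (rule le_realI) (use * in force)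
  thus ?thesis by simp
qed

lemma s_P_powi: "s (P powi k) = real_of_int k"
proof -
  have eq: "S (P powi k) = {q \<in> \<rat>. q \<le> real_of_int k}"
  proof (intro equalityI subsetI)
    fix q assume q: "q \<in> S (P powi k)"
    then obtain a b where b: "b \<ge> 1" "q = real_of_int a / real b" using S_def by auto
    hence "(P powi k) ^ b * P powi (- a) \<in> A" using q S_iff by simp
    hence "P powi (k * int b - a) \<in> A"
      by (simp add: power_int_power' P_powi_add)
    hence "k * int b \<ge> a" using P_powi_mem by simp
    hence "real_of_int a \<le> real_of_int (k * int b)" by linarith
    thus "q \<in> {q \<in> \<rat>. q \<le> real_of_int k}" using b q S_Rats by (auto simp: divide_le_eq)
  next
    fix q assume "q \<in> {q \<in> \<rat>. q \<le> real_of_int k}"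
    hence q: "q \<in> \<rat>" "q \<le> real_of_int k" by auto
    have "P powi k * P powi (- k) = 1" by (simp add: power_int_minus)
    hence "real_of_int k / real 1 \<in> S (P powi k)" using one_mem by (subst S_iff) auto
    thus "q \<in> S (P powi k)" using S_down q by simp
  qed
  show ?thesis unfolding s_def eq
    by (rule cSup_eq_maximum) auto
qed

lemma s_one: "s 1 = 0" using s_P_powi[of 0] by simp

text \<open>Superadditivity yields one inequality. The other uses that \<open>A\<close> is a
  valuation ring: if \<open>- q\<close> is not in the cut of 1/x, then \<open>q\<close> is in the
  cut of x.\<close>

lemma s_inverse:
  assumes "algebraic x" "x \<noteq> 0"
  shows "s (inverse x) = - s x"
proof (rule antisym)
  have ix: "algebraic (inverse x)" "inverse x \<noteq> 0" using assms by auto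
  show "s (inverse x) \<le> - s x" using s_add_le[OF assms ix] assms s_one by simp
  have "s x \<ge> - s (inverse x)"
  proof (rule le_realI)
    fix q assume q: "q \<in> \<rat>" "q < - s (inverse x)"
    hence "- q \<notin> S (inverse x)" using S_le_s[OF ix, of "- q"] by force
    hence "q \<in> S x" using S_or q by blast
    thus "q \<le> s x" using S_le_s assms by blast
  qed
  thus "- s x \<le> s (inverse x)" by simp
qed

lemma s_mult:
  assumes "algebraic x" "x \<noteq> 0" "algebraic y" "y \<noteq> 0"
  shows "s (x * y) = s x + s y"
proof (rule antisym[OF _ s_add_le[OF assms]])
  have "s (x * y) + s (inverse y) \<le> s (x * y * inverse y)"
    using assms by (intro s_add_le) (auto intro: algebraic_mult)
  thus "s (x * y) \<le> s x + s y" using s_inverse[OF assms(3,4)] assms(4) by (simp add: mult.assoc)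
qed

lemma s_plus:
  assumes "algebraic x" "x \<noteq> 0" "algebraic y" "y \<noteq> 0" "x + y \<noteq> 0"
  shows "min (s x) (s y) \<le> s (x + y)"
proof (rule le_realI)
  fix q assume q: "q \<in> \<rat>" "q < min (s x) (s y)"
  hence "q \<in> S (x + y)" using less_s_imp_S assms by (intro S_plus) auto
  thus "q \<le> s (x + y)" using S_le_s assms algebraic_add by blast
qed

text \<open>Splitting off the power of p leaves \<open>u\<close> prime to p. Both \<open>u\<close>
  and 1/u lie in \<open>A\<close>, so the order of \<open>u\<close> is 0.\<close>

lemma s_int:
  assumes "a \<noteq> 0"
  shows "s (of_int a) = real (multiplicity (int p) a)"
proof -
  have "prime (int p)" using prime_p by simp
  then obtain u where u: "a = int p ^ multiplicity (int p) a * u" "\<not> int p dvd u"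
    using assms by (metis multiplicity_decompose' not_prime_unit)
  hence cop: "coprime u (int p)" using \<open>prime (int p)\<close> by (metis coprime_commute prime_imp_coprime)
  have alg: "algebraic (of_int u :: complex)" "(of_int u :: complex) \<noteq> 0"
    using u by (auto intro: rat_imp_algebraic)
  have "real_of_int 0 / real 1 \<in> S (of_int u)" by (subst S_iff) (auto intro: of_int_mem)
  hence "s (of_int u) \<ge> 0" using S_le_s[OF alg] by auto
  moreover have "real_of_int 0 / real 1 \<in> S (inverse (of_int u))"
    using inverse_coprime_mem[OF cop] by (subst S_iff) auto
  hence "s (inverse (of_int u)) \<ge> 0" using S_le_s[of "inverse (of_int u)"] alg by auto
  ultimately have su: "s (of_int u) = 0" using s_inverse[OF alg] by simp
  have "(of_int a :: complex) = P powi (int (multiplicity (int p) a)) * of_int u"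
    using arg_cong[OF u(1), of "of_int :: int \<Rightarrow> complex"] by simp
  moreover have "algebraic (P powi (int (multiplicity (int p) a)))" by (auto intro: rat_imp_algebraic)
  ultimately have "s (of_int a) = s (P powi (int (multiplicity (int p) a))) + s (of_int u)"
    using alg by (simp only:) (rule s_mult, auto)
  thus ?thesis unfolding su s_P_powi by simp
qed

definition w :: "complex \<Rightarrow> real" where
  "w x = (if x = 0 then 0 else real p powr (- s x))"

lemma w_ultrametric:
  assumes "algebraic x" "algebraic y"
  shows "w (x + y) \<le> max (w x) (w y)"
proof (cases "x = 0 \<or> y = 0 \<or> x + y = 0")
  case True
  thus ?thesis by (auto simp: w_def le_max_iff_disj)
next
  case False
  hence "min (s x) (s y) \<le> s (x + y)" using s_plus assms by blast
  moreover have "real p > 1" using prime_gt_1_nat[OF prime_p] by simp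
  ultimately show ?thesis using False by (auto simp: w_def min_le_iff_disj le_max_iff_disj)
qed

lemma w_mult:
  assumes "algebraic x" "algebraic y"
  shows "w (x * y) = w x * w y"
  using s_mult[of x y] assms by (auto simp: w_def simp flip: powr_add)

lemma w_nonneg: "w x \<ge> 0" by (simp add: w_def)

lemma w_absolute_value: "absolute_value_on {x. algebraic x} w"
  unfolding absolute_value_on_def
proof (intro conjI ballI)
  fix x y :: complex assume xy: "x \<in> {x. algebraic x}" "y \<in> {x. algebraic x}"
  show "w (x * y) = w x * w y" using w_mult xy by blast
  have "w (x + y) \<le> max (w x) (w y)" using w_ultrametric xy by blast
  thus "w (x + y) \<le> w x + w y" using w_nonneg[of x] w_nonneg[of y] by linarith
qed (use prime_gt_0_nat[OF prime_p] in \<open>auto simp: w_def\<close>)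

lemma w_of_rat: "w (of_rat q) = padic_abs p q"
proof (cases "q = 0")
  case False
  obtain a b where ab: "quotient_of q = (a, b)" by fastforce
  have q: "q = of_int a / of_int b" "b > 0" using quotient_of_div[OF ab] quotient_of_denom_pos[OF ab] by auto
  have a0: "a \<noteq> 0" using False q by auto
  have "s (of_rat q) = s (of_int a * inverse (of_int b))" unfolding q(1) of_rat_divide by (simp add: divide_inverse)
  also have "\<dots> = s (of_int a) + s (inverse (of_int b))"
    using a0 q(2) by (intro s_mult) (auto intro: rat_imp_algebraic)
  also have "\<dots> = s (of_int a) - s (of_int b)"
    using q(2) by (subst s_inverse) (auto intro: rat_imp_algebraic)
  finally have "s (of_rat q) = real (multiplicity (int p) a) - real (multiplicity (int p) b)"
    using s_int a0 q(2) by simp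
  hence "- s (of_rat q) = real_of_int (int (multiplicity (int p) b) - int (multiplicity (int p) a))" by simp
  hence "real p powr (- s (of_rat q)) = real p powi (int (multiplicity (int p) b) - int (multiplicity (int p) a))"
    by (simp only:) (rule powr_real_of_int', auto)
  thus ?thesis using False by (simp add: w_def padic_abs_def ab)
qed (simp add: w_def padic_abs_def)

end

lemma ex_padic_value:
  assumes "prime p"
  shows "\<exists>w. padic_value {x. algebraic x} w p"
proof -
  obtain A where "maximal_subring p A" using ex_maximal_subring[OF assms] by blast
  then interpret maximal_subring p A .
  have "padic_value {x. algebraic x} w p"
    by (intro padic_value.intro padic_value_axioms.intro absolute_value_field.intro
        absolute_value_field_axioms.intro Alg.complex_subfield_axioms w_absolute_value prime_p w_of_rat)
  thus ?thesis by blast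
qed

section \<open>The field generated by an algebraic number and its embeddings\<close>

interpretation of_rat_poly: map_poly_inj_idom_divide_hom "of_rat :: rat \<Rightarrow> complex" ..

definition qeval :: "rat poly \<Rightarrow> complex \<Rightarrow> complex" where
  "qeval f x = poly (map_poly of_rat f) x"

lemma qeval_simps [simp]:
  "qeval 0 x = 0" "qeval 1 x = 1" "qeval (f + g) x = qeval f x + qeval g x"
  "qeval (f - g) x = qeval f x - qeval g x" "qeval (- f) x = - qeval f x"
  "qeval (f * g) x = qeval f x * qeval g x" "qeval [:c:] x = of_rat c"
  "qeval (monom c n) x = of_rat c * x ^ n" "qeval (smult c f) x = of_rat c * qeval f x"
  "qeval (f ^ n) x = qeval f x ^ n"
  by (simp_all add: qeval_def of_rat_poly.hom_add of_rat_poly.hom_mult of_rat_poly.hom_minus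
      of_rat_poly.hom_uminus map_poly_monom poly_monom of_rat_hom.map_poly_pCons_hom of_rat_hom.map_poly_hom_smult
      of_rat_poly.hom_power)

lemma qeval_sum: "qeval (\<Sum>i\<in>A. f i) x = (\<Sum>i\<in>A. qeval (f i) x)"
  by (induction A rule: infinite_finite_induct) auto

lemma qeval_dvd: "f dvd g \<Longrightarrow> qeval f x = 0 \<Longrightarrow> qeval g x = 0"
  by (auto elim!: dvdE)

lemma qeval_altdef: "degree f < n \<Longrightarrow> qeval f x = (\<Sum>i<n. of_rat (coeff f i) * x ^ i)"
  unfolding qeval_def poly_altdef
  by (rule sum.mono_neutral_cong_left) (auto simp: coeff_eq_0)

lemma algebraic_imp_qeval_root:
  assumes "algebraic x"
  obtains f where "f \<noteq> 0" "qeval f x = 0"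
proof -
  obtain g where g: "\<forall>i. coeff g i \<in> \<int>" "g \<noteq> 0" "poly g x = 0"
    using assms unfolding algebraic_def by blast
  have "\<forall>i. \<exists>c. coeff g i = of_rat (of_int c)" using g(1) by (metis Ints_cases of_rat_of_int_eq)
  then obtain c where c: "coeff g i = of_rat (of_int (c i))" for i by metis
  define f where "f = (\<Sum>i\<le>degree g. monom (of_int (c i)) i :: rat poly)"
  have "map_poly of_rat f = g"
  proof (rule poly_eqI)
    fix i
    show "coeff (map_poly of_rat f) i = coeff g i"
    proof (cases "i \<le> degree g")
      case True
      thus ?thesis by (simp add: f_def coeff_map_poly coeff_sum c)
    next
      case False
      thus ?thesis by (simp add: f_def coeff_map_poly coeff_sum coeff_eq_0)
    qed
  qed
  hence "f \<noteq> 0" "qeval f x = 0" using g by (auto simp: qeval_def)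
  thus ?thesis using that by blast
qed

lemma qeval_root_imp_algebraic:
  assumes "f \<noteq> 0" "qeval f x = 0"
  shows "algebraic x"
  by (rule algebraicI'[of "map_poly of_rat f"]) (use assms in \<open>auto simp: qeval_def coeff_map_poly\<close>)

lemma algebraic_qeval: "algebraic x \<Longrightarrow> algebraic (qeval f x)"
  by (subst qeval_altdef[of f "Suc (degree f)"])
     (simp, intro algebraic_sum algebraic_mult algebraic_power, auto intro: rat_imp_algebraic)

locale algebraic_number =
  fixes \<alpha> :: complex
  assumes alg: "algebraic \<alpha>"
begin

definition minpoly :: "rat poly" where
  "minpoly = (SOME f. lead_coeff f = 1 \<and> qeval f \<alpha> = 0 \<and>
     (\<forall>g. g \<noteq> 0 \<longrightarrow> qeval g \<alpha> = 0 \<longrightarrow> degree f \<le> degree g))"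

abbreviation d :: nat where "d \<equiv> degree minpoly"

lemma minpoly: "lead_coeff minpoly = 1" "qeval minpoly \<alpha> = 0"
  "g \<noteq> 0 \<Longrightarrow> qeval g \<alpha> = 0 \<Longrightarrow> d \<le> degree g"
proof -
  define Q where "Q = (\<lambda>f. f \<noteq> 0 \<and> qeval f \<alpha> = 0)"
  obtain f0 where "Q f0" using algebraic_imp_qeval_root[OF alg] unfolding Q_def by blast
  define f where "f = arg_min degree Q"
  have f: "Q f" "\<And>g. Q g \<Longrightarrow> degree f \<le> degree g"
    unfolding f_def using arg_min_nat_lemma[of Q f0 degree] \<open>Q f0\<close> by auto
  define h where "h = smult (inverse (lead_coeff f)) f"
  have "lead_coeff h = 1 \<and> qeval h \<alpha> = 0 \<and> (\<forall>g. g \<noteq> 0 \<longrightarrow> qeval g \<alpha> = 0 \<longrightarrow> degree h \<le> degree g)"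
    using f by (auto simp: h_def Q_def)
  hence "lead_coeff minpoly = 1 \<and> qeval minpoly \<alpha> = 0 \<and>
     (\<forall>g. g \<noteq> 0 \<longrightarrow> qeval g \<alpha> = 0 \<longrightarrow> d \<le> degree g)" unfolding minpoly_def by (rule someI)
  thus "lead_coeff minpoly = 1" "qeval minpoly \<alpha> = 0"
    "g \<noteq> 0 \<Longrightarrow> qeval g \<alpha> = 0 \<Longrightarrow> d \<le> degree g" by blast+
qed

lemma minpoly_nonzero: "minpoly \<noteq> 0"
  using minpoly(1) by auto

lemma d_pos: "d > 0"
proof (rule ccontr)
  assume "\<not> d > 0"
  then obtain c where "minpoly = [:c:]" by (auto elim: degree_eq_zeroE)
  thus False using minpoly(2) minpoly_nonzero by simp
qed

lemma qeval_small_degree: "qeval g \<alpha> = 0 \<Longrightarrow> degree g < d \<Longrightarrow> g = 0"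
  using minpoly(3)[of g] by auto

lemma qeval_mod: "qeval (f mod minpoly) \<alpha> = qeval f \<alpha>"
proof -
  have "qeval f \<alpha> = qeval (f div minpoly) \<alpha> * qeval minpoly \<alpha> + qeval (f mod minpoly) \<alpha>"
    by (metis div_mult_mod_eq qeval_simps(3,6))
  thus ?thesis using minpoly(2) by simp
qed

lemma degree_mod: "degree (f mod minpoly) < d"
  using degree_mod_less[OF minpoly_nonzero, of f] d_pos by auto

lemma minpoly_dvd_iff: "minpoly dvd f \<longleftrightarrow> qeval f \<alpha> = 0"
  using qeval_small_degree[OF _ degree_mod, of f] qeval_dvd[of minpoly f \<alpha>] minpoly(2) qeval_mod[of f]
  by (metis dvd_eq_mod_eq_0)

text \<open>The gcd \<open>h\<close> does not vanish at \<alpha>, so its cofactor \<open>k\<close>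
  does. By minimality \<open>k\<close> has the full degree, which makes \<open>h\<close>
  constant.\<close>

lemma bezout:
  assumes "qeval g \<alpha> \<noteq> 0"
  obtains u v where "u * g + v * minpoly = 1"
proof -
  define h where "h = gcd g minpoly"
  obtain k where k: "minpoly = h * k" unfolding h_def by (meson gcd_dvd2 dvdE)
  have "h dvd g" unfolding h_def by simp
  hence "qeval h \<alpha> \<noteq> 0" using qeval_dvd assms by blast
  moreover have "qeval h \<alpha> * qeval k \<alpha> = 0" using minpoly(2) k by (metis qeval_simps(6))
  ultimately have "qeval k \<alpha> = 0" by simp
  hence "degree minpoly \<le> degree k" using minpoly(3) k minpoly_nonzero by (metis mult_zero_right)
  moreover have "degree minpoly = degree h + degree k"
    using k minpoly_nonzero by (metis degree_mult_eq mult_zero_left mult_zero_right)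
  ultimately have "degree h = 0" by simp
  hence "is_unit h" using minpoly_nonzero k by (metis is_unit_iff_degree mult_zero_left)
  hence "normalize h = 1" by (simp add: is_unit_normalize)
  hence "h = 1" unfolding h_def by (simp only: normalize_gcd)
  hence "fst (bezout_coefficients g minpoly) * g + snd (bezout_coefficients g minpoly) * minpoly = 1"
    using bezout_coefficients_fst_snd[of g minpoly] by (simp add: h_def)
  thus ?thesis using that by blast
qed

definition K :: "complex set" where "K = range (\<lambda>f. qeval f \<alpha>)"

lemma qeval_K [simp]: "qeval f \<alpha> \<in> K" unfolding K_def by blast

lemma K_cases: assumes "x \<in> K" obtains f where "x = qeval f \<alpha>" "degree f < d"
proof -
  obtain g where "x = qeval g \<alpha>" using assms unfolding K_def by blast
  thus ?thesis using that[of "g mod minpoly"] qeval_mod degree_mod by auto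
qed

lemma K_coeffs: assumes "x \<in> K" obtains c where "x = (\<Sum>i<d. of_rat (c i) * \<alpha> ^ i)"
  using K_cases[OF assms] qeval_altdef by metis

lemma K_subfield: "subfield K complex_ring"
proof (rule complex_ring_subfieldI)
  fix x assume x: "x \<in> K" "x \<noteq> 0"
  obtain f where f: "x = qeval f \<alpha>" using K_cases x by blast
  then obtain u v where "u * f + v * minpoly = 1" using bezout x by blast
  hence "qeval (u * f + v * minpoly) \<alpha> = 1" by simp
  hence "qeval u \<alpha> * x = 1" using f minpoly(2) by simp
  hence "inverse x = qeval u \<alpha>" using x(2) by (simp add: inverse_unique mult.commute)
  thus "inverse x \<in> K" by simp
next
  show "1 \<in> K" using qeval_K[of 1] by simp
qed (metis K_cases qeval_K qeval_simps(3,5,6))+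

sublocale K: complex_subfield K
  by (rule complex_subfield.intro[OF K_subfield])

lemma K_alpha [simp]: "\<alpha> \<in> K" using qeval_K[of "monom 1 1"] by simp
lemma K_eq: "generate_field complex_ring {\<alpha>} = K"
proof (rule field.generate_fieldI[OF complex_ring_field, symmetric])
  fix L assume L: "subfield L complex_ring" "{\<alpha>} \<subseteq> L"
  interpret L: complex_subfield L by (rule complex_subfield.intro[OF L(1)])
  show "K \<subseteq> L"
  proof
    fix x assume "x \<in> K"
    then obtain c where "x = (\<Sum>i<d. of_rat (c i) * \<alpha> ^ i)" using K_coeffs by blast
    thus "x \<in> L" using L(2) by (auto intro!: L.F_sum L.F_mult L.F_power)
  qed
qed (use K_subfield in auto)

section \<open>Conjugates and the embeddings they define\<close>

definition conjugates :: "complex set" where "conjugates = {\<beta>. qeval minpoly \<beta> = 0}"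

lemma finite_conjugates: "finite conjugates"
  unfolding conjugates_def qeval_def using minpoly_nonzero by (intro poly_roots_finite) auto

lemma alpha_conjugate: "\<alpha> \<in> conjugates" by (simp add: conjugates_def minpoly)

lemma conjugates_algebraic: "\<beta> \<in> conjugates \<Longrightarrow> algebraic \<beta>"
  using qeval_root_imp_algebraic minpoly_nonzero unfolding conjugates_def by blast

text \<open>A Bezout identity with the minimal polynomial remains true at \<beta>. The equivalence
  is what makes \<open>emb\<close> well defined and injective.\<close>

lemma qeval_conjugate:
  assumes "\<beta> \<in> conjugates" shows "qeval f \<beta> = 0 \<longleftrightarrow> qeval f \<alpha> = 0"
proof
  assume "qeval f \<alpha> = 0"
  thus "qeval f \<beta> = 0" using qeval_dvd assms minpoly_dvd_iff unfolding conjugates_def by blast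
next
  assume *: "qeval f \<beta> = 0"
  show "qeval f \<alpha> = 0"
  proof (rule ccontr)
    assume "qeval f \<alpha> \<noteq> 0"
    then obtain u v where "u * f + v * minpoly = 1" using bezout by blast
    hence "qeval (u * f + v * minpoly) \<beta> = 1" by simp
    thus False using * assms by (simp add: conjugates_def)
  qed
qed

text \<open>Separability: the derivative is nonzero of degree below \<open>d\<close>, hence does not
  vanish at \<alpha>, nor at any conjugate.\<close>

lemma minpoly_eq_prod: "map_poly of_rat minpoly = (\<Prod>z\<in>conjugates. [:- z, 1:])"
proof -
  define g where "g = (map_poly of_rat minpoly :: complex poly)"
  have "qeval (pderiv minpoly) \<alpha> \<noteq> 0"
  proof
    assume "qeval (pderiv minpoly) \<alpha> = 0"
    moreover have "degree (pderiv minpoly) < d" using d_pos by (simp add: degree_pderiv)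
    ultimately have "pderiv minpoly = 0" by (rule qeval_small_degree)
    thus False using d_pos by (simp add: pderiv_eq_0_iff)
  qed
  hence "poly (pderiv g) \<beta> \<noteq> 0" if "\<beta> \<in> conjugates" for \<beta>
    using qeval_conjugate[OF that, of "pderiv minpoly"] unfolding g_def qeval_def
    by (simp add: of_rat_hom.map_poly_pderiv)
  hence "rsquarefree g"
    unfolding rsquarefree_roots by (auto simp: conjugates_def qeval_def g_def)
  hence "smult (lead_coeff g) (\<Prod>z|poly g z = 0. [:-z, 1:]) = g"
    by (rule complex_poly_decompose_rsquarefree)
  moreover have "lead_coeff g = 1" using minpoly(1) by (simp add: g_def coeff_map_poly)
  ultimately show ?thesis by (simp add: conjugates_def qeval_def g_def)
qed

lemma card_conjugates: "card conjugates = d"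
proof -
  have "d = degree (map_poly of_rat minpoly :: complex poly)" by simp
  also have "\<dots> = card conjugates"
    unfolding minpoly_eq_prod by (subst degree_prod_eq_sum_degree) auto
  finally show ?thesis ..
qed

text \<open>For a conjugate \<beta> this is the field embedding of \<open>K\<close> taking \<alpha>
  to \<beta>; the choice of the representing polynomial is irrelevant by
  \<open>emb_qeval\<close>.\<close>

definition emb :: "complex \<Rightarrow> complex \<Rightarrow> complex" where
  "emb \<beta> x = qeval (SOME f. x = qeval f \<alpha>) \<beta>"

lemma emb_qeval:
  assumes "\<beta> \<in> conjugates"
  shows "emb \<beta> (qeval f \<alpha>) = qeval f \<beta>"
proof -
  define g where "g = (SOME g. qeval f \<alpha> = qeval g \<alpha>)"
  have "qeval f \<alpha> = qeval g \<alpha>" unfolding g_def by (rule someI) (rule refl)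
  hence "qeval (f - g) \<alpha> = 0" by simp
  hence "qeval (f - g) \<beta> = 0" using qeval_conjugate[OF assms] by blast
  thus ?thesis by (simp add: emb_def g_def)
qed

lemma emb_simps:
  assumes "\<beta> \<in> conjugates"
  shows "emb \<beta> (of_rat q) = of_rat q" "emb \<beta> \<alpha> = \<beta>"
    "x \<in> K \<Longrightarrow> y \<in> K \<Longrightarrow> emb \<beta> (x + y) = emb \<beta> x + emb \<beta> y"
    "x \<in> K \<Longrightarrow> y \<in> K \<Longrightarrow> emb \<beta> (x * y) = emb \<beta> x * emb \<beta> y"
    "x \<in> K \<Longrightarrow> emb \<beta> x = 0 \<longleftrightarrow> x = 0"
    "x \<in> K \<Longrightarrow> algebraic (emb \<beta> x)"
proof -
  show "emb \<beta> (of_rat q) = of_rat q" using emb_qeval[OF assms, of "[:q:]"] by simp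
  show "emb \<beta> \<alpha> = \<beta>" using emb_qeval[OF assms, of "monom 1 1"] by simp
  show "emb \<beta> (x + y) = emb \<beta> x + emb \<beta> y" if "x \<in> K" "y \<in> K"
    using that emb_qeval[OF assms] by (metis K_cases qeval_simps(3))
  show "emb \<beta> (x * y) = emb \<beta> x * emb \<beta> y" if "x \<in> K" "y \<in> K"
    using that emb_qeval[OF assms] by (metis K_cases qeval_simps(6))
  show "emb \<beta> x = 0 \<longleftrightarrow> x = 0" if "x \<in> K"
    using that emb_qeval[OF assms] qeval_conjugate[OF assms] by (metis K_cases)
  show "algebraic (emb \<beta> x)" if "x \<in> K"
    using that emb_qeval[OF assms] algebraic_qeval[OF conjugates_algebraic[OF assms]] by (metis K_cases)
qed

lemma complex_ring_combine:
  "length Ks = length Us \<Longrightarrow> CR.combine Ks Us = (\<Sum>i<length Us. Ks ! i * Us ! i)"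
  by (induction Ks Us rule: list_induct2) (simp_all add: sum.lessThan_Suc_shift del: sum.lessThan_Suc)

lemma dimension_K: "CR.dimension d \<rat> K"
proof -
  define Us where "Us = map (\<lambda>i. \<alpha> ^ i) [0..<d]"
  have len: "length Us = d" by (simp add: Us_def)
  have comb: "CR.combine Ks Us = (\<Sum>i<d. Ks ! i * \<alpha> ^ i)" if "length Ks = d" for Ks
    using complex_ring_combine[of Ks Us] that by (simp add: Us_def)
  have "CR.independent \<rat> Us"
  proof (rule CR.trivial_combine_imp_independent[OF Rats_subfield])
    fix Ks assume Ks: "set Ks \<subseteq> \<rat>" "CR.combine Ks Us = \<zero>\<^bsub>complex_ring\<^esub>"
    \<comment> \<open>\<open>combine\<close> disregards surplus entries of the longer list, so the
      coefficients are first cut or padded with zeros to the length of \<open>Us\<close>.\<close>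
    obtain Ks' where Ks': "set (take (length Us) Ks) \<subseteq> set Ks'" "set Ks' \<subseteq> set (take (length Us) Ks) \<union> {0}"
      "length Ks' = length Us" "CR.combine Ks' Us = 0"
      using CR.combine_normalize[of Ks Us 0] Ks by auto
    have "\<forall>i\<in>{..<d}. \<exists>q. Ks' ! i = of_rat q"
      using Ks' Ks(1) len by (metis Rats_cases Rats_0 Un_iff in_set_takeD lessThan_iff nth_mem singletonD subset_iff)
    then obtain q where q: "\<And>i. i < d \<Longrightarrow> Ks' ! i = of_rat (q i)" by (metis lessThan_iff)
    define f where "f = (\<Sum>i<d. monom (q i) i)"
    have "qeval f \<alpha> = 0" using Ks'(3,4) comb[of Ks'] q by (simp add: f_def qeval_sum len)
    moreover have "degree f < d"
      unfolding f_def using d_pos by (intro degree_sum_less) (auto intro: le_less_trans[OF degree_monom_le])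
    ultimately have "f = 0" by (rule qeval_small_degree)
    hence "q i = 0" if "i < d" for i
    proof -
      have "coeff f i = q i" using that by (simp add: f_def coeff_sum)
      thus ?thesis using \<open>f = 0\<close> by simp
    qed
    hence "set Ks' \<subseteq> {0}" using q Ks'(3) len by (auto simp: in_set_conv_nth)
    thus "set (take (length Us) Ks) \<subseteq> {\<zero>\<^bsub>complex_ring\<^esub>}" using Ks'(1) by auto
  qed auto
  moreover have "CR.Span \<rat> Us = K"
  proof
    show "CR.Span \<rat> Us \<subseteq> K"
    proof
      fix x assume "x \<in> CR.Span \<rat> Us"
      then obtain Ks where Ks: "set Ks \<subseteq> \<rat>" "length Ks = d" "x = CR.combine Ks Us"
        using CR.Span_mem_iff_length_version[OF Rats_subfield, of Us x] len by auto
      have "Ks ! i \<in> K" if "i < d" for i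
        using Ks that K.F_rat by (metis Rats_cases nth_mem subset_iff)
      thus "x \<in> K" using Ks comb by (auto intro!: K.F_sum K.F_mult K.F_power)
    qed
    show "K \<subseteq> CR.Span \<rat> Us"
    proof
      fix x assume "x \<in> K"
      then obtain c where c: "x = (\<Sum>i<d. of_rat (c i) * \<alpha> ^ i)" using K_coeffs by blast
      define Ks where "Ks = map (\<lambda>i. of_rat (c i) :: complex) [0..<d]"
      have "set Ks \<subseteq> \<rat>" "length Ks = d" "x = CR.combine Ks Us"
        using c comb[of Ks] by (auto simp: Ks_def)
      thus "x \<in> CR.Span \<rat> Us" using CR.Span_mem_iff_length_version[OF Rats_subfield, of Us x] len by auto
    qed
  qed
  ultimately show ?thesis using CR.dimensionI[OF Rats_subfield] len by metis
qed

lemma number_field_degree_K: "number_field_degree K = d"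
  using CR.dimI[OF Rats_subfield dimension_K] unfolding number_field_degree_def over_def .

end

section \<open>Interpolation and norms\<close>

definition lagrange_basis :: "complex set \<Rightarrow> complex \<Rightarrow> complex poly" where
  "lagrange_basis B \<beta> = (\<Prod>\<gamma>\<in>B - {\<beta>}. smult (inverse (\<beta> - \<gamma>)) [:- \<gamma>, 1:])"

lemma coeff_prod_algebraic:
  fixes p :: "'i \<Rightarrow> complex poly"
  assumes "\<And>x i. x \<in> A \<Longrightarrow> algebraic (coeff (p x) i)"
  shows "algebraic (coeff (\<Prod>x\<in>A. p x) i)"
  using assms
proof (induction A arbitrary: i rule: infinite_finite_induct)
  case (insert x A)
  thus ?case by (auto simp: coeff_mult intro!: algebraic_sum algebraic_mult)
qed (auto intro: rat_imp_algebraic)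

lemma lagrange_basis_algebraic:
  assumes "\<And>\<gamma>. \<gamma> \<in> B \<Longrightarrow> algebraic \<gamma>" "\<beta> \<in> B"
  shows "algebraic (coeff (lagrange_basis B \<beta>) i)"
  unfolding lagrange_basis_def
proof (rule coeff_prod_algebraic)
  fix \<gamma> j assume "\<gamma> \<in> B - {\<beta>}"
  hence "algebraic (inverse (\<beta> - \<gamma>))" "algebraic (- \<gamma>)"
    using assms by (auto intro!: algebraic_diff)
  thus "algebraic (coeff (smult (inverse (\<beta> - \<gamma>)) [:- \<gamma>, 1:]) j)"
    by (auto simp: coeff_pCons split: nat.splits intro: algebraic_mult rat_imp_algebraic)
qed

text \<open>The coefficients depend linearly on the values, with weights determined by
  \<open>B\<close> alone. Small values on \<open>B\<close> thus force small coefficients, for any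
  absolute value on the algebraic numbers.\<close>

lemma coeff_interpolation:
  fixes f :: "complex poly"
  assumes B: "finite B" "degree f < card B"
  shows "coeff f i = (\<Sum>\<beta>\<in>B. poly f \<beta> * coeff (lagrange_basis B \<beta>) i)"
proof -
  define g where "g = (\<Sum>\<beta>\<in>B. smult (poly f \<beta>) (lagrange_basis B \<beta>))"
  have L: "poly (lagrange_basis B \<beta>) \<gamma> = (if \<beta> = \<gamma> then 1 else 0)" if "\<beta> \<in> B" "\<gamma> \<in> B" for \<beta> \<gamma>
  proof -
    have "poly (lagrange_basis B \<beta>) \<gamma> = (\<Prod>x\<in>B - {\<beta>}. (\<gamma> - x) / (\<beta> - x))"
      unfolding lagrange_basis_def poly_prod by (intro prod.cong refl) (simp add: divide_inverse algebra_simps)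
    thus ?thesis using that B(1) by (auto intro!: prod.neutral)
  qed
  have "f = g"
  proof (rule poly_eqI_degree[where A = B])
    fix \<gamma> assume g: "\<gamma> \<in> B"
    have "poly g \<gamma> = (\<Sum>\<beta>\<in>B. if \<beta> = \<gamma> then poly f \<beta> else 0)"
      unfolding g_def poly_sum using L g by (intro sum.cong) auto
    thus "poly f \<gamma> = poly g \<gamma>" using g B(1) by simp
  next
    have "degree (smult (poly f \<beta>) (lagrange_basis B \<beta>)) < card B" if b: "\<beta> \<in> B" for \<beta>
    proof -
      have "degree (lagrange_basis B \<beta>) \<le> (\<Sum>\<gamma>\<in>B - {\<beta>}. degree (smult (inverse (\<beta> - \<gamma>)) [:- \<gamma>, 1:]))"
        unfolding lagrange_basis_def using degree_prod_sum_le[of "B - {\<beta>}" "\<lambda>\<gamma>. smult (inverse (\<beta> - \<gamma>)) [:- \<gamma>, 1:]"] B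
        by (simp only: o_def finite_Diff)
      also have "\<dots> \<le> (\<Sum>\<gamma>\<in>B - {\<beta>}. 1)"
      proof (rule sum_mono)
        fix \<gamma> :: complex
        have "degree [:- \<gamma>, 1:] = 1" by simp
        thus "degree (smult (inverse (\<beta> - \<gamma>)) [:- \<gamma>, 1:]) \<le> 1"
          using degree_smult_le[of "inverse (\<beta> - \<gamma>)" "[:- \<gamma>, 1:]"] by linarith
      qed
      also have "\<dots> < card B" using b B by (simp add: card_gt_0_iff card_Diff_singleton)
      finally show ?thesis using degree_smult_le[of "poly f \<beta>" "lagrange_basis B \<beta>"] by simp
    qed
    thus "degree g < card B" unfolding g_def using B by (intro degree_sum_less) auto
  qed (use B in auto)
  hence "coeff f i = coeff g i" by simp
  thus ?thesis by (simp add: g_def coeff_sum)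
qed

context algebraic_number
begin

text \<open>\<open>M\<close> is the matrix of multiplication by f(\<alpha>) in the basis of powers,
  \<open>U\<close> the Vandermonde matrix of the conjugates. The identity U M = D U diagonalises
  \<open>M\<close>, so the product of the conjugate values is the determinant of a rational
  matrix.\<close>

lemma norm_rational:
  obtains q where "(\<Prod>\<beta>\<in>conjugates. qeval f \<beta>) = of_rat q"
proof -
  obtain b where b: "bij_betw b {..<d} conjugates"
    using ex_bij_betw_nat_finite[OF finite_conjugates] by (auto simp: card_conjugates atLeast0LessThan)
  define M where "M = Matrix.mat d d (\<lambda>(k, j). coeff ((f * monom 1 j) mod minpoly) k)"
  define U where "U = Matrix.mat d d (\<lambda>(i, k). b i ^ k)"
  define D where "D = mat_diag d (\<lambda>i. qeval f (b i))"
  have M: "M \<in> carrier_mat d d" and U: "U \<in> carrier_mat d d" and D: "D \<in> carrier_mat d d"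
    by (auto simp: M_def U_def D_def)
  have bc: "b i \<in> conjugates" if "i < d" for i using b that by (auto simp: bij_betw_def)
  have "U * map_mat of_rat M = D * U"
  proof (rule eq_matI)
    fix i j assume "i < dim_row (D * U)" "j < dim_col (D * U)"
    hence ij: "i < d" "j < d" using U D by auto
    have "(U * map_mat of_rat M) $$ (i, j) = (\<Sum>k<d. b i ^ k * of_rat (coeff ((f * monom 1 j) mod minpoly) k))"
      using ij by (simp add: U_def M_def scalar_prod_def atLeast0LessThan)
    also have "\<dots> = qeval ((f * monom 1 j) mod minpoly) (b i)"
      by (subst qeval_altdef[OF degree_mod]) (simp add: mult.commute)
    also have "\<dots> = qeval (f * monom 1 j) (b i)"
    proof -
      have "qeval (f * monom 1 j) (b i) = qeval ((f * monom 1 j) div minpoly) (b i) * qeval minpoly (b i)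
          + qeval ((f * monom 1 j) mod minpoly) (b i)"
        by (metis div_mult_mod_eq qeval_simps(3,6))
      thus ?thesis using bc[OF ij(1)] by (simp add: conjugates_def)
    qed
    also have "\<dots> = (D * U) $$ (i, j)"
      unfolding D_def mat_diag_mult_left[OF U] using ij by (simp add: U_def)
    finally show "(U * map_mat of_rat M) $$ (i, j) = (D * U) $$ (i, j)" .
  qed (use M U D in auto)
  hence "Determinant.det (U * map_mat of_rat M) = Determinant.det (D * U)" by simp
  hence "Determinant.det U * Determinant.det (map_mat of_rat M) = Determinant.det D * Determinant.det U"
    using M U D by (simp add: Determinant.det_mult[of _ d])
  \<comment> \<open>A kernel vector would be the coefficients of a nonzero polynomial of degree
    below \<open>d\<close> with the \<open>d\<close> conjugates as roots.\<close>
  moreover have "Determinant.det U \<noteq> 0"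
  proof
    assume "Determinant.det U = 0"
    then obtain v where v: "v \<in> carrier_vec d" "v \<noteq> 0\<^sub>v d" "U *\<^sub>v v = 0\<^sub>v d"
      using det_0_iff_vec_prod_zero[OF U] by blast
    define g where "g = (\<Sum>k<d. monom (vec_index v k) k)"
    have "coeff g k = 0" for k
    proof -
      have "g = 0"
      proof (rule poly_eqI_degree[where A = conjugates])
        fix \<beta> assume "\<beta> \<in> conjugates"
        then obtain i where i: "i < d" "\<beta> = b i" using b by (auto simp: bij_betw_def)
        have "poly g \<beta> = vec_index (U *\<^sub>v v) i"
          using i v(1) by (simp add: g_def poly_sum poly_monom U_def scalar_prod_def atLeast0LessThan mult.commute)
        thus "poly g \<beta> = poly 0 \<beta>" using v(3) i by simp
      next
        show "degree g < card conjugates" unfolding g_def card_conjugates using d_pos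
          by (intro degree_sum_less) (auto intro: le_less_trans[OF degree_monom_le])
      qed (use d_pos card_conjugates in auto)
      thus ?thesis by simp
    qed
    moreover have "coeff g k = vec_index v k" if "k < d" for k using that by (simp add: g_def coeff_sum)
    ultimately have "v = 0\<^sub>v d" using v(1) by (intro eq_vecI) auto
    thus False using v(2) by simp
  qed
  ultimately have "Determinant.det D = of_rat (Determinant.det M)" by (simp add: of_rat_hom.hom_det)
  moreover have "Determinant.det D = (\<Prod>i<d. qeval f (b i))"
    using D by (subst Determinant.det_upper_triangular[of _ d])
      (auto simp: D_def mat_diag_def upper_triangular_def prod_list_diag_prod atLeast0LessThan)
  moreover have "\<dots> = (\<Prod>\<beta>\<in>conjugates. qeval f \<beta>)"
    using prod.reindex_bij_betw[OF b] by simp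
  ultimately show ?thesis using that by simp
qed

end

section \<open>The completion at a place\<close>

locale valued_number_field = algebraic_number +
  fixes v :: "complex \<Rightarrow> real"
  assumes absolute: "absolute_value_on K v"
begin

sublocale absolute_value_field K v
  by (intro absolute_value_field.intro absolute_value_field_axioms.intro K.complex_subfield_axioms absolute)

abbreviation Kv where "Kv \<equiv> completion K v"
abbreviation Qv where "Qv \<equiv> rat_completion K v"
abbreviation C where "C \<equiv> cauchy_ring K v"
abbreviation cs where "cs \<equiv> carrier C"
abbreviation null where "null s \<equiv> (\<lambda>i. v (s i)) \<longlonglongrightarrow> 0"
abbreviation cl where "cl s \<equiv> null_ideal K v +>\<^bsub>C\<^esub> s"

lemma cs_iff: "s \<in> cs \<longleftrightarrow> (\<forall>i. s i \<in> K) \<and> (\<forall>e>0. \<exists>N. \<forall>i\<ge>N. \<forall>j\<ge>N. v (s i - s j) < e)"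
  by (auto simp: cauchy_ring_def)

lemma C_simps [simp]:
  "s \<otimes>\<^bsub>C\<^esub> t = (\<lambda>i. s i * t i)" "s \<oplus>\<^bsub>C\<^esub> t = (\<lambda>i. s i + t i)" "\<one>\<^bsub>C\<^esub> = (\<lambda>_. 1)" "\<zero>\<^bsub>C\<^esub> = (\<lambda>_. 0)"
  by (simp_all add: cauchy_ring_def)

lemma cs_K: "s \<in> cs \<Longrightarrow> s i \<in> K" by (simp add: cs_iff)

lemma cs_const: "x \<in> K \<Longrightarrow> (\<lambda>_. x) \<in> cs" by (simp add: cs_iff)

lemma cs_bounded:
  assumes "s \<in> cs" obtains B where "B > 0" "\<And>i. v (s i) \<le> B"
proof -
  obtain N where N: "\<And>i j. i \<ge> N \<Longrightarrow> j \<ge> N \<Longrightarrow> v (s i - s j) < 1"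
    using assms[unfolded cs_iff, THEN conjunct2, rule_format, of 1] by auto
  define B where "B = Max ((\<lambda>i. v (s i)) ` {..N}) + 1"
  have le: "v (s i) \<le> B - 1" if "i \<le> N" for i
    unfolding B_def using that by (auto intro!: Max_ge)
  have "v (s i) \<le> B" for i
  proof (cases "i \<le> N")
    case False
    hence "v (s i - s N) < 1" using N by simp
    moreover have "v (s i) \<le> v (s i - s N) + v (s N)"
      using v_triangle[of "s i - s N" "s N"] cs_K[OF assms] K.F_diff by simp
    ultimately show ?thesis using le[of N] by simp
  qed (use le[of i] in simp)
  moreover have "B > 0" using le[of N] v_nonneg[OF cs_K[OF assms], of N] by linarith
  ultimately show ?thesis using that by blast
qed

lemma cs_add: assumes "s \<in> cs" "t \<in> cs" shows "(\<lambda>i. s i + t i) \<in> cs"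
  unfolding cs_iff
proof (intro conjI allI impI)
  show "s i + t i \<in> K" for i using assms cs_K K.F_add by blast
  fix e :: real assume e: "e > 0"
  obtain N where N: "\<And>i j. i \<ge> N \<Longrightarrow> j \<ge> N \<Longrightarrow> v (s i - s j) < e / 2"
    using assms(1) e unfolding cs_iff by (meson half_gt_zero)
  obtain M where M: "\<And>i j. i \<ge> M \<Longrightarrow> j \<ge> M \<Longrightarrow> v (t i - t j) < e / 2"
    using assms(2) e unfolding cs_iff by (meson half_gt_zero)
  have "v (s i + t i - (s j + t j)) < e" if "i \<ge> max N M" "j \<ge> max N M" for i j
  proof -
    have "s i + t i - (s j + t j) = (s i - s j) + (t i - t j)" by simp
    hence "v (s i + t i - (s j + t j)) \<le> v (s i - s j) + v (t i - t j)"
      using v_triangle assms cs_K K.F_diff by metis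
    thus ?thesis using N[of i j] M[of i j] that by simp
  qed
  thus "\<exists>N. \<forall>i\<ge>N. \<forall>j\<ge>N. v (s i + t i - (s j + t j)) < e" by blast
qed

lemma cs_mult: assumes "s \<in> cs" "t \<in> cs" shows "(\<lambda>i. s i * t i) \<in> cs"
  unfolding cs_iff
proof (intro conjI allI impI)
  show "s i * t i \<in> K" for i using assms cs_K K.F_mult by blast
  fix e :: real assume e: "e > 0"
  obtain B where B: "B > 0" "\<And>i. v (s i) \<le> B" using cs_bounded assms by blast
  obtain D where D: "D > 0" "\<And>i. v (t i) \<le> D" using cs_bounded assms by blast
  have eD: "e / (2 * D) > 0" and eB: "e / (2 * B) > 0" using e B D by auto
  obtain N where N: "\<And>i j. i \<ge> N \<Longrightarrow> j \<ge> N \<Longrightarrow> v (s i - s j) < e / (2 * D)"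
    using assms(1) eD unfolding cs_iff by meson
  obtain M where M: "\<And>i j. i \<ge> M \<Longrightarrow> j \<ge> M \<Longrightarrow> v (t i - t j) < e / (2 * B)"
    using assms(2) eB unfolding cs_iff by meson
  have "v (s i * t i - (s j * t j)) < e" if "i \<ge> max N M" "j \<ge> max N M" for i j
  proof -
    note KK = cs_K[OF assms(1)] cs_K[OF assms(2)]
    have "s i * t i - s j * t j = s i * (t i - t j) + (s i - s j) * t j" by (simp add: algebra_simps)
    hence "v (s i * t i - s j * t j) \<le> v (s i * (t i - t j)) + v ((s i - s j) * t j)"
      using v_triangle KK K.F_diff K.F_mult by metis
    also have "\<dots> = v (s i) * v (t i - t j) + v (s i - s j) * v (t j)"
      using v_mult KK K.F_diff by metis
    also have "\<dots> \<le> B * v (t i - t j) + v (s i - s j) * D"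
      using B D KK K.F_diff by (intro add_mono mult_mono) (auto intro: v_nonneg)
    also have "\<dots> < B * (e / (2 * B)) + (e / (2 * D)) * D"
      using N[of i j] M[of i j] that B(1) D(1) by (intro add_strict_mono mult_strict_left_mono mult_strict_right_mono) auto
    also have "\<dots> = e" using B D by simp
    finally show ?thesis .
  qed
  thus "\<exists>N. \<forall>i\<ge>N. \<forall>j\<ge>N. v (s i * t i - (s j * t j)) < e" by blast
qed

lemma cs_minus: assumes "s \<in> cs" shows "(\<lambda>i. - s i) \<in> cs"
  using cs_mult[OF cs_const[of "- 1"] assms] K.F_minus[OF K.F_one] by simp

lemma cs_diff: assumes "s \<in> cs" "t \<in> cs" shows "(\<lambda>i. s i - t i) \<in> cs"
  using cs_add[OF assms(1) cs_minus[OF assms(2)]] by simp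

lemma C_cring: "cring C"
proof (rule cringI)
  show "abelian_group C"
  proof (rule abelian_groupI)
    fix x assume x: "x \<in> cs"
    show "\<exists>y\<in>cs. y \<oplus>\<^bsub>C\<^esub> x = \<zero>\<^bsub>C\<^esub>"
      by (rule bexI[of _ "\<lambda>i. - x i"]) (use cs_minus[OF x] in auto)
  qed (auto simp: algebra_simps intro: cs_add cs_const)
  show "comm_monoid C"
    by (rule comm_monoidI) (auto simp: algebra_simps intro: cs_mult cs_const)
qed (auto simp: algebra_simps)

lemma null_add:
  assumes "s \<in> cs" "t \<in> cs" "null s" "null t" shows "null (\<lambda>i. s i + t i)"
proof (rule tendsto_sandwich[where f = "\<lambda>_. 0" and h = "\<lambda>i. v (s i) + v (t i)"])
  show "(\<lambda>i. v (s i) + v (t i)) \<longlonglongrightarrow> 0" using tendsto_add[OF assms(3,4)] by simp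
qed (use assms cs_K in \<open>auto intro!: always_eventually v_nonneg v_triangle K.F_add\<close>)

lemma null_mult:
  assumes "s \<in> cs" "t \<in> cs" "null t" shows "null (\<lambda>i. s i * t i)"
proof -
  obtain B where B: "B > 0" "\<And>i. v (s i) \<le> B" using cs_bounded assms by blast
  show ?thesis
  proof (rule tendsto_sandwich[where f = "\<lambda>_. 0" and h = "\<lambda>i. B * v (t i)"])
    show "(\<lambda>i. B * v (t i)) \<longlonglongrightarrow> 0" using tendsto_mult_left[OF assms(3), of B] by simp
    have "v (s i * t i) \<le> B * v (t i)" for i
      using B v_mult[OF cs_K[OF assms(1)] cs_K[OF assms(2)]] v_nonneg[OF cs_K[OF assms(2)]]
      by (simp add: mult_right_mono)
    thus "\<forall>\<^sub>F n in sequentially. v (s n * t n) \<le> B * v (t n)" by simp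
  qed (use assms cs_K in \<open>auto intro!: always_eventually v_nonneg K.F_mult\<close>)
qed

lemma null_ideal_iff: "s \<in> null_ideal K v \<longleftrightarrow> s \<in> cs \<and> null s"
  by (simp add: null_ideal_def)

lemma ideal_null: "ideal (null_ideal K v) C"
proof -
  interpret C: cring C by (rule C_cring)
  have inv: "\<ominus>\<^bsub>C\<^esub> s = (\<lambda>i. - s i)" if "s \<in> cs" for s
    by (rule C.minus_equality) (use that cs_minus in auto)
  show ?thesis
  proof (rule idealI[OF C.ring_axioms])
    show "subgroup (null_ideal K v) (add_monoid C)"
    proof (rule C.add.subgroupI)
      show "null_ideal K v \<noteq> {}" using cs_const[of 0] null_ideal_iff[of "\<lambda>_. 0"] by auto
      show "\<ominus>\<^bsub>C\<^esub> a \<in> null_ideal K v" if "a \<in> null_ideal K v" for a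
        using that cs_minus inv cs_K by (auto simp: null_ideal_iff)
    qed (auto simp: null_ideal_iff intro: cs_add null_add)
    show "x \<otimes>\<^bsub>C\<^esub> a \<in> null_ideal K v" "a \<otimes>\<^bsub>C\<^esub> x \<in> null_ideal K v"
      if "a \<in> null_ideal K v" "x \<in> cs" for a x
      using that null_mult[of x a] cs_mult[of x a] by (auto simp: null_ideal_iff mult.commute)
  qed
qed

lemma completion_cring: "cring Kv"
  unfolding completion_def by (rule ideal.quotient_is_cring[OF ideal_null C_cring])

lemma cl_hom:
  "s \<in> cs \<Longrightarrow> cl s \<in> carrier Kv"
  "s \<in> cs \<Longrightarrow> t \<in> cs \<Longrightarrow> cl s \<otimes>\<^bsub>Kv\<^esub> cl t = cl (\<lambda>i. s i * t i)"
  "s \<in> cs \<Longrightarrow> t \<in> cs \<Longrightarrow> cl s \<oplus>\<^bsub>Kv\<^esub> cl t = cl (\<lambda>i. s i + t i)"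
  "\<one>\<^bsub>Kv\<^esub> = cl (\<lambda>_. 1)" "\<zero>\<^bsub>Kv\<^esub> = cl (\<lambda>_. 0)"
  "s \<in> cs \<Longrightarrow> \<ominus>\<^bsub>Kv\<^esub> cl s = cl (\<lambda>i. - s i)"
proof -
  interpret h: ring_hom_cring C "C Quot null_ideal K v" "(+>\<^bsub>C\<^esub>) (null_ideal K v)"
    by (rule ideal.rcos_ring_hom_cring[OF ideal_null C_cring])
  show 1: "s \<in> cs \<Longrightarrow> cl s \<in> carrier Kv"
    using h.hom_closed by (simp add: completion_def)
  show "s \<in> cs \<Longrightarrow> t \<in> cs \<Longrightarrow> cl s \<otimes>\<^bsub>Kv\<^esub> cl t = cl (\<lambda>i. s i * t i)"
    using h.hom_mult[of s t] by (simp add: completion_def)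
  show "s \<in> cs \<Longrightarrow> t \<in> cs \<Longrightarrow> cl s \<oplus>\<^bsub>Kv\<^esub> cl t = cl (\<lambda>i. s i + t i)"
    using h.hom_add[of s t] by (simp add: completion_def)
  show "\<one>\<^bsub>Kv\<^esub> = cl (\<lambda>_. 1)" using h.hom_one by (simp add: completion_def)
  show "\<zero>\<^bsub>Kv\<^esub> = cl (\<lambda>_. 0)" using h.hom_zero by (simp add: completion_def)
  show "\<ominus>\<^bsub>Kv\<^esub> cl s = cl (\<lambda>i. - s i)" if "s \<in> cs"
  proof -
    have "\<ominus>\<^bsub>C\<^esub> s = (\<lambda>i. - s i)"
      by (rule h.R.minus_equality) (use that cs_minus in auto)
    thus ?thesis using h.hom_a_inv[OF that] by (simp add: completion_def)
  qed
qed

lemma cl_eq_zero_iff: "s \<in> cs \<Longrightarrow> cl s = \<zero>\<^bsub>Kv\<^esub> \<longleftrightarrow> null s"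
proof -
  assume s: "s \<in> cs"
  interpret h: ring_hom_cring C "C Quot null_ideal K v" "(+>\<^bsub>C\<^esub>) (null_ideal K v)"
    by (rule ideal.rcos_ring_hom_cring[OF ideal_null C_cring])
  interpret I: ideal "null_ideal K v" C by (rule ideal_null)
  have z: "\<zero>\<^bsub>Kv\<^esub> = null_ideal K v" by (simp add: completion_def FactRing_def)
  show ?thesis
  proof
    assume "cl s = \<zero>\<^bsub>Kv\<^esub>"
    hence "s \<in> null_ideal K v" using I.a_rcos_self[OF s] z by simp
    thus "null s" by (simp add: null_ideal_iff)
  next
    assume "null s"
    hence "s \<in> null_ideal K v" using s by (simp add: null_ideal_iff)
    thus "cl s = \<zero>\<^bsub>Kv\<^esub>" unfolding z by (rule I.a_rcos_const)
  qed
qed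

lemma completion_carrier: "carrier Kv = cl ` cs"
  by (auto simp: completion_def FactRing_def A_RCOSETS_def')

lemma rat_completion_eq: "Qv = cl ` {s \<in> cs. range s \<subseteq> \<rat>}"
  by (auto simp: rat_completion_def)

text \<open>A Cauchy sequence that reaches \<open>e\<close> infinitely often stays above
  \<open>e / 2\<close> once its oscillation is below \<open>e / 2\<close>.\<close>

lemma not_null_bounded_below:
  assumes s: "s \<in> cs" "\<not> null s"
  obtains e N where "e > 0" "\<And>i. i \<ge> N \<Longrightarrow> v (s i) \<ge> e"
proof -
  obtain e where e: "e > 0" "\<And>N. \<exists>n\<ge>N. \<not> v (s n) < e"
    using s(2) v_nonneg[OF cs_K[OF s(1)]] unfolding LIMSEQ_iff by auto
  obtain N where N: "\<And>i j. i \<ge> N \<Longrightarrow> j \<ge> N \<Longrightarrow> v (s i - s j) < e / 2"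
    using s(1) e(1) unfolding cs_iff by (meson half_gt_zero)
  obtain n where n: "n \<ge> N" "v (s n) \<ge> e" using e(2)[of N] by auto
  have "v (s i) \<ge> e / 2" if "i \<ge> N" for i
  proof -
    have "v (s n) \<le> v (s n - s i) + v (s i)"
      using v_triangle[of "s n - s i" "s i"] cs_K[OF s(1)] K.F_diff by simp
    thus ?thesis using N[OF n(1) that] n(2) by simp
  qed
  thus ?thesis using that[of "e / 2" N] e(1) by simp
qed

text \<open>Finitely many terms may be 0, and there \<open>inverse 0 = 0\<close>; the product with
  the original sequence is therefore 1 only up to a null sequence.\<close>

lemma cs_inverse:
  assumes s: "s \<in> cs" "\<not> null s"
  shows "(\<lambda>i. inverse (s i)) \<in> cs" "null (\<lambda>i. s i * inverse (s i) - 1)"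
proof -
  obtain d N where d: "d > 0" "\<And>i. i \<ge> N \<Longrightarrow> v (s i) \<ge> d" using not_null_bounded_below[OF s] by blast
  note KK = cs_K[OF s(1)]
  have nz: "s i \<noteq> 0" if "i \<ge> N" for i using d that v_eq_0[OF KK, of i] by force
  show "(\<lambda>i. inverse (s i)) \<in> cs" unfolding cs_iff
  proof (intro conjI allI impI)
    show "inverse (s i) \<in> K" for i using KK K.F_inverse by blast
    fix e :: real assume e: "e > 0"
    hence "e * (d * d) > 0" using d by simp
    then obtain M where M: "\<And>i j. i \<ge> M \<Longrightarrow> j \<ge> M \<Longrightarrow> v (s i - s j) < e * (d * d)"
      using s(1) unfolding cs_iff by meson
    have "v (inverse (s i) - inverse (s j)) < e" if ij: "i \<ge> max N M" "j \<ge> max N M" for i j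
    proof -
      have "inverse (s i) - inverse (s j) = (s j - s i) * (inverse (s i) * inverse (s j))"
        using nz[of i] nz[of j] ij by (simp add: field_simps)
      hence "v (inverse (s i) - inverse (s j)) = v (s j - s i) * (inverse (v (s i)) * inverse (v (s j)))"
        using v_mult K.F_diff KK K.F_mult K.F_inverse v_inverse by metis
      also have "\<dots> \<le> v (s j - s i) * (inverse d * inverse d)"
        using d(2)[of i] d(2)[of j] d(1) ij v_nonneg[OF K.F_diff[OF KK KK]]
        by (intro mult_left_mono mult_mono le_imp_inverse_le) auto
      also have "\<dots> < e * (d * d) * (inverse d * inverse d)"
        using M[of j i] ij d(1) by (intro mult_strict_right_mono) auto
      also have "\<dots> = e" using d(1) by (simp add: field_simps)
      finally show ?thesis .
    qed
    thus "\<exists>N. \<forall>i\<ge>N. \<forall>j\<ge>N. v (inverse (s i) - inverse (s j)) < e" by blast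
  qed
  show "null (\<lambda>i. s i * inverse (s i) - 1)"
    by (rule tendsto_eventually) (use nz in \<open>auto intro!: eventually_sequentiallyI[of N]\<close>)
qed

lemma cl_eqI:
  assumes "s \<in> cs" "t \<in> cs" "null (\<lambda>i. s i - t i)"
  shows "cl s = cl t"
proof -
  interpret Q: cring Kv by (rule completion_cring)
  have "cl (\<lambda>i. s i - t i) = \<zero>\<^bsub>Kv\<^esub>" using cl_eq_zero_iff[OF cs_diff[OF assms(1,2)]] assms by simp
  moreover have "cl (\<lambda>i. s i - t i) = cl s \<oplus>\<^bsub>Kv\<^esub> cl (\<lambda>i. - t i)"
    using cl_hom(3)[OF assms(1) cs_minus[OF assms(2)]] by simp
  moreover have "cl s = (cl s \<oplus>\<^bsub>Kv\<^esub> cl (\<lambda>i. - t i)) \<oplus>\<^bsub>Kv\<^esub> cl t"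
    using assms cl_hom(3)[OF cs_add[OF assms(1) cs_minus[OF assms(2)]] assms(2)]
      cl_hom(3)[OF assms(1) cs_minus[OF assms(2)]] by simp
  ultimately show ?thesis using cl_hom(1)[OF assms(2)] by simp
qed

text \<open>Needed to speak of the dimension over \<open>Qv\<close>. A class other than zero has an
  inverse by \<open>cs_inverse\<close>, and termwise inverses of rationals are rational.\<close>

lemma rat_completion_subfield: "subfield Qv Kv"
proof -
  interpret Q: cring Kv by (rule completion_cring)
  have F: "s \<in> cs \<Longrightarrow> range s \<subseteq> \<rat> \<Longrightarrow> cl s \<in> Qv" for s by (auto simp: rat_completion_eq)
  have sub: "subring Qv Kv"
  proof (rule Q.subringI)
    show "Qv \<subseteq> carrier Kv" using cl_hom(1) by (auto simp: rat_completion_eq)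
    show "\<one>\<^bsub>Kv\<^esub> \<in> Qv" unfolding cl_hom(4) by (intro F cs_const) auto
    show "\<ominus>\<^bsub>Kv\<^esub> h \<in> Qv" if h: "h \<in> Qv" for h
    proof -
      obtain s where s: "s \<in> cs" "range s \<subseteq> \<rat>" "h = cl s" using h by (auto simp: rat_completion_eq)
      thus ?thesis unfolding s(3) cl_hom(6)[OF s(1)] by (intro F cs_minus) auto
    qed
    show "h1 \<otimes>\<^bsub>Kv\<^esub> h2 \<in> Qv" "h1 \<oplus>\<^bsub>Kv\<^esub> h2 \<in> Qv" if h12: "h1 \<in> Qv" "h2 \<in> Qv" for h1 h2
    proof -
      obtain s t where s: "s \<in> cs" "range s \<subseteq> \<rat>" "h1 = cl s" "t \<in> cs" "range t \<subseteq> \<rat>" "h2 = cl t"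
        using h12 by (auto simp: rat_completion_eq)
      show "h1 \<otimes>\<^bsub>Kv\<^esub> h2 \<in> Qv"
        unfolding s(3,6) cl_hom(2)[OF s(1,4)] using s by (intro F cs_mult) (auto intro: Rats_mult)
      show "h1 \<oplus>\<^bsub>Kv\<^esub> h2 \<in> Qv"
        unfolding s(3,6) cl_hom(3)[OF s(1,4)] using s by (intro F cs_add) (auto intro: Rats_add)
    qed
  qed
  have one_neq: "\<one>\<^bsub>Kv\<^esub> \<noteq> \<zero>\<^bsub>Kv\<^esub>"
    unfolding cl_hom(4) using cl_eq_zero_iff[OF cs_const[of 1]] by (simp add: LIMSEQ_const_iff)
  show ?thesis
  proof (rule Q.subfieldI)
    show "subcring Qv Kv" by (rule Q.subcringI'[OF sub])
    show "Units (Kv\<lparr>carrier := Qv\<rparr>) = Qv - {\<zero>\<^bsub>Kv\<^esub>}"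
    proof (intro equalityI subsetI)
      fix x assume "x \<in> Units (Kv\<lparr>carrier := Qv\<rparr>)"
      then obtain y where "x \<in> Qv" "y \<in> Qv" "y \<otimes>\<^bsub>Kv\<^esub> x = \<one>\<^bsub>Kv\<^esub>"
        by (auto simp: Units_def)
      thus "x \<in> Qv - {\<zero>\<^bsub>Kv\<^esub>}" using one_neq subringE(1)[OF sub] by (metis DiffI Q.r_null singletonD subsetD)
    next
      fix x assume x: "x \<in> Qv - {\<zero>\<^bsub>Kv\<^esub>}"
      then obtain s where s: "s \<in> cs" "range s \<subseteq> \<rat>" "x = cl s" by (auto simp: rat_completion_eq)
      hence "\<not> null s" using x cl_eq_zero_iff by auto
      note inv = cs_inverse[OF s(1) this]
      have "cl s \<otimes>\<^bsub>Kv\<^esub> cl (\<lambda>i. inverse (s i)) = \<one>\<^bsub>Kv\<^esub>"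
        unfolding cl_hom(2)[OF s(1) inv(1)] cl_hom(4)
        by (rule cl_eqI[OF cs_mult[OF s(1) inv(1)] cs_const inv(2)]) simp
      moreover have "cl (\<lambda>i. inverse (s i)) \<in> Qv" using s(2) by (intro F inv(1)) auto
      ultimately show "x \<in> Units (Kv\<lparr>carrier := Qv\<rparr>)"
        using x s(3) subringE(1)[OF sub] Q.m_comm[of "cl s" "cl (\<lambda>i. inverse (s i))"] by (auto simp: Units_def intro!: bexI)
    qed
  qed
qed

end

section \<open>Local degrees\<close>

context valued_number_field
begin

abbreviation lc :: "nat \<Rightarrow> (nat \<Rightarrow> rat) \<Rightarrow> complex" where
  "lc k c \<equiv> (\<Sum>i<k. of_rat (c i) * \<alpha> ^ i)"

lemma lc_K [simp]: "lc k c \<in> K"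
  by (intro K.F_sum K.F_mult K.F_power) auto

lemma lc_add: "lc k a + lc k b = lc k (\<lambda>i. a i + b i)"
  by (simp add: of_rat_add distrib_right sum.distrib)

lemma lc_diff: "lc k a - lc k b = lc k (\<lambda>i. a i - b i)"
  by (simp add: of_rat_diff left_diff_distrib sum_subtractf)

lemma lc_scale: "of_rat q * lc k a = lc k (\<lambda>i. q * a i)"
  by (simp add: of_rat_mult sum_distrib_left mult.assoc)

text \<open>Linear independence of \<open>1, \<alpha>, \<dots>, \<alpha>\<^sup>k\<^sup>-\<^sup>1\<close> over the closure of \<open>\<rat>\<close> in the completion,
  phrased with sequences of rationals only.\<close>

definition powers_indep :: "nat \<Rightarrow> bool" where
  "powers_indep k \<longleftrightarrow>
     (\<forall>c. null (\<lambda>n. lc k (c n)) \<longrightarrow> (\<forall>i<k. null (\<lambda>n. of_rat (c n i))))"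

lemma powers_indepD: "powers_indep k \<Longrightarrow> null (\<lambda>n. lc k (c n)) \<Longrightarrow> i < k \<Longrightarrow> null (\<lambda>n. of_rat (c n i))"
  unfolding powers_indep_def by blast

lemma powers_indep_mono:
  assumes "powers_indep k" "j \<le> k" shows "powers_indep j"
  unfolding powers_indep_def
proof (intro allI impI)
  fix c i assume c: "null (\<lambda>n. lc j (c n))" and i: "i < j"
  define c' where "c' = (\<lambda>n i. if i < j then c n i else 0)"
  have "lc k (c' n) = lc j (c n)" for n
    unfolding c'_def using assms(2) by (intro sum.mono_neutral_cong_right) auto
  hence "null (\<lambda>n. of_rat (c' n i))" using powers_indepD[OF assms(1), of c' i] c i assms(2) by simp
  thus "null (\<lambda>n. of_rat (c n i))" using i by (simp add: c'_def)
qed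

text \<open>The coefficients of the minimal polynomial, repeated as a constant sequence, form a
  relation whose top coefficient stays 1. This bounds the lengths of independent families.\<close>

lemma not_powers_indep: "\<not> powers_indep (Suc d)"
proof
  assume "powers_indep (Suc d)"
  moreover have "lc (Suc d) (coeff minpoly) = 0"
    using minpoly(2) qeval_altdef[of minpoly "Suc d" \<alpha>] by simp
  ultimately have "null (\<lambda>n. of_rat (coeff minpoly d))"
    using powers_indepD[of "Suc d" "\<lambda>_. coeff minpoly" d] by simp
  thus False using minpoly(1) by (simp add: LIMSEQ_const_iff)
qed

text \<open>Suppose no constant works. Counterexamples for the constants n + 1, scaled to have a
  largest coefficient of value 1, are combinations tending to 0 whose coefficients do not, against
  independence.\<close>

lemma coefficients_bounded:
  assumes "powers_indep k"
  obtains B where "B > 0" "\<And>c i. i < k \<Longrightarrow> v (of_rat (c i)) \<le> B * v (lc k c)"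
proof -
  have "\<exists>B>0. \<forall>c. \<forall>i<k. v (of_rat (c i)) \<le> B * v (lc k c)"
  proof (rule ccontr)
    assume "\<not> ?thesis"
    hence "\<forall>n. \<exists>c. \<exists>i<k. v (of_rat (c i)) > real (Suc n) * v (lc k c)"
      by (meson not_le of_nat_0_less_iff zero_less_Suc)
    then obtain c i where ci: "\<And>n. i n < k" "\<And>n. v (of_rat (c n (i n))) > real (Suc n) * v (lc k (c n))"
      by metis
    have "\<exists>j<k. \<forall>l<k. v (of_rat (c n l)) \<le> v (of_rat (c n j))" for n
    proof -
      have "Max ((\<lambda>l. v (of_rat (c n l))) ` {..<k}) \<in> (\<lambda>l. v (of_rat (c n l))) ` {..<k}"
        using ci(1)[of n] by (intro Max_in) auto
      then obtain j where "j < k" "v (of_rat (c n j)) = Max ((\<lambda>l. v (of_rat (c n l))) ` {..<k})" by auto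
      thus ?thesis by (intro exI[of _ j]) auto
    qed
    then obtain j where j: "\<And>n. j n < k" "\<And>n l. l < k \<Longrightarrow> v (of_rat (c n l)) \<le> v (of_rat (c n (j n)))"
      by metis
    define c' where "c' = (\<lambda>n l. inverse (c n (j n)) * c n l)"
    have pos: "v (of_rat (c n (j n))) > real (Suc n) * v (lc k (c n))" for n
      using ci(2)[of n] j(2)[OF ci(1), of n n] by linarith
    have pos0: "v (of_rat (c n (j n))) > 0" for n
    proof -
      have "real (Suc n) * v (lc k (c n)) \<ge> 0" using v_nonneg[OF lc_K] by simp
      thus ?thesis using pos[of n] by linarith
    qed
    have "v (lc k (c' n)) \<le> 1 / real (Suc n)" for n
    proof -
      have "lc k (c' n) = of_rat (inverse (c n (j n))) * lc k (c n)"
        unfolding c'_def lc_scale ..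
      hence "v (lc k (c' n)) = v (of_rat (inverse (c n (j n)))) * v (lc k (c n))"
        by (simp only: v_mult[OF K.F_rat lc_K])
      hence eq: "v (lc k (c' n)) = inverse (v (of_rat (c n (j n)))) * v (lc k (c n))"
        by (simp only: of_rat_inverse v_inverse[OF K.F_rat])
      have le: "inverse b * a \<le> 1 / real (Suc n)" if "real (Suc n) * a < b" "b > 0" for a b
        using that by (simp add: field_simps del: of_nat_Suc)
      show ?thesis unfolding eq using pos[of n] pos0[of n] by (rule le)
    qed
    hence "null (\<lambda>n. lc k (c' n))"
      by (intro tendsto_sandwich[OF _ _ tendsto_const LIMSEQ_Suc[OF lim_1_over_n]]
          always_eventually allI v_nonneg lc_K)
    hence "null (\<lambda>n. of_rat (c' n l))" if "l < k" for l
      using powers_indepD[OF assms] that by blast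
    \<comment> \<open>The position \<open>j n\<close> of the coefficient scaled to 1 may change with
      \<open>n\<close>; the sum over all positions is at least 1 regardless.\<close>
    hence "(\<lambda>n. \<Sum>l<k. v (of_rat (c' n l))) \<longlonglongrightarrow> (\<Sum>l<k. 0)" by (intro tendsto_sum) auto
    moreover have "(\<Sum>l<k. v (of_rat (c' n l))) \<ge> 1" for n
    proof -
      have "c n (j n) \<noteq> 0" using pos0[of n] by auto
      hence "v (of_rat (c' n (j n))) = 1" by (simp add: c'_def)
      moreover have "v (of_rat (c' n (j n))) \<le> (\<Sum>l<k. v (of_rat (c' n l)))"
        using j(1) v_nonneg by (intro member_le_sum) auto
      ultimately show ?thesis by simp
    qed
    ultimately have "(\<Sum>l<k. 0) \<ge> (1::real)" by (intro LIMSEQ_le_const) auto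
    thus False by simp
  qed
  thus ?thesis using that by blast
qed

text \<open>\<open>S\<close> is the closure in \<open>K\<close> of the span of the first
  \<open>k\<close> powers of \<alpha>. Dependence at length \<open>k + 1\<close> puts the next power
  into it, so the closure is stable under multiplication by \<alpha> and is all of
  \<open>K\<close>.\<close>

lemma powers_dense:
  assumes ind: "powers_indep k" "\<not> powers_indep (Suc k)" and x: "x \<in> K" and \<delta>: "\<delta> > 0"
  obtains c where "v (x - lc k c) < \<delta>"
proof -
  define S where "S = {x \<in> K. \<forall>\<delta>>0. \<exists>c. v (x - lc k c) < \<delta>}"
  have SD: "\<exists>c. v (x - lc k c) < \<delta>" if "x \<in> S" "\<delta> > 0" for x \<delta>
    using that by (auto simp: S_def)
  have S_add: "x + y \<in> S" if xy: "x \<in> S" "y \<in> S" for x y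
    unfolding S_def
  proof (safe)
    show "x + y \<in> K" using xy K.F_add by (auto simp: S_def)
    fix \<delta> :: real assume "\<delta> > 0"
    then obtain a b where ab: "v (x - lc k a) < \<delta> / 2" "v (y - lc k b) < \<delta> / 2"
      using SD[OF xy(1), of "\<delta> / 2"] SD[OF xy(2), of "\<delta> / 2"] by auto
    have "v (x + y - lc k (\<lambda>i. a i + b i)) = v ((x - lc k a) + (y - lc k b))"
      unfolding lc_add[symmetric] by (simp add: algebra_simps)
    also have "\<dots> \<le> v (x - lc k a) + v (y - lc k b)"
      using xy by (intro v_triangle K.F_diff) (auto simp: S_def)
    also have "\<dots> < \<delta>" using ab by simp
    finally show "\<exists>c. v (x + y - lc k c) < \<delta>" by (intro exI[of _ "\<lambda>i. a i + b i"])
  qed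
  have S_scale: "of_rat q * x \<in> S" if xs: "x \<in> S" for x q
    unfolding S_def
  proof (safe)
    show "of_rat q * x \<in> K" using xs K.F_mult by (auto simp: S_def)
    fix \<delta> :: real assume \<delta>: "\<delta> > 0"
    have p: "v (of_rat q) + 1 > 0" using v_nonneg[OF K.F_rat, of q] by simp
    then obtain a where a: "v (x - lc k a) < \<delta> / (v (of_rat q) + 1)"
      using SD[OF xs, of "\<delta> / (v (of_rat q) + 1)"] \<delta> by auto
    have "v (of_rat q * x - lc k (\<lambda>i. q * a i)) = v (of_rat q * (x - lc k a))"
      by (simp add: right_diff_distrib lc_scale)
    also have "\<dots> = v (of_rat q) * v (x - lc k a)"
      using xs by (intro v_mult K.F_diff) (auto simp: S_def)
    also have "\<dots> \<le> (v (of_rat q) + 1) * v (x - lc k a)"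
      using xs by (intro mult_right_mono v_nonneg K.F_diff) (auto simp: S_def)
    also have "\<dots> < \<delta>" using a p by (simp add: field_simps)
    finally show "\<exists>c. v (of_rat q * x - lc k c) < \<delta>" by (intro exI[of _ "\<lambda>i. q * a i"])
  qed
  have S_0: "0 \<in> S"
    unfolding S_def by (auto intro!: exI[of _ "\<lambda>_. 0"])
  have S_sum: "(\<Sum>i\<in>I. f i) \<in> S" if "\<And>i. i \<in> I \<Longrightarrow> f i \<in> S" for I :: "nat set" and f
    using that by (induction I rule: infinite_finite_induct) (auto intro: S_add S_0)
  have S_small: "\<alpha> ^ l \<in> S" if l: "l < k" for l
  proof -
    have "lc k (\<lambda>i. if i = l then 1 else 0) = (\<Sum>i<k. if i = l then \<alpha> ^ i else 0)"
      by (intro sum.cong) auto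
    also have "\<dots> = \<alpha> ^ l" using l by simp
    finally have "v (\<alpha> ^ l - lc k (\<lambda>i. if i = l then 1 else 0)) = 0" by simp
    thus ?thesis unfolding S_def by (auto intro!: K.F_power exI[of _ "\<lambda>i. if i = l then 1 else 0"])
  qed
  have S_k: "\<alpha> ^ k \<in> S"
    unfolding S_def
  proof safe
    show "\<alpha> ^ k \<in> K" by (simp add: K.F_power)
    fix \<delta> :: real assume \<delta>: "\<delta> > 0"
    obtain c i where c: "null (\<lambda>n. lc (Suc k) (c n))" "i < Suc k" "\<not> null (\<lambda>n. of_rat (c n i))"
      using ind(2) unfolding powers_indep_def by blast
    \<comment> \<open>Otherwise the last term could be dropped, leaving a null sequence of
      combinations of length \<open>k\<close> whose coefficients are not all null.\<close>
    have nk: "\<not> null (\<lambda>n. of_rat (c n k))"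
    proof
      assume nk: "null (\<lambda>n. of_rat (c n k))"
      have "null (\<lambda>n. lc k (c n))"
      proof (rule tendsto_sandwich[where f = "\<lambda>_. 0" and h = "\<lambda>n. v (lc (Suc k) (c n)) + v (of_rat (c n k)) * v (\<alpha> ^ k)"])
        show "(\<lambda>n. v (lc (Suc k) (c n)) + v (of_rat (c n k)) * v (\<alpha> ^ k)) \<longlonglongrightarrow> 0"
          using tendsto_add[OF c(1) tendsto_mult_right[OF nk, of "v (\<alpha> ^ k)"]] by simp
        have "v (lc k (c n)) \<le> v (lc (Suc k) (c n)) + v (of_rat (c n k)) * v (\<alpha> ^ k)" for n
        proof -
          have "v (lc (Suc k) (c n) - of_rat (c n k) * \<alpha> ^ k) \<le>
            v (lc (Suc k) (c n)) + v (of_rat (c n k) * \<alpha> ^ k)"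
            by (intro v_diff lc_K K.F_mult K.F_power) auto
          thus ?thesis by (simp add: v_mult K.F_power)
        qed
        thus "\<forall>\<^sub>F n in sequentially. v (lc k (c n)) \<le> v (lc (Suc k) (c n)) + v (of_rat (c n k)) * v (\<alpha> ^ k)"
          by simp
      qed (auto intro!: always_eventually v_nonneg)
      hence "null (\<lambda>n. of_rat (c n i))"
        using powers_indepD[OF ind(1), of c i] c(2) nk by (cases "i = k") auto
      thus False using c(3) by blast
    qed
    then obtain e where e: "e > 0" "\<And>N. \<exists>n\<ge>N. \<not> v (of_rat (c n k)) < e"
      using v_nonneg[OF K.F_rat] unfolding LIMSEQ_iff by auto
    have "\<delta> * e > 0" using \<delta> e by simp
    then obtain N where N: "\<And>n. n \<ge> N \<Longrightarrow> v (lc (Suc k) (c n)) < \<delta> * e"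
      using c(1) v_nonneg[OF lc_K] unfolding LIMSEQ_iff by (metis abs_of_nonneg diff_zero real_norm_def)
    obtain n where n: "n \<ge> N" "v (of_rat (c n k)) \<ge> e" using e(2)[of N] by auto
    have cnk: "c n k \<noteq> 0" using n(2) e(1) by auto
    \<comment> \<open>The relation is solved for \<open>\<alpha> ^ k\<close> at an index where its
      last coefficient has value at least \<open>e\<close>; the error is then below
      \<open>\<delta>\<close>.\<close>
    have "\<alpha> ^ k - lc k (\<lambda>i. (- inverse (c n k)) * c n i) = of_rat (inverse (c n k)) * lc (Suc k) (c n)"
      unfolding lc_scale[symmetric] using cnk by (simp add: distrib_left of_rat_inverse of_rat_minus)
    hence "v (\<alpha> ^ k - lc k (\<lambda>i. (- inverse (c n k)) * c n i)) = v (of_rat (inverse (c n k))) * v (lc (Suc k) (c n))"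
      by (simp only: v_mult[OF K.F_rat lc_K])
    hence "v (\<alpha> ^ k - lc k (\<lambda>i. (- inverse (c n k)) * c n i)) = inverse (v (of_rat (c n k))) * v (lc (Suc k) (c n))"
      by (simp only: of_rat_inverse v_inverse[OF K.F_rat])
    also have "\<dots> \<le> inverse e * v (lc (Suc k) (c n))"
      using n e by (intro mult_right_mono le_imp_inverse_le v_nonneg lc_K)
    also have "\<dots> < inverse e * (\<delta> * e)"
      using N[OF n(1)] e(1) by (intro mult_strict_left_mono) auto
    also have "\<dots> = \<delta>" using e(1) by simp
    finally show "\<exists>c. v (\<alpha> ^ k - lc k c) < \<delta>"
      by (intro exI[of _ "\<lambda>i. (- inverse (c n k)) * c n i"])
  qed
  have S_alpha: "\<alpha> * x \<in> S" if xs: "x \<in> S" for x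
    unfolding S_def
  proof safe
    show "\<alpha> * x \<in> K" using xs K.F_mult by (auto simp: S_def)
    fix \<delta> :: real assume \<delta>: "\<delta> > 0"
    have p: "v \<alpha> + 1 > 0" using v_nonneg[OF K_alpha] by simp
    hence "\<delta> / 2 / (v \<alpha> + 1) > 0" using \<delta> by simp
    then obtain a where a: "v (x - lc k a) < \<delta> / 2 / (v \<alpha> + 1)"
      using SD[OF xs] by blast
    have "\<alpha> * lc k a = (\<Sum>i<k. of_rat (a i) * \<alpha> ^ Suc i)"
      by (simp add: sum_distrib_left mult_ac)
    also have "\<dots> \<in> S"
    proof (intro S_sum S_scale)
      fix i assume "i \<in> {..<k}"
      thus "\<alpha> ^ Suc i \<in> S" using S_small[of "Suc i"] S_k by (cases "Suc i = k") auto
    qed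
    finally obtain b where b: "v (\<alpha> * lc k a - lc k b) < \<delta> / 2"
      using \<delta> SD[of "\<alpha> * lc k a" "\<delta> / 2"] by auto
    have xK: "x \<in> K" using xs by (simp add: S_def)
    have "v (\<alpha> * x - lc k b) \<le> v (\<alpha> * x - \<alpha> * lc k a) + v (\<alpha> * lc k a - lc k b)"
      using xK by (intro v_diff_triangle K.F_mult) auto
    also have "v (\<alpha> * x - \<alpha> * lc k a) = v \<alpha> * v (x - lc k a)"
      using xK by (subst v_mult[symmetric]) (auto simp: K.F_diff right_diff_distrib)
    also have "\<dots> \<le> (v \<alpha> + 1) * v (x - lc k a)"
      using xK by (intro mult_right_mono v_nonneg K.F_diff) auto
    also have "\<dots> < \<delta> / 2" using a p by (simp add: field_simps)
    finally show "\<exists>c. v (\<alpha> * x - lc k c) < \<delta>" using b by (intro exI[of _ b]) simp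
  qed
  have S_one: "1 \<in> S"
  proof (cases "k = 0")
    case True
    thus ?thesis using S_k by simp
  next
    case False
    thus ?thesis using S_small[of 0] by simp
  qed
  have pow: "\<alpha> ^ l \<in> S" for l
    by (induction l) (use S_one S_alpha in auto)
  obtain c where "x = lc d c" using K_coeffs[OF x] by blast
  hence "x \<in> S" using S_sum[of "{..<d}" "\<lambda>i. of_rat (c i) * \<alpha> ^ i"] S_scale pow by simp
  thus ?thesis using that \<delta> unfolding S_def by blast
qed

lemma combine_cl:
  assumes "length Ks = length Us" "\<And>s. s \<in> set Ks \<Longrightarrow> s \<in> cs" "\<And>s. s \<in> set Us \<Longrightarrow> s \<in> cs"
  shows "ring.combine Kv (map cl Ks) (map cl Us) =
           cl (\<lambda>n. \<Sum>i<length Us. (Ks ! i) n * (Us ! i) n)"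
    and "(\<lambda>n. \<Sum>i<length Us. (Ks ! i) n * (Us ! i) n) \<in> cs"
  using assms
proof (induction Ks Us rule: list_induct2)
  interpret Q: cring Kv by (rule completion_cring)
  case Nil
  { case 1 show ?case by (simp add: cl_hom(5))
  next case 2 show ?case using cs_const[of 0] by simp }
next
  interpret Q: cring Kv by (rule completion_cring)
  case (Cons x xs y ys)
  note IH = Cons.IH
  have xy: "x \<in> cs" "y \<in> cs" "\<And>s. s \<in> set xs \<Longrightarrow> s \<in> cs" "\<And>s. s \<in> set ys \<Longrightarrow> s \<in> cs" if
    "\<And>s. s \<in> set (x # xs) \<Longrightarrow> s \<in> cs" "\<And>s. s \<in> set (y # ys) \<Longrightarrow> s \<in> cs" using that by auto
  have eq: "(\<lambda>n. \<Sum>i<length (y # ys). ((x # xs) ! i) n * ((y # ys) ! i) n) =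
    (\<lambda>n. x n * y n + (\<Sum>i<length ys. (xs ! i) n * (ys ! i) n))"
    by (simp add: sum.lessThan_Suc_shift del: sum.lessThan_Suc)
  { case 1
    note a = xy[OF 1]
    show ?case unfolding eq
      using IH[OF a(3,4)] a(1,2) by (simp add: cl_hom(2) cl_hom(3) cs_mult)
  next
    case 2
    note a = xy[OF 2]
    show ?case unfolding eq using IH[OF a(3,4)] a(1,2) by (intro cs_add cs_mult) auto }
qed

text \<open>Independence passes directly to classes. For generation, a Cauchy sequence is
  approximated by combinations of the powers; by \<open>coefficients_bounded\<close> each
  coefficient is itself a Cauchy sequence of rationals and so has a class in
  \<open>Qv\<close>.\<close>

lemma completion_dimension:
  assumes ind: "powers_indep k" "\<not> powers_indep (Suc k)"
  shows "local_degree K v = k"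
proof -
  interpret Q: cring Kv by (rule completion_cring)
  note F = rat_completion_subfield
  define Us where "Us = map (\<lambda>i (n::nat). \<alpha> ^ i) [0..<k]"
  have Us: "length Us = k" "\<And>s. s \<in> set Us \<Longrightarrow> s \<in> cs" by (auto simp: Us_def intro!: cs_const K.F_power)
  have comb: "Q.combine (map cl Ks) (map cl Us) = cl (\<lambda>n. \<Sum>i<k. (Ks ! i) n * \<alpha> ^ i)"
    "(\<lambda>n. \<Sum>i<k. (Ks ! i) n * \<alpha> ^ i) \<in> cs"
    if "length Ks = k" "\<And>s. s \<in> set Ks \<Longrightarrow> s \<in> cs" for Ks
  proof -
    have "(\<lambda>n. \<Sum>i<length Us. (Ks ! i) n * (Us ! i) n) = (\<lambda>n. \<Sum>i<k. (Ks ! i) n * \<alpha> ^ i)"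
      by (simp add: Us_def)
    thus "Q.combine (map cl Ks) (map cl Us) = cl (\<lambda>n. \<Sum>i<k. (Ks ! i) n * \<alpha> ^ i)"
      "(\<lambda>n. \<Sum>i<k. (Ks ! i) n * \<alpha> ^ i) \<in> cs"
      using combine_cl[of Ks Us] that Us by simp_all
  qed
  have Us_carrier: "set (map cl Us) \<subseteq> carrier Kv" using Us cl_hom(1) by auto
  have lift: "\<exists>Ks'. Ks = map cl Ks' \<and> (\<forall>s\<in>set Ks'. s \<in> cs \<and> range s \<subseteq> \<rat>)" if Ks: "set Ks \<subseteq> Qv" for Ks
  proof -
    have "\<forall>x\<in>set Ks. \<exists>s. s \<in> cs \<and> range s \<subseteq> \<rat> \<and> x = cl s"
      using Ks by (auto simp: rat_completion_eq)
    then obtain g where "\<forall>x\<in>set Ks. g x \<in> cs \<and> range (g x) \<subseteq> \<rat> \<and> x = cl (g x)" by metis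
    thus ?thesis by (intro exI[of _ "map g Ks"]) (auto simp: map_idI)
  qed
  have "Q.independent Qv (map cl Us)"
  proof (rule Q.trivial_combine_imp_independent[OF F Us_carrier])
    fix Ks assume Ks: "set Ks \<subseteq> Qv" "Q.combine Ks (map cl Us) = \<zero>\<^bsub>Kv\<^esub>"
    have sub: "Qv \<subseteq> carrier Kv" using subfieldE(3)[OF F] .
    obtain Ks1 where Ks1: "set (take (length (map cl Us)) Ks) \<subseteq> set Ks1"
      "set Ks1 \<subseteq> set (take (length (map cl Us)) Ks) \<union> {\<zero>\<^bsub>Kv\<^esub>}"
      "length Ks1 = length (map cl Us)" "Q.combine Ks1 (map cl Us) = \<zero>\<^bsub>Kv\<^esub>"
      using Q.combine_normalize[of Ks "map cl Us" "\<zero>\<^bsub>Kv\<^esub>"] Ks Us_carrier sub by blast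
    have "set Ks1 \<subseteq> Qv"
      using Ks1(2) Ks(1) subringE(2)[OF subfieldE(1)[OF F]] by (meson Un_least empty_subsetI insert_subset order.trans set_take_subset)
    then obtain Ks' where Ks': "Ks1 = map cl Ks'" "\<forall>s\<in>set Ks'. s \<in> cs \<and> range s \<subseteq> \<rat>" using lift by blast
    have len: "length Ks' = k" using Ks1(3) Ks'(1) Us(1) by simp
    have "\<forall>i\<in>{..<k}. \<forall>n. \<exists>q. (Ks' ! i) n = of_rat q"
      using Ks'(2) len by (metis Rats_cases lessThan_iff nth_mem rangeI subset_iff)
    then obtain q where q: "\<And>i n. i < k \<Longrightarrow> (Ks' ! i) n = of_rat (q i n)" by (metis lessThan_iff)
    have cs': "\<And>s. s \<in> set Ks' \<Longrightarrow> s \<in> cs" using Ks'(2) by blast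
    have "null (\<lambda>n. \<Sum>i<k. (Ks' ! i) n * \<alpha> ^ i)"
      using cl_eq_zero_iff[OF comb(2)[OF len cs']] comb(1)[OF len cs'] Ks1(4) Ks'(1) by simp
    moreover have "(\<Sum>i<k. (Ks' ! i) n * \<alpha> ^ i) = lc k (\<lambda>i. q i n)" for n using q by simp
    ultimately have nq: "null (\<lambda>n. lc k (\<lambda>i. q i n))" by simp
    have "null (\<lambda>n. of_rat (q i n))" if "i < k" for i
      using powers_indepD[OF ind(1), of "\<lambda>n i. q i n", OF nq that] .
    moreover have "Ks' ! i = (\<lambda>n. of_rat (q i n))" if "i < k" for i using q that by blast
    ultimately have "cl (Ks' ! i) = \<zero>\<^bsub>Kv\<^esub>" if "i < k" for i
      using cl_eq_zero_iff cs' that len nth_mem by metis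
    hence "set Ks1 \<subseteq> {\<zero>\<^bsub>Kv\<^esub>}" unfolding Ks'(1) using len by (auto simp: in_set_conv_nth)
    thus "set (take (length (map cl Us)) Ks) \<subseteq> {\<zero>\<^bsub>Kv\<^esub>}" using Ks1(1) by blast
  qed
  moreover have "Q.Span Qv (map cl Us) = carrier Kv"
  proof
    show "Q.Span Qv (map cl Us) \<subseteq> carrier Kv"
      by (rule Q.Span_in_carrier[OF subfieldE(3)[OF F] Us_carrier])
    show "carrier Kv \<subseteq> Q.Span Qv (map cl Us)"
    proof
      fix x assume "x \<in> carrier Kv"
      then obtain s where s: "s \<in> cs" "x = cl s" unfolding completion_carrier by blast
      have "\<exists>c. v (s n - lc k c) < 1 / real (Suc n)" for n
        by (rule powers_dense[OF ind cs_K[OF s(1)], of "1 / real (Suc n)" n]) auto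
      then obtain c where c: "\<And>n. v (s n - lc k (c n)) < 1 / real (Suc n)" by metis
      define t where "t = (\<lambda>n. lc k (c n))"
      have tK: "t n \<in> K" for n by (simp add: t_def)
      have null: "null (\<lambda>n. s n - t n)"
      proof (rule tendsto_sandwich[OF _ _ tendsto_const LIMSEQ_Suc[OF lim_1_over_n]])
        show "\<forall>\<^sub>F n in sequentially. 0 \<le> v (s n - t n)"
          by (intro always_eventually allI v_nonneg K.F_diff cs_K[OF s(1)] tK)
        show "\<forall>\<^sub>F n in sequentially. v (s n - t n) \<le> 1 / real (Suc n)"
          unfolding t_def by (intro always_eventually allI less_imp_le c)
      qed
      have t: "t \<in> cs" unfolding cs_iff
      proof (intro conjI allI impI tK)
        fix e :: real assume e: "e > 0"
        hence e3: "e / 3 > 0" by simp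
        obtain N where N: "\<And>i j. i \<ge> N \<Longrightarrow> j \<ge> N \<Longrightarrow> v (s i - s j) < e / 3"
          using s(1) e3 unfolding cs_iff by meson
        obtain M where M: "\<And>i. i \<ge> M \<Longrightarrow> v (s i - t i) < e / 3"
          using null e3 v_nonneg[OF K.F_diff[OF cs_K[OF s(1)] tK]] unfolding LIMSEQ_iff
          by (metis abs_of_nonneg diff_zero real_norm_def)
        have "v (t i - t j) < e" if "i \<ge> max N M" "j \<ge> max N M" for i j
        proof -
          note KK = cs_K[OF s(1)] tK
          have "v (t i - t j) \<le> v (t i - s i) + v (s i - t j)" using KK by (intro v_diff_triangle) auto
          also have "v (s i - t j) \<le> v (s i - s j) + v (s j - t j)" using KK by (intro v_diff_triangle) auto
          finally show ?thesis
            using N[of i j] M[of i] M[of j] that v_diff_commute[of "t i" "s i"] KK by simp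
        qed
        thus "\<exists>N. \<forall>i\<ge>N. \<forall>j\<ge>N. v (t i - t j) < e" by blast
      qed
      obtain B where B: "B > 0" "\<And>c i. i < k \<Longrightarrow> v (of_rat (c i)) \<le> B * v (lc k c)"
        using coefficients_bounded[OF ind(1)] by blast
      define Ks where "Ks = map (\<lambda>i n. of_rat (c n i) :: complex) [0..<k]"
      have Ks_cs: "(\<lambda>n. of_rat (c n i)) \<in> cs" if i: "i < k" for i
        unfolding cs_iff
      proof (intro conjI allI impI K.F_rat)
        fix e :: real assume e: "e > 0"
        hence "e / B > 0" using B by simp
        then obtain N where N: "\<And>i j. i \<ge> N \<Longrightarrow> j \<ge> N \<Longrightarrow> v (t i - t j) < e / B"
          using t unfolding cs_iff by meson
        have "v (of_rat (c n i) - of_rat (c m i)) < e" if "n \<ge> N" "m \<ge> N" for n m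
        proof -
          have "v (of_rat (c n i) - of_rat (c m i)) \<le> B * v (t n - t m)"
            using B(2)[OF i, of "\<lambda>i. c n i - c m i"] by (simp add: t_def lc_diff of_rat_diff)
          also have "\<dots> < e" using N[OF that] B(1) by (simp add: field_simps)
          finally show ?thesis .
        qed
        thus "\<exists>N. \<forall>n\<ge>N. \<forall>m\<ge>N. v (of_rat (c n i) - of_rat (c m i)) < e" by blast
      qed
      have K1: "length Ks = k" "\<And>s. s \<in> set Ks \<Longrightarrow> s \<in> cs" using Ks_cs by (auto simp: Ks_def)
      have "set (map cl Ks) \<subseteq> Qv"
        using K1(2) by (auto simp: rat_completion_eq Ks_def)
      moreover have "x = Q.combine (map cl Ks) (map cl Us)"
      proof -
        have "(\<lambda>n. \<Sum>i<k. (Ks ! i) n * \<alpha> ^ i) = t" by (simp add: Ks_def t_def)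
        thus ?thesis using comb(1)[OF K1] cl_eqI[OF s(1) t null] s(2) by simp
      qed
      ultimately show "x \<in> Q.Span Qv (map cl Us)"
        using Q.Span_mem_iff_length_version[OF F Us_carrier, of x] K1(1) Us(1) by (metis length_map)
    qed
  qed
  ultimately have "Q.dimension k Qv (carrier Kv)"
    using Q.dimensionI[OF F, of "map cl Us"] Us(1) by simp
  thus ?thesis using Q.dimI[OF F] unfolding local_degree_def over_def by blast
qed

text \<open>Independence is inherited by shorter families and fails beyond \<open>d\<close>, so
  there is a largest independent length; it equals the local degree.\<close>

lemma local_degree_ge:
  assumes "powers_indep k"
  shows "k \<le> local_degree K v"
proof -
  have le: "j \<le> d" if "powers_indep j" for j
    using powers_indep_mono[OF that, of "Suc d"] not_powers_indep by (cases "j \<le> d") auto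
  define m where "m = Max {j. powers_indep j}"
  have fin: "finite {j. powers_indep j}" using le by (auto intro: finite_subset[of _ "{..d}"])
  hence m: "powers_indep m" unfolding m_def using Max_in[OF fin] assms by auto
  have "\<not> powers_indep (Suc m)"
  proof
    assume "powers_indep (Suc m)"
    hence "Suc m \<le> m" unfolding m_def using fin by (intro Max_ge) auto
    thus False by simp
  qed
  hence "local_degree K v = m" using completion_dimension m by blast
  moreover have "k \<le> m" unfolding m_def using fin assms by (intro Max_ge) auto
  ultimately show ?thesis by simp
qed

text \<open>Conjugates inducing the same place are pairwise distinct roots, so the coefficients of a
  polynomial of small degree are recovered from its values there by interpolation.\<close>

lemma powers_indep_conjugates:
  assumes w: "absolute_value_on {x. algebraic x} w"
    and B: "B \<subseteq> conjugates" "\<And>\<beta> x. \<beta> \<in> B \<Longrightarrow> x \<in> K \<Longrightarrow> w (emb \<beta> x) = v x"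
  shows "powers_indep (card B)"
  unfolding powers_indep_def
proof (intro allI impI)
  interpret w: absolute_value_field "{x. algebraic x}" w
    by (intro absolute_value_field.intro absolute_value_field_axioms.intro Alg.complex_subfield_axioms w)
  fix c i assume null: "null (\<lambda>n. lc (card B) (c n))" and i: "i < card B"
  have fB: "finite B" using B(1) finite_conjugates finite_subset by blast
  define f where "f = (\<lambda>n. \<Sum>j<card B. monom (c n j) j)"
  have qf: "qeval (f n) x = (\<Sum>j<card B. of_rat (c n j) * x ^ j)" for n x by (simp add: f_def qeval_sum)
  have algB: "algebraic \<beta>" if "\<beta> \<in> B" for \<beta> using that B(1) conjugates_algebraic by blast
  have deg: "degree (map_poly of_rat (f n) :: complex poly) < card B" for n
  proof -
    have "degree (f n) < card B" unfolding f_def using i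
      by (intro degree_sum_less) (auto intro: le_less_trans[OF degree_monom_le])
    thus ?thesis by simp
  qed
  have val: "w (qeval (f n) \<beta>) = v (lc (card B) (c n))" if "\<beta> \<in> B" for \<beta> n
    using B(2)[OF that, of "qeval (f n) \<alpha>"] emb_qeval[of \<beta> "f n"] B(1) that by (auto simp: qf)
  have coeff_f: "coeff (f n) i = c n i" for n using i by (simp add: f_def coeff_sum)
  show "null (\<lambda>n. of_rat (c n i))"
  proof (rule tendsto_sandwich[where f = "\<lambda>_. 0" and
        h = "\<lambda>n. \<Sum>\<beta>\<in>B. v (lc (card B) (c n)) * w (coeff (lagrange_basis B \<beta>) i)"])
    have "(\<lambda>n. \<Sum>\<beta>\<in>B. v (lc (card B) (c n)) * w (coeff (lagrange_basis B \<beta>) i)) \<longlonglongrightarrow>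
      (\<Sum>\<beta>\<in>B. 0 * w (coeff (lagrange_basis B \<beta>) i))"
      by (intro tendsto_sum tendsto_mult_right null)
    thus "(\<lambda>n. \<Sum>\<beta>\<in>B. v (lc (card B) (c n)) * w (coeff (lagrange_basis B \<beta>) i)) \<longlonglongrightarrow> 0" by simp
    have "v (of_rat (c n i)) \<le> (\<Sum>\<beta>\<in>B. v (lc (card B) (c n)) * w (coeff (lagrange_basis B \<beta>) i))" for n
    proof -
      obtain \<beta>0 where "\<beta>0 \<in> B" using i fB by (metis card.empty equals0I not_less_zero)
      hence "v (of_rat (c n i)) = w (of_rat (c n i))"
        using B(2)[of \<beta>0 "of_rat (c n i)"] emb_simps(1)[of \<beta>0] B(1) by auto
      also have "w (of_rat (c n i)) = w (\<Sum>\<beta>\<in>B. qeval (f n) \<beta> * coeff (lagrange_basis B \<beta>) i)"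
        using coeff_interpolation[OF fB deg, of n i] coeff_f by (simp add: qeval_def coeff_map_poly)
      also have "\<dots> \<le> (\<Sum>\<beta>\<in>B. w (qeval (f n) \<beta> * coeff (lagrange_basis B \<beta>) i))"
        using algB by (intro w.v_sum CollectI algebraic_mult algebraic_qeval lagrange_basis_algebraic) auto
      also have "\<dots> = (\<Sum>\<beta>\<in>B. v (lc (card B) (c n)) * w (coeff (lagrange_basis B \<beta>) i))"
        using algB by (intro sum.cong refl) (simp add: w.v_mult algebraic_qeval lagrange_basis_algebraic val)
      finally show ?thesis .
    qed
    thus "\<forall>\<^sub>F n in sequentially. v (of_rat (c n i)) \<le> (\<Sum>\<beta>\<in>B. v (lc (card B) (c n)) * w (coeff (lagrange_basis B \<beta>) i))"
      by simp
  qed (auto intro!: always_eventually v_nonneg)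
qed

end

section \<open>Finitely many places at which a number is large\<close>

context valued_number_field
begin

section \<open>The limit of x^n / (1 + x^n) at a place\<close>

lemma v_one_plus_power:
  assumes x: "x \<in> K" "v x < 1"
  shows "(\<lambda>n. v (1 + x ^ n)) \<longlonglongrightarrow> 1"
proof -
  have lim: "(\<lambda>n. v x ^ n) \<longlonglongrightarrow> 0" using v_nonneg[OF x(1)] x(2) by (intro LIMSEQ_power_zero) auto
  show ?thesis
  proof (rule tendsto_sandwich)
    show "(\<lambda>n. 1 - v x ^ n) \<longlonglongrightarrow> 1" "(\<lambda>n. 1 + v x ^ n) \<longlonglongrightarrow> 1"
      using tendsto_diff[OF tendsto_const lim, of 1] tendsto_add[OF tendsto_const lim, of 1] by simp_all
    have "v (1 + x ^ n) \<le> 1 + v x ^ n" for n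
      using v_triangle[of 1 "x ^ n"] x v_power K.F_power by simp
    thus "\<forall>\<^sub>F n in sequentially. v (1 + x ^ n) \<le> 1 + v x ^ n" by simp
    have "1 - v x ^ n \<le> v (1 + x ^ n)" for n
      using v_diff[of "1 + x ^ n" "x ^ n"] x v_power K.F_power K.F_add by simp
    thus "\<forall>\<^sub>F n in sequentially. 1 - v x ^ n \<le> v (1 + x ^ n)" by simp
  qed
qed

lemma v_approx_zero:
  assumes x: "x \<in> K" "v x < 1"
  shows "(\<lambda>n. v (x ^ n * inverse (1 + x ^ n))) \<longlonglongrightarrow> 0"
proof -
  have lim: "(\<lambda>n. v x ^ n) \<longlonglongrightarrow> 0" using v_nonneg[OF x(1)] x(2) by (intro LIMSEQ_power_zero) auto
  have "(\<lambda>n. v x ^ n * inverse (v (1 + x ^ n))) \<longlonglongrightarrow> 0 * inverse 1"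
    by (intro tendsto_mult lim tendsto_inverse v_one_plus_power x) auto
  moreover have "v (x ^ n * inverse (1 + x ^ n)) = v x ^ n * inverse (v (1 + x ^ n))" for n
    using x by (simp add: v_mult K.F_power K.F_add K.F_inverse v_inverse v_power)
  ultimately show ?thesis by simp
qed

lemma v_approx_one:
  assumes x: "x \<in> K" "v x > 1"
  shows "(\<lambda>n. v (x ^ n * inverse (1 + x ^ n))) \<longlonglongrightarrow> 1"
proof -
  have x0: "x \<noteq> 0" using x by auto
  have "(\<lambda>n. inverse (v (1 + inverse x ^ n))) \<longlonglongrightarrow> inverse 1"
    using x by (intro tendsto_inverse v_one_plus_power) (auto simp: K.F_inverse v_inverse inverse_less_1_iff)
  moreover have "v (x ^ n * inverse (1 + x ^ n)) = inverse (v (1 + inverse x ^ n))" for n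
  proof -
    have "x ^ n * inverse (1 + x ^ n) = inverse (inverse x ^ n * (1 + x ^ n))"
      by (simp add: power_inverse)
    also have "inverse x ^ n * (1 + x ^ n) = 1 + inverse x ^ n" using x0 by (simp add: power_inverse field_simps)
    finally show ?thesis using x by (simp add: v_inverse K.F_inverse K.F_power K.F_add)
  qed
  ultimately show ?thesis by simp
qed

end

text \<open>\<open>\<rho>\<close> is the common restriction to \<open>\<rat>\<close> of the places
  considered, archimedean or p-adic. The witness \<open>q0\<close> makes it nontrivial and serves as
  the unit of scale.\<close>

locale rational_places = algebraic_number +
  fixes \<rho> :: "rat \<Rightarrow> real" and q0 :: rat
  assumes q0: "\<rho> q0 > 1"
begin

definition T :: "(complex \<Rightarrow> real) set" where
  "T = {v. v \<in> extensional K \<and> absolute_value_on K v \<and> (\<forall>q. v (of_rat q) = \<rho> q)}"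

lemma T_valued: "v \<in> T \<Longrightarrow> valued_number_field \<alpha> v"
  by unfold_locales (simp add: T_def)

lemma T_rat: "v \<in> T \<Longrightarrow> v (of_rat q) = \<rho> q" by (simp add: T_def)

text \<open>If \<open>u y < v y\<close>, a high power of \<open>y\<close> makes the ratio of the two
  values exceed \<open>\<rho> q0\<close>. As both places agree on \<open>\<rat>\<close>, multiplying
  by a power of \<open>q0\<close> shifts both values alike until 1 lies between them.\<close>

lemma T_distinct:
  assumes uv: "u \<in> T" "v \<in> T" "u \<noteq> v"
  obtains z where "z \<in> K" "u z < 1" "v z \<ge> 1"
proof -
  interpret u: valued_number_field \<alpha> u using T_valued uv by blast
  interpret v: valued_number_field \<alpha> v using T_valued uv by blast
  obtain x where x: "x \<in> K" "u x \<noteq> v x" using uv by (metis (mono_tags, lifting) T_def extensionalityI mem_Collect_eq)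
  have x0: "x \<noteq> 0" using x by auto
  obtain y where y: "y \<in> K" "u y < v y" "y \<noteq> 0"
  proof (cases "u x < v x")
    case True
    thus ?thesis using that x x0 by blast
  next
    case False
    hence "v x < u x" using x by simp
    moreover have "v x > 0" using v.v_nonneg[OF x(1)] v.v_eq_0[OF x(1)] x0 by simp
    ultimately have "u (inverse x) < v (inverse x)"
      using x by (simp add: u.v_inverse v.v_inverse)
    thus ?thesis using that[of "inverse x"] x x0 K.F_inverse by simp
  qed
  have pos: "u y > 0" using u.v_nonneg[OF y(1)] u.v_eq_0[OF y(1)] y(3) by simp
  hence pos': "v y > 0" using y by simp
  define c where "c = \<rho> q0"
  have c: "c > 1" "ln c > 0" using q0 by (auto simp: c_def)
  have "ln (v y) - ln (u y) > 0" using pos y by simp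
  then obtain n :: nat where n: "ln c < real n * (ln (v y) - ln (u y))"
    using reals_Archimedean3 by blast
  \<comment> \<open>The floor brings \<open>v z\<close> into the interval from 1 up to, but
    excluding, \<open>c\<close>; by the choice of \<open>n\<close>, \<open>u z\<close> is smaller by
    more than a factor \<open>c\<close>, hence below 1.\<close>
  define m where "m = \<lfloor>real n * ln (v y) / ln c\<rfloor>"
  have "real_of_int m \<le> real n * ln (v y) / ln c" "real n * ln (v y) / ln c < real_of_int m + 1"
    unfolding m_def by linarith+
  hence m: "real_of_int m * ln c \<le> real n * ln (v y)" "real n * ln (v y) < (real_of_int m + 1) * ln c"
    using c by (auto simp: field_simps)
  define z where "z = y ^ n * of_rat q0 powi (- m)"
  have q0K: "of_rat q0 powi (- m) \<in> K" using K.F_power_int K.F_rat by blast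
  have exp_eq: "t ^ n * c powi (- m) = exp (real n * ln t - real_of_int m * ln c)" if "t > 0" for t
  proof -
    have "t ^ n = exp (real n * ln t)" using that by (simp add: exp_of_nat_mult)
    moreover have "c powi (- m) = exp (- (real_of_int m * ln c))"
      using c powr_real_of_int'[of c "- m"] by (simp add: powr_def)
    ultimately show ?thesis by (simp add: exp_diff exp_minus field_simps)
  qed
  have "u z = u y ^ n * c powi (- m)"
    using y q0K by (simp add: z_def u.v_mult K.F_power u.v_power u.v_power_int T_rat[OF uv(1)] c_def)
  hence uz: "u z = exp (real n * ln (u y) - real_of_int m * ln c)" using exp_eq pos by simp
  have "v z = v y ^ n * c powi (- m)"
    using y q0K by (simp add: z_def v.v_mult K.F_power v.v_power v.v_power_int T_rat[OF uv(2)] c_def)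
  hence vz: "v z = exp (real n * ln (v y) - real_of_int m * ln c)" using exp_eq pos' by simp
  have "u z < 1" unfolding uz using m n by (simp add: algebra_simps)
  moreover have "v z \<ge> 1" unfolding vz using m by simp
  moreover have "z \<in> K" unfolding z_def using y q0K by (intro K.F_mult K.F_power)
  ultimately show ?thesis using that by blast
qed

text \<open>Strict inequalities on both sides come from the quotient of two witnesses of
  \<open>T_distinct\<close>, one for each order of the places.\<close>

lemma T_separate:
  assumes uv: "u \<in> T" "v \<in> T" "u \<noteq> v"
  obtains y where "y \<in> K" "u y > 1" "v y < 1"
proof -
  interpret u: valued_number_field \<alpha> u using T_valued uv by blast
  interpret v: valued_number_field \<alpha> v using T_valued uv by blast
  obtain z where z: "z \<in> K" "u z < 1" "v z \<ge> 1" using T_distinct uv by blast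
  obtain z' where z': "z' \<in> K" "v z' < 1" "u z' \<ge> 1" using T_distinct[of v u] uv by blast
  have z0: "z \<noteq> 0" using z(3) by auto
  have uz: "u z > 0" using u.v_nonneg[OF z(1)] u.v_eq_0[OF z(1)] z0 by simp
  have "u (z' * inverse z) = u z' / u z" "v (z' * inverse z) = v z' / v z"
    using z(1) z'(1) K.F_inverse by (simp_all add: u.v_mult u.v_inverse v.v_mult v.v_inverse divide_inverse)
  moreover have "u z' / u z > 1" using uz z z' by (simp add: field_simps)
  moreover have "v z' / v z < 1" using z z' by (simp add: field_simps)
  moreover have "z' * inverse z \<in> K" using z(1) z'(1) K.F_inverse K.F_mult by blast
  ultimately show ?thesis using that by metis
qed

text \<open>The Artin--Whaples argument: if \<open>u x > 1\<close>, then \<open>x\<^sup>n / (1 + x\<^sup>n)\<close> tends to 1 at \<open>u\<close> and \<open>v\<close>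
  and to 0 at the places in \<open>F\<close>.\<close>

lemma T_approximation:
  assumes "finite F" "F \<subseteq> T" "v \<in> T" "v \<notin> F"
  shows "\<exists>x\<in>K. v x > 1 \<and> (\<forall>u\<in>F. u x < 1)"
  using assms
proof (induction F rule: finite_induct)
  case empty
  thus ?case using q0 by (intro bexI[of _ "of_rat q0"]) (auto simp: T_rat)
next
  case (insert u F)
  interpret v: valued_number_field \<alpha> v using T_valued insert by blast
  interpret u: valued_number_field \<alpha> u using T_valued insert by blast
  obtain x where x: "x \<in> K" "v x > 1" "\<And>w. w \<in> F \<Longrightarrow> w x < 1" using insert by auto
  obtain y where y: "y \<in> K" "v y > 1" "u y < 1" using T_separate[of v u] insert.prems by auto
  \<comment> \<open>The common end of both cases: since \<open>g n\<close> tends to 0 at the places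
    in \<open>F\<close>, so does \<open>g n * y\<close>. Only the behaviour at \<open>u\<close> and
    \<open>v\<close> depends on the choice of \<open>g\<close>.\<close>
  have main: ?case if g: "\<And>n. g n \<in> K" "\<And>w. w \<in> F \<Longrightarrow> (\<lambda>n. w (g n)) \<longlonglongrightarrow> 0"
    "\<forall>\<^sub>F n in sequentially. v (g n * y) > 1" "\<forall>\<^sub>F n in sequentially. u (g n * y) < 1" for g :: "nat \<Rightarrow> complex"
  proof -
    have "\<forall>\<^sub>F n in sequentially. w (g n * y) < 1" if w: "w \<in> F" for w
    proof -
      interpret w: valued_number_field \<alpha> w using T_valued insert.prems w by blast
      have "(\<lambda>n. w (g n) * w y) \<longlonglongrightarrow> 0 * w y" by (intro tendsto_mult_right g(2) w)
      hence "(\<lambda>n. w (g n * y)) \<longlonglongrightarrow> 0" using w.v_mult[OF g(1) y(1)] by simp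
      thus ?thesis by (rule order_tendstoD) simp
    qed
    hence "\<forall>\<^sub>F n in sequentially. \<forall>w\<in>F. w (g n * y) < 1"
      using insert.hyps(1) by (simp add: eventually_ball_finite)
    with g(3,4) have "\<forall>\<^sub>F n in sequentially. v (g n * y) > 1 \<and> (\<forall>w\<in>insert u F. w (g n * y) < 1)"
      by eventually_elim auto
    then obtain n where "v (g n * y) > 1 \<and> (\<forall>w\<in>insert u F. w (g n * y) < 1)"
      using eventually_happens' sequentially_bot by blast
    thus ?thesis using K.F_mult[OF g(1) y(1)] by blast
  qed
  show ?case
  \<comment> \<open>If \<open>u x \<le> 1\<close>, the plain powers of \<open>x\<close> suffice:
    they leave \<open>u\<close> of the product at most \<open>u y\<close> and \<open>v\<close> of it
    at least \<open>v y\<close>.\<close>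
  proof (cases "u x \<le> 1")
    case True
    show ?thesis
    proof (rule main[of "\<lambda>n. x ^ n"])
      show "x ^ n \<in> K" for n using x K.F_power by blast
      show "(\<lambda>n. w (x ^ n)) \<longlonglongrightarrow> 0" if w: "w \<in> F" for w
      proof -
        interpret w: valued_number_field \<alpha> w using T_valued insert.prems w by blast
        show ?thesis using x w.v_nonneg[OF x(1)] w by (simp add: w.v_power LIMSEQ_power_zero)
      qed
      have "v (x ^ n * y) > 1" for n
      proof -
        have "v (x ^ n * y) = v x ^ n * v y" using x y by (simp add: v.v_mult K.F_power v.v_power)
        moreover have "v x ^ n * v y \<ge> 1 * v y"
          using x y v.v_nonneg by (intro mult_right_mono one_le_power) auto
        ultimately show ?thesis using y by linarith
      qed
      thus "\<forall>\<^sub>F n in sequentially. v (x ^ n * y) > 1" by simp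
      have "u (x ^ n * y) < 1" for n
      proof -
        have "u (x ^ n * y) = u x ^ n * u y" using x y by (simp add: u.v_mult K.F_power u.v_power)
        moreover have "u x ^ n * u y \<le> 1 * u y"
          using True x y u.v_nonneg by (intro mult_right_mono power_le_one) auto
        ultimately show ?thesis using y by linarith
      qed
      thus "\<forall>\<^sub>F n in sequentially. u (x ^ n * y) < 1" by simp
    qed
  next
    case False
    have gK: "x ^ n * inverse (1 + x ^ n) \<in> K" for n
      using x by (intro K.F_mult K.F_power K.F_inverse K.F_add) auto
    show ?thesis
    proof (rule main[of "\<lambda>n. x ^ n * inverse (1 + x ^ n)"])
      show "(\<lambda>n. w (x ^ n * inverse (1 + x ^ n))) \<longlonglongrightarrow> 0" if w: "w \<in> F" for w
      proof -
        interpret w: valued_number_field \<alpha> w using T_valued insert.prems w by blast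
        show ?thesis using x w by (intro w.v_approx_zero) auto
      qed
      have "(\<lambda>n. v (x ^ n * inverse (1 + x ^ n)) * v y) \<longlonglongrightarrow> 1 * v y"
        by (intro tendsto_mult_right v.v_approx_one x)
      hence "(\<lambda>n. v (x ^ n * inverse (1 + x ^ n) * y)) \<longlonglongrightarrow> v y" using v.v_mult[OF gK y(1)] by simp
      thus "\<forall>\<^sub>F n in sequentially. v (x ^ n * inverse (1 + x ^ n) * y) > 1" by (rule order_tendstoD) (use y in simp)
      have "(\<lambda>n. u (x ^ n * inverse (1 + x ^ n)) * u y) \<longlonglongrightarrow> 1 * u y"
        using False by (intro tendsto_mult_right u.v_approx_one x) auto
      hence "(\<lambda>n. u (x ^ n * inverse (1 + x ^ n) * y)) \<longlonglongrightarrow> u y" using u.v_mult[OF gK y(1)] by simp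
      thus "\<forall>\<^sub>F n in sequentially. u (x ^ n * inverse (1 + x ^ n) * y) < 1" by (rule order_tendstoD) (use y in simp)
    qed (rule gK)
  qed
qed

text \<open>Take for each place an element large there and small at the others. High powers of these
  are linearly independent over \<open>\<rat>\<close>: in a relation, pick the coefficient with the
  largest \<open>\<rho>\<close>; at the corresponding place its term outweighs all others
  together.\<close>

lemma card_T_le:
  assumes F: "finite F" "F \<subseteq> T"
  shows "card F \<le> d"
proof (rule ccontr)
  assume "\<not> card F \<le> d"
  have "\<forall>v\<in>F. \<exists>x\<in>K. v x > 1 \<and> (\<forall>u\<in>F - {v}. u x < 1)"
    using T_approximation[of "F - {v}" v for v] F by blast
  then obtain x where x: "\<And>v. v \<in> F \<Longrightarrow> x v \<in> K" "\<And>v. v \<in> F \<Longrightarrow> v (x v) > 1"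
    "\<And>u v. v \<in> F \<Longrightarrow> u \<in> F \<Longrightarrow> u \<noteq> v \<Longrightarrow> u (x v) < 1" by (metis DiffI singletonD)
  have "\<forall>\<^sub>F n in sequentially. \<forall>v\<in>F. (\<Sum>u\<in>F - {v}. v (x u) ^ n) < 1"
  proof (rule eventually_ball_finite[OF F(1)], intro ballI)
    fix v assume v: "v \<in> F"
    interpret v: valued_number_field \<alpha> v using T_valued F v by blast
    have "(\<lambda>n. \<Sum>u\<in>F - {v}. v (x u) ^ n) \<longlonglongrightarrow> (\<Sum>u\<in>F - {v}. 0)"
      using x v by (intro tendsto_sum LIMSEQ_power_zero) (auto simp: v.v_nonneg)
    hence "(\<lambda>n. \<Sum>u\<in>F - {v}. v (x u) ^ n) \<longlonglongrightarrow> 0" by simp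
    thus "\<forall>\<^sub>F n in sequentially. (\<Sum>u\<in>F - {v}. v (x u) ^ n) < 1" by (rule order_tendstoD) simp
  qed
  then obtain n where n: "\<And>v. v \<in> F \<Longrightarrow> (\<Sum>u\<in>F - {v}. v (x u) ^ n) < 1"
    using eventually_happens' sequentially_bot by blast
  obtain vs where vs: "set vs = F" "distinct vs" using F(1) finite_distinct_list by blast
  define Us where "Us = map (\<lambda>v. x v ^ n) vs"
  have len: "length Us = card F" using vs distinct_card[of vs] by (simp add: Us_def)
  have UsK: "set Us \<subseteq> K" using vs x(1) K.F_power by (auto simp: Us_def)
  have "CR.dependent \<rat> Us"
    using CR.independent_length_le_dimension[OF Rats_subfield dimension_K _ UsK] len \<open>\<not> card F \<le> d\<close> by auto
  then obtain Ks where Ks: "length Ks = length Us" "CR.combine Ks Us = \<zero>\<^bsub>complex_ring\<^esub>" "set Ks \<subseteq> \<rat>"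
    "set Ks \<noteq> {\<zero>\<^bsub>complex_ring\<^esub>}"
    using CR.dependent_imp_non_trivial_combine[OF Rats_subfield, of Us] by auto
  have "\<forall>i\<in>{..<card F}. \<exists>q. Ks ! i = of_rat q"
    using Ks(1,3) len by (metis Rats_cases lessThan_iff nth_mem subset_iff)
  then obtain q where q: "\<And>i. i < card F \<Longrightarrow> Ks ! i = of_rat (q i)" by (metis lessThan_iff)
  have rel: "(\<Sum>i<card F. of_rat (q i) * x (vs ! i) ^ n) = 0"
    using complex_ring_combine[OF Ks(1)] Ks(2) len q by (simp add: Us_def)
  have "card F > 0" using \<open>\<not> card F \<le> d\<close> by simp
  hence "Max ((\<lambda>i. \<rho> (q i)) ` {..<card F}) \<in> (\<lambda>i. \<rho> (q i)) ` {..<card F}" by (intro Max_in) auto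
  then obtain i where i: "i < card F" "\<rho> (q i) = Max ((\<lambda>i. \<rho> (q i)) ` {..<card F})" by auto
  hence max: "\<rho> (q j) \<le> \<rho> (q i)" if "j < card F" for j using that by simp
  define v where "v = vs ! i"
  have len_vs: "length vs = card F" using vs distinct_card by metis
  have vF: "v \<in> F" using i(1) vs len_vs by (auto simp: v_def)
  have vj: "vs ! j \<in> F" if "j < card F" for j using that vs len_vs by auto
  interpret v: valued_number_field \<alpha> v using T_valued F vF by blast
  have vT: "v \<in> T" using vF F by blast
  have \<rho>_pos: "\<rho> (q i) > 0"
  proof -
    have "\<exists>j<card F. Ks ! j \<noteq> 0"
    proof (rule ccontr)
      assume "\<not> ?thesis"
      hence "set Ks \<subseteq> {0}" using len Ks(1) by (auto simp: in_set_conv_nth)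
      moreover have "Ks \<noteq> []" using Ks(1) len \<open>card F > 0\<close> by auto
      ultimately show False using Ks(4) by (auto simp: subset_singleton_iff)
    qed
    then obtain j where j: "j < card F" "Ks ! j \<noteq> 0" by blast
    hence "q j \<noteq> 0" using q by auto
    hence "v (of_rat (q j)) > 0" using v.v_nonneg[OF K.F_rat] v.v_eq_0[OF K.F_rat] by (metis less_le of_rat_eq_0_iff)
    thus ?thesis using max[OF j(1)] T_rat[OF vT] by (metis less_le_trans)
  qed
  have "of_rat (q i) * x v ^ n = - (\<Sum>j\<in>{..<card F} - {i}. of_rat (q j) * x (vs ! j) ^ n)"
    using rel i(1) by (simp add: sum.remove[of "{..<card F}" i] v_def eq_neg_iff_add_eq_0)
  hence "v (of_rat (q i) * x v ^ n) = v (\<Sum>j\<in>{..<card F} - {i}. of_rat (q j) * x (vs ! j) ^ n)"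
    by (simp only:) (rule v.v_minus, use x(1) vj in \<open>auto intro!: K.F_sum K.F_mult K.F_power\<close>)
  also have "\<dots> \<le> (\<Sum>j\<in>{..<card F} - {i}. v (of_rat (q j) * x (vs ! j) ^ n))"
    using x(1) vj by (intro v.v_sum K.F_mult K.F_power) auto
  also have "\<dots> = (\<Sum>j\<in>{..<card F} - {i}. \<rho> (q j) * v (x (vs ! j)) ^ n)"
    using x(1) vj by (intro sum.cong refl) (simp add: v.v_mult K.F_power v.v_power T_rat[OF vT])
  also have "\<dots> \<le> (\<Sum>j\<in>{..<card F} - {i}. \<rho> (q i) * v (x (vs ! j)) ^ n)"
    using x(1) vj max v.v_nonneg by (intro sum_mono mult_right_mono) auto
  also have "\<dots> = \<rho> (q i) * (\<Sum>j\<in>{..<card F} - {i}. v (x (vs ! j)) ^ n)" by (simp add: sum_distrib_left)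
  also have "(\<Sum>j\<in>{..<card F} - {i}. v (x (vs ! j)) ^ n) = (\<Sum>u\<in>F - {v}. v (x u) ^ n)"
  proof (rule sum.reindex_bij_betw)
    have "bij_betw ((!) vs) {..<card F} F" using vs len_vs by (metis bij_betw_nth)
    thus "bij_betw ((!) vs) ({..<card F} - {i}) (F - {v})"
      using i(1) vj[OF i(1)] unfolding v_def by (intro bij_betw_DiffI) auto
  qed
  also have "\<rho> (q i) * \<dots> < \<rho> (q i) * 1" using n[OF vF] \<rho>_pos by (intro mult_strict_left_mono)
  also have "\<dots> \<le> \<rho> (q i) * v (x v) ^ n" using \<rho>_pos x(2)[OF vF] by (simp add: one_le_power)
  also have "\<dots> = v (of_rat (q i) * x v ^ n)"
    using x(1)[OF vF] by (simp add: v.v_mult K.F_power v.v_power T_rat[OF vT])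
  finally show False by simp
qed

lemma finite_T: "finite T"
proof (rule ccontr)
  assume "infinite T"
  then obtain F where "finite F" "card F = Suc d" "F \<subseteq> T" using infinite_arbitrarily_large by blast
  thus False using card_T_le[of F] by simp
qed

end

context algebraic_number
begin

text \<open>At a p-adic place with \<open>v \<alpha> > 1\<close>, the prime p divides the leading
  coefficient of an integer relation, as otherwise the leading term would dominate strictly. This
  leaves finitely many restrictions to \<open>\<rat>\<close>, each with finitely many
  extensions.\<close>

lemma finite_places_above:
  "finite {v \<in> places K. v \<alpha> > 1}"
proof -
  obtain f where f: "\<forall>i. coeff f i \<in> \<int>" "f \<noteq> 0" "poly f \<alpha> = 0"
    using alg unfolding algebraic_def by blast
  define n where "n = degree f"
  have n0: "n \<noteq> 0"
  proof
    assume "n = 0"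
    then obtain c where "f = [:c:]" unfolding n_def by (auto elim: degree_eq_zeroE)
    thus False using f by auto
  qed
  have "\<forall>i. \<exists>c. coeff f i = of_int c" using f(1) by (metis Ints_cases)
  then obtain c where c: "\<And>i. coeff f i = of_int (c i)" by metis
  have cn: "c n \<noteq> 0" using c[of n] f(2) by (auto simp: n_def)
  define T' where "T' = (\<lambda>\<rho>. {v. v \<in> extensional K \<and> absolute_value_on K v \<and> (\<forall>q. v (of_rat q) = \<rho> q)})"
  have finT: "finite (T' \<rho>)" if "\<rho> q0 > 1" for \<rho> q0
  proof -
    interpret rational_places \<alpha> \<rho> q0 using that by unfold_locales
    show ?thesis unfolding T'_def by (rule finite_T[unfolded T_def])
  qed
  have arch: "finite (T' (\<lambda>q. \<bar>of_rat q\<bar>))" by (rule finT[of _ 2]) simp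
  have padic: "finite (T' (padic_abs p))" if p: "prime p" for p
  proof (rule finT[of _ "inverse (of_nat p)"])
    obtain w where "padic_value {x. algebraic x} w p" using ex_padic_value[OF p] by blast
    then interpret w: padic_value "{x. algebraic x}" w p .
    have p1: "real p > 1" using prime_gt_1_nat[OF p] by simp
    have "padic_abs p (inverse (of_nat p)) = real p"
      using w.v_inverse[of "of_nat p"] w.v_rat[of "of_nat p"] w.v_rat[of "inverse (of_nat p)"] padic_abs_self[OF p]
      by (simp add: of_rat_inverse)
    thus "padic_abs p (inverse (of_nat p)) > 1" using p1 by simp
  qed
  have "{v \<in> places K. v \<alpha> > 1} \<subseteq> T' (\<lambda>q. \<bar>of_rat q\<bar>) \<union> (\<Union>p\<in>{p. prime p \<and> int p dvd c n}. T' (padic_abs p))"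
  proof
    fix v assume v: "v \<in> {v \<in> places K. v \<alpha> > 1}"
    hence ext: "v \<in> extensional K" "absolute_value_on K v" unfolding places_def by auto
    interpret v: valued_number_field \<alpha> v using ext by unfold_locales
    show "v \<in> T' (\<lambda>q. \<bar>of_rat q\<bar>) \<union> (\<Union>p\<in>{p. prime p \<and> int p dvd c n}. T' (padic_abs p))"
    proof (cases "\<forall>q::rat. v (of_rat q) = \<bar>of_rat q\<bar>")
      case True
      thus ?thesis using ext by (auto simp: T'_def)
    next
      case False
      then obtain p where p: "prime p" "\<And>q. v (of_rat q) = padic_abs p q" using v unfolding places_def by auto
      interpret v: padic_value K v p
        using p by (intro padic_value.intro padic_value_axioms.intro v.absolute_value_field_axioms) auto
      have "int p dvd c n"
      proof (rule ccontr)
        assume ndvd: "\<not> int p dvd c n"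
        have vc: "v (of_int (c n)) = 1"
          using padic_abs_of_int[of p "c n"] p(2)[of "of_int (c n)"] cn ndvd by (simp add: not_dvd_imp_multiplicity_0)
        have a1: "v \<alpha> > 1" using v by simp
        have "0 = (\<Sum>i\<le>n. of_int (c i) * \<alpha> ^ i)" using f(3) by (simp add: poly_altdef c n_def)
        also have "{..n} = insert n {..<n}" by auto
        also have "(\<Sum>i\<in>\<dots>. of_int (c i) * \<alpha> ^ i) = of_int (c n) * \<alpha> ^ n + (\<Sum>i<n. of_int (c i) * \<alpha> ^ i)" by simp
        finally have "of_int (c n) * \<alpha> ^ n = - (\<Sum>i<n. of_int (c i) * \<alpha> ^ i)" by (simp add: eq_neg_iff_add_eq_0)
        hence "v (of_int (c n) * \<alpha> ^ n) = v (\<Sum>i<n. of_int (c i) * \<alpha> ^ i)"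
          by (simp add: K.F_sum K.F_mult K.F_power)
        also have "\<dots> \<le> v \<alpha> ^ (n - 1)"
        proof (rule v.v_sum_le)
          fix i assume i: "i \<in> {..<n}"
          show "of_int (c i) * \<alpha> ^ i \<in> K" by (simp add: K.F_mult K.F_power)
          have "v (of_int (c i) * \<alpha> ^ i) = v (of_int (c i)) * v \<alpha> ^ i"
            by (simp add: v.v_mult K.F_power v.v_power)
          also have "\<dots> \<le> 1 * v \<alpha> ^ (n - 1)"
            using v.v_int a1 i by (intro mult_mono power_increasing) auto
          finally show "v (of_int (c i) * \<alpha> ^ i) \<le> v \<alpha> ^ (n - 1)" by simp
        qed (use a1 in simp)
        also have "v (of_int (c n) * \<alpha> ^ n) = v \<alpha> ^ n"
          using vc by (simp add: v.v_mult K.F_power v.v_power)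
        finally have "v \<alpha> ^ n \<le> v \<alpha> ^ (n - 1)" .
        moreover have "v \<alpha> ^ (n - 1) < v \<alpha> ^ n" using a1 n0 by (intro power_strict_increasing) auto
        ultimately show False by simp
      qed
      thus ?thesis using p ext by (auto simp: T'_def)
    qed
  qed
  moreover have "finite {p. prime p \<and> int p dvd c n}"
  proof (rule finite_subset)
    show "{p. prime p \<and> int p dvd c n} \<subseteq> nat ` {k. k dvd c n}" by (auto simp: image_iff intro!: exI[of _ "int _"])
    show "finite (nat ` {k. k dvd c n})" using cn by (intro finite_imageI) (rule finite_divisors_int)
  qed
  ultimately show ?thesis using arch padic by (auto intro: finite_subset)
qed

end

section \<open>A lower bound for the height from an auxiliary polynomial\<close>

lemma log_plus_nonneg: "log_plus t \<ge> 0"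
  by (simp add: log_plus_def)

lemma log_plus_powr: "t \<ge> 0 \<Longrightarrow> e \<ge> 0 \<Longrightarrow> log_plus (t powr e) = e * log_plus t"
  by (cases "t = 0") (auto simp: log_plus_def ln_powr max_def mult_le_0_iff zero_le_mult_iff)

lemma ln_max_one: "t \<ge> 0 \<Longrightarrow> ln (max 1 t) = log_plus t"
  by (cases "t = 0") (auto simp: log_plus_def max_def)

lemma abs_eq_prod_primes:
  fixes a :: int
  assumes "a \<noteq> 0" "finite S" "\<And>p. p \<in> S \<Longrightarrow> prime p" "\<And>p. prime p \<Longrightarrow> int p dvd a \<Longrightarrow> p \<in> S"
  shows "real_of_int \<bar>a\<bar> = (\<Prod>p\<in>S. real p ^ multiplicity (int p) a)"
proof -
  have sub: "prime_factors a \<subseteq> int ` S"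
  proof
    fix q assume "q \<in> prime_factors a"
    hence q: "prime q" "q dvd a" by auto
    hence "prime (nat q)" "int (nat q) = q" by (auto simp: prime_ge_0_int)
    thus "q \<in> int ` S" using assms(4)[of "nat q"] q by (metis image_eqI)
  qed
  have "\<bar>a\<bar> = (\<Prod>q\<in>prime_factors a. q ^ multiplicity q a)" using prod_prime_factors[OF assms(1)] by simp
  also have "\<dots> = (\<Prod>q\<in>int ` S. q ^ multiplicity q a)"
  proof (rule prod.mono_neutral_left)
    show "\<forall>q\<in>int ` S - prime_factors a. q ^ multiplicity q a = 1"
    proof
      fix q assume q: "q \<in> int ` S - prime_factors a"
      hence "prime q" using assms(3) by auto
      hence "\<not> q dvd a" using q assms(1) by (auto simp: prime_factors_dvd)
      thus "q ^ multiplicity q a = 1" by (simp add: not_dvd_imp_multiplicity_0)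
    qed
  qed (use sub assms(2) in auto)
  also have "\<dots> = (\<Prod>p\<in>S. int p ^ multiplicity (int p) a)"
    by (subst prod.reindex) (auto simp: inj_on_def)
  finally have "real_of_int \<bar>a\<bar> = real_of_int (\<Prod>p\<in>S. int p ^ multiplicity (int p) a)" by simp
  thus ?thesis by simp
qed

lemma product_formula:
  assumes "q \<noteq> 0"
  obtains S where "finite S" "\<And>p. p \<in> S \<Longrightarrow> prime p" "\<bar>of_rat q :: real\<bar> * (\<Prod>p\<in>S. padic_abs p q) = 1"
proof -
  obtain a b where ab: "quotient_of q = (a, b)" by (cases "quotient_of q") blast
  have q: "q = of_int a / of_int b" "b > 0" using quotient_of_div[OF ab] quotient_of_denom_pos[OF ab] by auto
  have a0: "a \<noteq> 0" using assms q by auto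
  define S where "S = {p. prime p \<and> (int p dvd a \<or> int p dvd b)}"
  have "S \<subseteq> nat ` {k. k dvd a} \<union> nat ` {k. k dvd b}"
  proof
    fix p assume "p \<in> S"
    hence "int p dvd a \<or> int p dvd b" by (simp add: S_def)
    thus "p \<in> nat ` {k. k dvd a} \<union> nat ` {k. k dvd b}" using image_eqI[of p nat "int p"] by auto
  qed
  moreover have "finite (nat ` {k. k dvd a} \<union> nat ` {k. k dvd b})"
    using a0 q(2) finite_divisors_int[of a] finite_divisors_int[of b] by auto
  ultimately have fin: "finite S" by (rule finite_subset)
  have pr: "prime p" if "p \<in> S" for p using that by (simp add: S_def)
  have A: "real_of_int \<bar>a\<bar> = (\<Prod>p\<in>S. real p ^ multiplicity (int p) a)"
    by (rule abs_eq_prod_primes[OF a0 fin pr]) (simp_all add: S_def)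
  have B: "real_of_int \<bar>b\<bar> = (\<Prod>p\<in>S. real p ^ multiplicity (int p) b)"
    using q(2) by (intro abs_eq_prod_primes[OF _ fin pr]) (simp_all add: S_def)
  have "(\<Prod>p\<in>S. padic_abs p q) = (\<Prod>p\<in>S. real p ^ multiplicity (int p) b / real p ^ multiplicity (int p) a)"
  proof (rule prod.cong[OF refl])
    fix p assume "p \<in> S"
    hence "real p \<noteq> 0" using pr prime_gt_0_nat by fastforce
    thus "padic_abs p q = real p ^ multiplicity (int p) b / real p ^ multiplicity (int p) a"
      using assms by (simp add: padic_abs_def ab power_int_diff)
  qed
  also have "\<dots> = real_of_int \<bar>b\<bar> / real_of_int \<bar>a\<bar>" unfolding A B by (rule prod_dividef)
  finally have "(\<Prod>p\<in>S. padic_abs p q) = real_of_int \<bar>b\<bar> / real_of_int \<bar>a\<bar>" .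
  moreover have "\<bar>of_rat q :: real\<bar> = real_of_int \<bar>a\<bar> / real_of_int \<bar>b\<bar>"
    using q by (simp add: of_rat_divide)
  ultimately have "\<bar>of_rat q :: real\<bar> * (\<Prod>p\<in>S. padic_abs p q) = 1" using a0 q(2) by simp
  thus ?thesis using that fin pr by blast
qed

lemma qeval_of_int_poly: "qeval (map_poly of_int H) z = poly (map_poly of_int H) z"
proof -
  have "map_poly of_rat (map_poly of_int H :: rat poly) = (map_poly of_int H :: complex poly)"
    by (subst map_poly_map_poly) (auto simp: o_def)
  thus ?thesis by (simp add: qeval_def)
qed

context algebraic_number
begin

text \<open>Restricting to \<open>K\<close> makes embeddings with the same values on
  \<open>K\<close> give the same function, as the representation of places demands.\<close>

definition induced_place :: "(complex \<Rightarrow> real) \<Rightarrow> complex \<Rightarrow> complex \<Rightarrow> real" where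
  "induced_place w \<beta> = restrict (\<lambda>x. w (emb \<beta> x)) K"

context
  fixes w :: "complex \<Rightarrow> real"
  assumes w: "absolute_value_on {x. algebraic x} w"
begin

lemma induced_place_absolute_value:
  assumes "\<beta> \<in> conjugates"
  shows "absolute_value_on K (induced_place w \<beta>)"
proof -
  have a: "algebraic (emb \<beta> x)" if "x \<in> K" for x using emb_simps(6)[OF assms that] .
  show ?thesis
    unfolding absolute_value_on_def
  proof (intro conjI ballI)
    fix x y assume xy: "x \<in> K" "y \<in> K"
    show "induced_place w \<beta> (x * y) = induced_place w \<beta> x * induced_place w \<beta> y"
      using xy a emb_simps(4)[OF assms xy] w K.F_mult[OF xy] by (simp add: induced_place_def absolute_value_on_def)
    show "induced_place w \<beta> (x + y) \<le> induced_place w \<beta> x + induced_place w \<beta> y"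
      using xy a emb_simps(3)[OF assms xy] w K.F_add[OF xy] by (simp add: induced_place_def absolute_value_on_def)
  next
    fix x assume x: "x \<in> K"
    show "0 \<le> induced_place w \<beta> x" "(induced_place w \<beta> x = 0) = (x = 0)"
      using x a emb_simps(5)[OF assms x] w by (simp_all add: induced_place_def absolute_value_on_def)
  qed
qed

lemma local_degree_induced_place:
  assumes "\<beta> \<in> conjugates"
  shows "card {\<gamma> \<in> conjugates. induced_place w \<gamma> = induced_place w \<beta>} \<le> local_degree K (induced_place w \<beta>)"
proof -
  interpret v: valued_number_field \<alpha> "induced_place w \<beta>"
    using induced_place_absolute_value[OF assms] by unfold_locales
  have "w (emb \<gamma> x) = induced_place w \<beta> x" if "induced_place w \<gamma> = induced_place w \<beta>" "x \<in> K" for \<gamma> x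
  proof -
    have "induced_place w \<gamma> x = induced_place w \<beta> x" using that(1) by simp
    thus ?thesis using that(2) by (simp add: induced_place_def)
  qed
  thus ?thesis by (intro v.local_degree_ge v.powers_indep_conjugates[OF w]) auto
qed

text \<open>The conjugates are grouped by the place they induce; a group has at most as many members
  as the local degree, and \<open>log_plus\<close> is nonnegative.\<close>

lemma sum_induced_places:
  "(\<Sum>\<beta>\<in>conjugates. log_plus (w \<beta>)) \<le>
     (\<Sum>v\<in>induced_place w ` conjugates. real (local_degree K v) * log_plus (v \<alpha>))"
proof -
  have "(\<Sum>\<beta>\<in>conjugates. log_plus (w \<beta>)) =
    (\<Sum>v\<in>induced_place w ` conjugates. \<Sum>\<beta>\<in>{\<beta> \<in> conjugates. induced_place w \<beta> = v}. log_plus (w \<beta>))"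
    by (rule sum.image_gen[OF finite_conjugates])
  also have "\<dots> = (\<Sum>v\<in>induced_place w ` conjugates. \<Sum>\<beta>\<in>{\<beta> \<in> conjugates. induced_place w \<beta> = v}. log_plus (v \<alpha>))"
    by (intro sum.cong refl) (auto simp: induced_place_def emb_simps)
  also have "\<dots> = (\<Sum>v\<in>induced_place w ` conjugates.
      real (card {\<beta> \<in> conjugates. induced_place w \<beta> = v}) * log_plus (v \<alpha>))" by simp
  also have "\<dots> \<le> (\<Sum>v\<in>induced_place w ` conjugates. real (local_degree K v) * log_plus (v \<alpha>))"
    using local_degree_induced_place by (intro sum_mono mult_right_mono log_plus_nonneg) auto
  finally show ?thesis .
qed

end

lemma induced_place_rat: "\<beta> \<in> conjugates \<Longrightarrow> induced_place w \<beta> (of_rat q) = w (of_rat q)"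
  by (simp add: induced_place_def emb_simps)

text \<open>Different indices restrict differently to \<open>\<rat>\<close>, so the places they
  induce are disjoint and together form a finite partial sum of the height. The factor
  \<open>d\<close> undoes the exponent 1/d in the normalisation.\<close>

lemma sum_le_height:
  assumes w: "\<And>i. i \<in> I \<Longrightarrow> absolute_value_on {x. algebraic x} (w i)"
    "\<And>i \<beta>. i \<in> I \<Longrightarrow> \<beta> \<in> conjugates \<Longrightarrow> induced_place (w i) \<beta> \<in> places K"
    and I: "finite I"
    and disj: "\<And>i j. i \<in> I \<Longrightarrow> j \<in> I \<Longrightarrow> i \<noteq> j \<Longrightarrow> \<exists>q. w i (of_rat q) \<noteq> w j (of_rat q)"
  shows "(\<Sum>i\<in>I. \<Sum>\<beta>\<in>conjugates. log_plus (w i \<beta>)) \<le> real d * weil_height \<alpha>"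
proof -
  define A where "A = (\<Union>i\<in>I. induced_place (w i) ` conjugates)"
  have fin: "finite A" using I finite_conjugates by (auto simp: A_def)
  have AP: "A \<subseteq> places K" using w(2) by (auto simp: A_def)
  have h: "log_plus (normalized_abs K v \<alpha>) = real (local_degree K v) / real d * log_plus (v \<alpha>)" if "v \<in> places K" for v
  proof -
    have "v \<alpha> \<ge> 0" using that by (auto simp: places_def absolute_value_on_def)
    thus ?thesis unfolding normalized_abs_def number_field_degree_K by (intro log_plus_powr) auto
  qed
  have "(\<Sum>i\<in>I. \<Sum>\<beta>\<in>conjugates. log_plus (w i \<beta>)) \<le>
    (\<Sum>i\<in>I. \<Sum>v\<in>induced_place (w i) ` conjugates. real (local_degree K v) * log_plus (v \<alpha>))"
    by (intro sum_mono sum_induced_places w)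
  also have "\<dots> = (\<Sum>v\<in>A. real (local_degree K v) * log_plus (v \<alpha>))"
    unfolding A_def
  proof (rule sum.UNION_disjoint[symmetric])
    show "\<forall>i\<in>I. \<forall>j\<in>I. i \<noteq> j \<longrightarrow> induced_place (w i) ` conjugates \<inter> induced_place (w j) ` conjugates = {}"
    proof (intro ballI impI, rule ccontr)
      fix i j assume ij: "i \<in> I" "j \<in> I" "i \<noteq> j"
        "induced_place (w i) ` conjugates \<inter> induced_place (w j) ` conjugates \<noteq> {}"
      then obtain \<beta> \<gamma> where bc: "\<beta> \<in> conjugates" "\<gamma> \<in> conjugates" "induced_place (w i) \<beta> = induced_place (w j) \<gamma>"
        by auto
      thus False using disj[OF ij(1-3)] induced_place_rat by metis
    qed
  qed (use I finite_conjugates in auto)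
  also have "\<dots> = (\<Sum>v\<in>A. real d * log_plus (normalized_abs K v \<alpha>))"
    using AP h d_pos by (intro sum.cong) auto
  also have "\<dots> = real d * (\<Sum>v\<in>A. log_plus (normalized_abs K v \<alpha>))" by (simp add: sum_distrib_left)
  also have "(\<Sum>v\<in>A. log_plus (normalized_abs K v \<alpha>)) \<le> (\<Sum>\<^sub>\<infinity>v\<in>places K. log_plus (normalized_abs K v \<alpha>))"
  \<comment> \<open>Summability holds because only the finitely many places with
    \<open>v \<alpha> > 1\<close> contribute a nonzero term.\<close>
  proof (rule finite_sum_le_infsum)
    have "(\<lambda>v. log_plus (normalized_abs K v \<alpha>)) summable_on {v \<in> places K. v \<alpha> > 1}"
      using finite_places_above by simp
    moreover have "log_plus (normalized_abs K v \<alpha>) = 0" if "v \<in> places K" "\<not> v \<alpha> > 1" for v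
    proof -
      have "v \<alpha> \<ge> 0" using that by (auto simp: places_def absolute_value_on_def)
      hence "log_plus (v \<alpha>) = 0" using ln_max_one[of "v \<alpha>"] that(2) by simp
      thus ?thesis using h[OF that(1)] by simp
    qed
    ultimately show "(\<lambda>v. log_plus (normalized_abs K v \<alpha>)) summable_on places K"
      by (subst (asm) summable_on_cong_neutral[where T = "places K" and g = "\<lambda>v. log_plus (normalized_abs K v \<alpha>)"]) auto
  qed (use fin AP log_plus_nonneg in auto)
  finally show ?thesis using d_pos by (simp add: weil_height_def K_eq weil_height_in_def mult_left_mono)
qed

text \<open>The product formula for the rational norm \<open>q\<close> of H(\<alpha>). Each complex
  conjugate contributes at most \<open>ln L\<close> plus \<open>N\<close> times its
  \<open>log_plus\<close>. Each p-adic one contributes at most \<open>N\<close> times its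
  \<open>log_plus\<close>, since the coefficients of \<open>H\<close> are integers. The sum is
  bounded by \<open>d * ln L + N * d * weil_height \<alpha>\<close>.\<close>

theorem height_lower_bound:
  fixes H :: "int poly" and N :: nat and L :: real
  assumes deg: "degree H \<le> N" and L: "L > 0"
    and bound: "\<And>z. z \<in> conjugates \<Longrightarrow> cmod (poly (map_poly of_int H) z) \<le> L * max 1 (cmod z) ^ N"
    and nz: "poly (map_poly of_int H) \<alpha> \<noteq> 0"
  shows "real N * weil_height \<alpha> \<ge> - ln L"
proof -
  define h where "h = (map_poly of_int H :: rat poly)"
  have h: "qeval h z = poly (map_poly of_int H) z" for z by (simp add: h_def qeval_of_int_poly)
  obtain q where q: "(\<Prod>\<beta>\<in>conjugates. qeval h \<beta>) = of_rat q" using norm_rational by blast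
  have nz': "qeval h \<beta> \<noteq> 0" if "\<beta> \<in> conjugates" for \<beta> using nz h qeval_conjugate[OF that, of h] by simp
  hence "(\<Prod>\<beta>\<in>conjugates. qeval h \<beta>) \<noteq> 0" using finite_conjugates by simp
  hence q0: "q \<noteq> 0" using q by auto
  obtain S where S: "finite S" "\<And>p. p \<in> S \<Longrightarrow> prime p" "\<bar>of_rat q :: real\<bar> * (\<Prod>p\<in>S. padic_abs p q) = 1"
    using product_formula[OF q0] by blast
  have "\<forall>p\<in>S. \<exists>w. padic_value {x. algebraic x} w p" using ex_padic_value S(2) by blast
  then obtain W where W_padic: "\<And>p. p \<in> S \<Longrightarrow> padic_value {x. algebraic x} (W p) p" by metis
  have W: "absolute_value_on {x. algebraic x} (W p)" "W p (of_rat q) = padic_abs p q" if "p \<in> S" for p q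
  proof -
    interpret padic_value "{x. algebraic x}" "W p" p by (rule W_padic[OF that])
    show "absolute_value_on {x. algebraic x} (W p)" "W p (of_rat q) = padic_abs p q"
      by (rule absolute_value v_rat)+
  qed
  have S0: "0 \<notin> S" using S(2) by fastforce
  \<comment> \<open>The index 0, which is not prime, stands for the archimedean absolute
    value.\<close>
  define w where "w = (\<lambda>p. if p = 0 then cmod else W p)"
  have arch: "absolute_value_on {x. algebraic x} cmod"
    by (auto simp: absolute_value_on_def norm_mult norm_triangle_ineq)
  have wS: "w p = W p" if "p \<in> S" for p using that S0 by (auto simp: w_def)
  have w0: "w 0 = cmod" by (simp add: w_def)
  have cmod_rat: "cmod (of_rat r) = \<bar>of_rat r\<bar>" for r
    by (cases r) (simp add: of_rat_rat norm_divide)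
  have le: "(\<Sum>p\<in>insert 0 S. \<Sum>\<beta>\<in>conjugates. log_plus (w p \<beta>)) \<le> real d * weil_height \<alpha>"
  proof (rule sum_le_height)
    show "absolute_value_on {x. algebraic x} (w p)" if "p \<in> insert 0 S" for p
      using that W(1) arch wS w0 by auto
    show "induced_place (w p) \<beta> \<in> places K" if p: "p \<in> insert 0 S" and b: "\<beta> \<in> conjugates" for p \<beta>
    proof -
      have "absolute_value_on K (induced_place (w p) \<beta>)"
        using p W(1) arch wS w0 b by (intro induced_place_absolute_value) auto
      moreover have "induced_place (w p) \<beta> \<in> extensional K" by (simp add: induced_place_def)
      moreover have "(\<forall>q::rat. induced_place (w p) \<beta> (of_rat q) = \<bar>of_rat q\<bar>) \<or>
        (\<exists>p'. prime p' \<and> (\<forall>q. induced_place (w p) \<beta> (of_rat q) = padic_abs p' q))"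
      proof (cases "p = 0")
        case True
        thus ?thesis using cmod_rat w0 by (simp add: induced_place_rat[OF b])
      next
        case False
        hence "p \<in> S" using p by simp
        hence "prime p \<and> (\<forall>q. induced_place (w p) \<beta> (of_rat q) = padic_abs p q)"
          using S(2) W(2) wS by (simp add: induced_place_rat[OF b])
        thus ?thesis by blast
      qed
      ultimately show ?thesis by (simp add: places_def)
    qed
    show "\<exists>r. w i (of_rat r) \<noteq> w j (of_rat r)" if ij: "i \<in> insert 0 S" "j \<in> insert 0 S" "i \<noteq> j" for i j
    proof -
      \<comment> \<open>A prime \<open>i\<close> tells its own place from the others: its value is
        1/i there, 1 at other primes and \<open>i\<close> at the archimedean place.\<close>
      have *: "w i (of_rat (of_nat i)) \<noteq> w j (of_rat (of_nat i))" if i: "i \<in> S" and j: "j \<in> insert 0 S" "j \<noteq> i" for i j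
      proof -
        have i1: "real i > 1" using prime_gt_1_nat[OF S(2)[OF i]] by simp
        have "w i (of_rat (of_nat i)) < 1" 
          unfolding wS[OF i] W(2)[OF i] padic_abs_self[OF S(2)[OF i]] using i1 by (simp add: inverse_less_1_iff)
        moreover have "w j (of_rat (of_nat i)) \<ge> 1"
        proof (cases "j = 0")
          case True
          thus ?thesis using i1 w0 by simp
        next
          case False
          hence jS: "j \<in> S" using j by simp
          show ?thesis
            unfolding wS[OF jS] W(2)[OF jS] padic_abs_other[OF S(2)[OF jS] S(2)[OF i] j(2)] by simp
        qed
        ultimately show ?thesis by linarith
      qed
      show ?thesis
      proof (cases "i = 0")
        case True
        hence "j \<in> S" using ij by auto
        thus ?thesis using *[of j i] ij by metis
      next
        case False
        hence "i \<in> S" using ij by auto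
        thus ?thesis using *[of i j] ij by metis
      qed
    qed
  qed (use S in simp)
  have A: "ln \<bar>of_rat q :: real\<bar> \<le> real d * ln L + real N * (\<Sum>\<beta>\<in>conjugates. log_plus (cmod \<beta>))"
  proof -
    have "\<bar>of_rat q\<bar> = (\<Prod>\<beta>\<in>conjugates. cmod (qeval h \<beta>))"
      unfolding cmod_rat[symmetric] q[symmetric] by (rule prod_norm[symmetric])
    hence "ln \<bar>of_rat q :: real\<bar> = (\<Sum>\<beta>\<in>conjugates. ln (cmod (qeval h \<beta>)))"
      using nz' finite_conjugates by (simp add: ln_prod)
    also have "\<dots> \<le> (\<Sum>\<beta>\<in>conjugates. ln L + real N * log_plus (cmod \<beta>))"
    proof (rule sum_mono)
      fix \<beta> assume b: "\<beta> \<in> conjugates"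
      have "ln (cmod (qeval h \<beta>)) \<le> ln (L * max 1 (cmod \<beta>) ^ N)"
        using bound[OF b] nz'[OF b] L by (subst ln_le_cancel_iff) (auto simp: h)
      also have "\<dots> = ln L + real N * ln (max 1 (cmod \<beta>))"
        using L by (subst ln_mult) (auto simp: ln_realpow)
      also have "ln (max 1 (cmod \<beta>)) = log_plus (cmod \<beta>)" by (rule ln_max_one) simp
      finally show "ln (cmod (qeval h \<beta>)) \<le> ln L + real N * log_plus (cmod \<beta>)" .
    qed
    also have "\<dots> = real d * ln L + real N * (\<Sum>\<beta>\<in>conjugates. log_plus (cmod \<beta>))"
      by (simp add: sum.distrib card_conjugates sum_distrib_left)
    finally show ?thesis .
  qed
  have B: "ln (padic_abs p q) \<le> real N * (\<Sum>\<beta>\<in>conjugates. log_plus (W p \<beta>))" "padic_abs p q > 0" if p: "p \<in> S" for p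
  proof -
    interpret W: padic_value "{x. algebraic x}" "W p" p by (rule W_padic[OF p])
    have pq: "padic_abs p q = (\<Prod>\<beta>\<in>conjugates. W p (qeval h \<beta>))"
      using W.v_prod[of conjugates "qeval h"] q W(2)[OF p, of q] conjugates_algebraic algebraic_qeval by auto
    have pos: "W p (qeval h \<beta>) > 0" if "\<beta> \<in> conjugates" for \<beta>
      
      using W.v_nonneg[of "qeval h \<beta>"] W.v_eq_0[of "qeval h \<beta>"] nz'[OF that]
        algebraic_qeval[OF conjugates_algebraic[OF that]] by simp
    show "padic_abs p q > 0" unfolding pq using pos by (intro prod_pos) auto
    have "W p (qeval h \<beta>) \<noteq> 0" if "\<beta> \<in> conjugates" for \<beta> using pos[OF that] by simp
    hence "ln (padic_abs p q) = (\<Sum>\<beta>\<in>conjugates. ln (W p (qeval h \<beta>)))"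
      unfolding pq using pos finite_conjugates by (intro ln_prod) auto
    also have "\<dots> \<le> (\<Sum>\<beta>\<in>conjugates. real N * log_plus (W p \<beta>))"
    proof (rule sum_mono)
      fix \<beta> assume b: "\<beta> \<in> conjugates"
      note ab = conjugates_algebraic[OF b]
      have "qeval h \<beta> = (\<Sum>i\<le>degree H. of_int (coeff H i) * \<beta> ^ i)"
        unfolding h poly_altdef by (simp add: coeff_map_poly)
      also have "W p \<dots> \<le> max 1 (W p \<beta>) ^ N"
      proof (rule W.v_sum_le)
        fix i assume i: "i \<in> {..degree H}"
        show "of_int (coeff H i) * \<beta> ^ i \<in> {x. algebraic x}"
          using ab by (intro Alg.F_mult Alg.F_power) (simp_all add: rat_imp_algebraic)
        have "W p (of_int (coeff H i) * \<beta> ^ i) = W p (of_int (coeff H i)) * W p \<beta> ^ i"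
          
          using ab by (simp add: W.v_mult W.v_power algebraic_power rat_imp_algebraic)
        also have "\<dots> \<le> 1 * max 1 (W p \<beta>) ^ i"
          using W.v_int W.v_nonneg[of \<beta>] ab
          by (intro mult_mono power_mono) auto
        also have "\<dots> \<le> max 1 (W p \<beta>) ^ N" using i deg by (auto intro!: power_increasing)
        finally show "W p (of_int (coeff H i) * \<beta> ^ i) \<le> max 1 (W p \<beta>) ^ N" .
      qed (auto simp: le_max_iff_disj)
      finally have "ln (W p (qeval h \<beta>)) \<le> ln (max 1 (W p \<beta>) ^ N)"
        using pos[OF b] by (subst ln_le_cancel_iff) auto
      also have "\<dots> = real N * log_plus (W p \<beta>)"
        using ln_max_one[OF W.v_nonneg[of \<beta>]] ab by (simp add: ln_realpow)
      finally show "ln (W p (qeval h \<beta>)) \<le> real N * log_plus (W p \<beta>)" .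
    qed
    finally show "ln (padic_abs p q) \<le> real N * (\<Sum>\<beta>\<in>conjugates. log_plus (W p \<beta>))"
      by (simp add: sum_distrib_left)
  qed
  have "0 = ln (\<bar>of_rat q :: real\<bar> * (\<Prod>p\<in>S. padic_abs p q))" using S(3) by simp
  also have "\<dots> = ln \<bar>of_rat q :: real\<bar> + (\<Sum>p\<in>S. ln (padic_abs p q))"
  proof -
    have "(\<Prod>p\<in>S. padic_abs p q) > 0" using B(2) by (intro prod_pos) auto
    moreover have "ln (\<Prod>p\<in>S. padic_abs p q) = (\<Sum>p\<in>S. ln (padic_abs p q))"
      using B(2) S(1) by (intro ln_prod) (auto simp: less_le)
    ultimately show ?thesis using q0 by (subst ln_mult) auto
  qed
  also have "\<dots> \<le> (real d * ln L + real N * (\<Sum>\<beta>\<in>conjugates. log_plus (cmod \<beta>))) +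
      (\<Sum>p\<in>S. real N * (\<Sum>\<beta>\<in>conjugates. log_plus (W p \<beta>)))"
    using A B(1) by (intro add_mono sum_mono) auto
  also have "\<dots> = real d * ln L + real N * (\<Sum>p\<in>insert 0 S. \<Sum>\<beta>\<in>conjugates. log_plus (w p \<beta>))"
    using S(1) S0 by (simp add: w0 wS sum_distrib_left distrib_left)
  also have "\<dots> \<le> real d * ln L + real N * (real d * weil_height \<alpha>)"
    using le by (intro add_mono mult_left_mono) auto
  also have "\<dots> = real d * (ln L + real N * weil_height \<alpha>)" by (simp add: algebra_simps)
  finally show ?thesis using d_pos by (simp add: zero_le_mult_iff)
qed

end

section \<open>Irreducibility of the cyclotomic polynomials\<close>

lemma prime_dvd_binomial_power:
  fixes a b :: "'a :: comm_ring_1"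
  assumes p: "prime p"
  shows "of_nat p dvd (a + b) ^ p - (a ^ p + b ^ p)"
proof -
  have p0: "p > 0" using prime_gt_0_nat[OF p] .
  have "(a + b) ^ p = (\<Sum>k\<le>p. of_nat (p choose k) * a ^ k * b ^ (p - k))" by (rule binomial_ring)
  also have "{..p} = insert 0 (insert p {1..<p})" using p0 by auto
  also have "(\<Sum>k\<in>\<dots>. of_nat (p choose k) * a ^ k * b ^ (p - k)) =
    b ^ p + (a ^ p + (\<Sum>k\<in>{1..<p}. of_nat (p choose k) * a ^ k * b ^ (p - k)))"
    using p0 by simp
  finally have "(a + b) ^ p - (a ^ p + b ^ p) = (\<Sum>k\<in>{1..<p}. of_nat (p choose k) * a ^ k * b ^ (p - k))"
    by simp
  also have "of_nat p dvd \<dots>"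
  proof (intro dvd_sum dvd_mult2)
    fix k assume k: "k \<in> {1..<p}"
    have "p dvd (p choose k)" by (rule dvd_choose_prime) (use k p in auto)
    thus "of_nat p dvd (of_nat (p choose k) :: 'a)" by (metis dvd_def of_nat_mult)
  qed
  finally show ?thesis .
qed

lemma dvd_power_diff:
  fixes a b c :: "'a :: comm_ring_1"
  assumes "c dvd a - b" shows "c dvd a ^ n - b ^ n"
proof (cases n)
  case (Suc m)
  thus ?thesis using assms by (simp only: diff_power_eq_sum dvd_mult2)
qed simp

lemma prime_dvd_power_minus_self:
  fixes a :: int
  assumes p: "prime p"
  shows "int p dvd a ^ p - a"
proof (induction a rule: int_induct[where k = 0])
  case base
  thus ?case using prime_gt_0_nat[OF p] by (simp add: power_0_left)
next
  case (step1 i)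
  have "int p dvd ((i + 1) ^ p - (i ^ p + 1 ^ p)) + (i ^ p - i)"
    using step1 prime_dvd_binomial_power[OF p, of i 1] by (intro dvd_add) auto
  thus ?case by (simp add: algebra_simps)
next
  case (step2 i)
  have "int p dvd (i ^ p - i) - ((i - 1 + 1) ^ p - ((i - 1) ^ p + 1 ^ p))"
    by (rule dvd_diff[OF step2(2)]) (use prime_dvd_binomial_power[OF p, of "i - 1" 1] in simp)
  thus ?case by (simp add: algebra_simps)
qed

text \<open>Additivity of the p-th power modulo p, together with Fermat's congruence for the
  coefficients. It compares the values of an integer polynomial at a number and at its p-th
  power.\<close>

lemma prime_dvd_poly_power:
  fixes P :: "int poly"
  assumes p: "prime p"
  shows "of_nat p dvd P ^ p - pcompose P (monom 1 p)"
proof (induction P)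
  case 0
  thus ?case using prime_gt_0_nat[OF p] by (simp add: power_0_left)
next
  case (pCons a P)
  have X: "[:0, 1:] ^ p = (monom 1 p :: int poly)" by (simp add: monom_altdef)
  have "pCons a P = [:a:] + [:0, 1:] * P" by simp
  hence "of_nat p dvd (pCons a P) ^ p - ([:a:] ^ p + ([:0, 1:] * P) ^ p)"
    using prime_dvd_binomial_power[OF p, of "[:a:]" "[:0, 1:] * P"] by simp
  moreover have "of_nat p dvd [:a:] ^ p - [:a:]"
  proof -
    have "[:a:] ^ p - [:a:] = [:a ^ p - a:]" by (simp add: poly_const_pow)
    thus ?thesis using prime_dvd_power_minus_self[OF p, of a] by (simp add: of_nat_poly)
  qed
  moreover have "of_nat p dvd monom 1 p * (P ^ p - pcompose P (monom 1 p))" by (intro dvd_mult pCons(2))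
  ultimately have "of_nat p dvd ((pCons a P) ^ p - ([:a:] ^ p + ([:0, 1:] * P) ^ p)) + ([:a:] ^ p - [:a:]) +
      monom 1 p * (P ^ p - pcompose P (monom 1 p))" by (intro dvd_add)
  also have "\<dots> = (pCons a P) ^ p - pcompose (pCons a P) (monom 1 p)"
    by (simp only: power_mult_distrib X pcompose_pCons) (simp add: algebra_simps)
  finally show ?case .
qed

lemma root_of_unity_algebraic:
  fixes z :: complex
  assumes "z ^ e = 1" "e \<ge> 1" shows "algebraic z"
proof (rule qeval_root_imp_algebraic)
  have "coeff (monom 1 e - 1 :: rat poly) e = 1" using assms(2) by simp
  thus "monom 1 e - 1 \<noteq> (0 :: rat poly)" by (metis coeff_0 zero_neq_one)
qed (use assms in simp)

locale padic_algebraic = padic_value "{x. algebraic x}" w p for w p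
begin

lemmas w_nonneg = v_nonneg[unfolded mem_Collect_eq]
  and w_mult = v_mult[unfolded mem_Collect_eq]
  and w_minus = v_minus[unfolded mem_Collect_eq]
  and w_power = v_power[unfolded mem_Collect_eq]
  and w_prod = v_prod[unfolded mem_Collect_eq]
  and w_sum = v_sum_le[unfolded mem_Collect_eq]
  and w_ultrametric = ultrametric[unfolded mem_Collect_eq]

lemma algebraic_int': "algebraic (of_int k :: complex)" and algebraic_nat': "algebraic (of_nat k :: complex)"
  by (auto intro: rat_imp_algebraic)

lemma w_root_of_unity:
  assumes "z ^ e = 1" "e \<ge> 1" shows "algebraic z" "w z = 1"
proof -
  show a: "algebraic z" by (rule root_of_unity_algebraic[OF assms])
  have "w z ^ e = 1" using w_power[OF a, of e] assms(1) v_1 by simp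
  thus "w z = 1" using w_nonneg[OF a] assms(2) power_eq_imp_eq_base[of "w z" e 1] by simp
qed

text \<open>Linear factors are multiplied in one at a time. Algebraicity is carried through the
  induction because \<open>w\<close> is controlled only on algebraic numbers.\<close>

lemma coeff_prod_w_le:
  assumes "\<And>z. z \<in> B \<Longrightarrow> algebraic z" "\<And>z. z \<in> B \<Longrightarrow> w z \<le> 1"
  shows "w (coeff (\<Prod>z\<in>B. [:- z, 1:]) i) \<le> 1 \<and> algebraic (coeff (\<Prod>z\<in>B. [:- z, 1:]) i)"
  using assms
proof (induction B arbitrary: i rule: infinite_finite_induct)
  case (insert z B)
  define Q where "Q = (\<Prod>z\<in>B. [:- z, 1:])"
  have IH: "w (coeff Q i) \<le> 1" "algebraic (coeff Q i)" for i using insert by (auto simp: Q_def)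
  have z: "algebraic z" "w z \<le> 1" using insert by auto
  have zQ: "algebraic (- (z * coeff Q i))" "w (- (z * coeff Q i)) \<le> 1" for i
    using z IH w_nonneg by (auto simp: w_minus w_mult algebraic_mult intro!: mult_le_one)
  have eq: "(\<Prod>z\<in>insert z B. [:- z, 1:]) = pCons 0 Q - smult z Q" using insert by (simp add: Q_def)
  show ?case
  proof (cases i)
    case 0
    thus ?thesis unfolding eq using zQ[of 0] by simp
  next
    case (Suc j)
    have "coeff (pCons 0 Q - smult z Q) i = coeff Q j + (- (z * coeff Q i))" using Suc by simp
    moreover have "w (coeff Q j + (- (z * coeff Q i))) \<le> max (w (coeff Q j)) (w (- (z * coeff Q i)))"
      by (intro w_ultrametric IH zQ)
    moreover have "algebraic (coeff Q j + (- (z * coeff Q i)))" by (intro algebraic_add IH zQ)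
    ultimately show ?thesis unfolding eq using IH(1)[of j] zQ(2)[of i] by simp
  qed
qed (auto simp: v_1 v_0 rat_imp_algebraic)

text \<open>With \<open>\<eta>\<close> = z'/z, summing 1 - \<open>\<eta> ^ i\<close> over
  \<open>i < e\<close> gives \<open>e\<close>, as the geometric sum vanishes. Every summand is a
  multiple of 1 - \<open>\<eta>\<close>, so 1 - \<open>\<eta>\<close> divides the p-adic unit
  \<open>e\<close> with a cofactor \<open>R\<close> of value at most 1.\<close>

lemma roots_of_unity_apart:
  assumes e: "\<not> p dvd e" "e \<ge> 1" and z: "z ^ e = 1" "z' ^ e = 1" "z \<noteq> z'"
  shows "w (z - z') \<ge> 1"
proof -
  define \<eta> where "\<eta> = z' / z"
  have z0: "z \<noteq> 0" using z(1) e(2) by (auto simp: power_0_left)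
  have \<eta>: "\<eta> ^ e = 1" "\<eta> \<noteq> 1" using z z0 by (auto simp: \<eta>_def power_divide)
  have alg: "algebraic \<eta>" "w \<eta> = 1" using w_root_of_unity[OF \<eta>(1) e(2)] .
  define R where "R = (\<Sum>i<e. \<Sum>j<i. \<eta> ^ j)"
  have "(1 - \<eta>) * R = (\<Sum>i<e. 1 - \<eta> ^ i)"
    unfolding R_def sum_distrib_left by (intro sum.cong refl) (simp add: one_diff_power_eq sum_distrib_left)
  also have "\<dots> = of_nat e - (\<Sum>i<e. \<eta> ^ i)" by (simp add: sum_subtractf)
  also have "(\<Sum>i<e. \<eta> ^ i) = 0" using \<eta> one_diff_power_eq[of \<eta> e] by simp
  finally have eR: "(1 - \<eta>) * R = of_nat e" by simp
  have R: "algebraic R" "w R \<le> 1"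
    unfolding R_def using alg by (auto intro!: algebraic_sum w_sum algebraic_power simp: w_power)
  have a1: "algebraic (1 - \<eta>)" using alg by (intro algebraic_diff) (auto intro: rat_imp_algebraic)
  have "w (of_nat e) = 1"
    using v_rat[of "of_int (int e)"] padic_abs_of_int[of p "int e"] e by (simp add: not_dvd_imp_multiplicity_0)
  hence "1 = w (1 - \<eta>) * w R" using w_mult[OF a1 R(1)] eR by simp
  also have "\<dots> \<le> w (1 - \<eta>) * 1" using R(2) w_nonneg[OF a1] by (intro mult_left_mono)
  also have "w (1 - \<eta>) = w z * w (1 - \<eta>)" using w_root_of_unity[OF z(1) e(2)] by simp
  also have "\<dots> = w (z * (1 - \<eta>))" using w_root_of_unity[OF z(1) e(2)] a1 by (simp add: w_mult)
  also have "z * (1 - \<eta>) = z - z'" using z0 by (simp add: \<eta>_def right_diff_distrib)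
  finally show ?thesis by simp
qed

end

lemma padic_integral_imp_Ints:
  assumes "\<And>p. prime p \<Longrightarrow> padic_abs p q \<le> 1"
  shows "q \<in> \<int>"
proof (cases "q = 0")
  case False
  obtain a b where ab: "quotient_of q = (a, b)" by (cases "quotient_of q") blast
  have q: "q = of_int a / of_int b" "b > 0" "coprime a b"
    using quotient_of_div[OF ab] quotient_of_denom_pos[OF ab] quotient_of_coprime[OF ab] by auto
  have "b = 1"
  proof (rule ccontr)
    assume "b \<noteq> 1"
    hence "nat b \<noteq> 1" using q(2) by auto
    then obtain p where p: "prime p" "p dvd nat b" using prime_factor_nat by blast
    hence pb: "int p dvd b" using q(2) by (metis int_dvd_int_iff int_nat_eq less_le_not_le)
    hence pa: "\<not> int p dvd a" using q(3) p(1) by (metis coprime_common_divisor not_prime_unit prime_nat_int_transfer)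
    have "multiplicity (int p) b \<ge> 1"
      using pb q(2) p(1) by (metis less_numeral_extra(3) multiplicity_gt_zero_iff not_prime_unit
          prime_nat_int_transfer less_one not_le)
    hence "real p ^ 1 \<le> real p ^ multiplicity (int p) b"
      using prime_gt_0_nat[OF p(1)] by (intro power_increasing) auto
    hence "real p \<le> real p ^ multiplicity (int p) b" by (simp only: power_one_right)
    moreover have "padic_abs p q = real p ^ multiplicity (int p) b"
      using False pa by (simp add: padic_abs_def ab not_dvd_imp_multiplicity_0)
    ultimately show False using assms[OF p(1)] prime_gt_1_nat[OF p(1)] by linarith
  qed
  thus ?thesis using q by simp
qed simp

section \<open>The minimal polynomial of a root of unity\<close>

locale root_of_unity = algebraic_number +
  fixes e :: nat
  assumes e_pos: "e \<ge> 1" and alpha_e: "\<alpha> ^ e = 1"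
    and order: "\<And>k. k \<ge> 1 \<Longrightarrow> \<alpha> ^ k = 1 \<Longrightarrow> e \<le> k"
begin

lemma alpha_power_eq_1_iff: "\<alpha> ^ k = 1 \<longleftrightarrow> e dvd k"
proof
  assume k: "\<alpha> ^ k = 1"
  have "\<alpha> ^ k = \<alpha> ^ (e * (k div e) + k mod e)" by simp
  also have "\<dots> = \<alpha> ^ (k mod e)" by (simp only: power_add power_mult alpha_e power_one mult_1)
  finally have "\<alpha> ^ (k mod e) = 1" using k by simp
  hence "k mod e = 0" using order[of "k mod e"] e_pos by (metis Suc_leI less_one linorder_not_less mod_less_divisor neq0_conv less_le_trans One_nat_def)
  thus "e dvd k" by auto
qed (auto simp: power_mult alpha_e)

lemma conjugate_power_eq_1_iff:
  assumes "\<gamma> \<in> conjugates" shows "\<gamma> ^ k = 1 \<longleftrightarrow> e dvd k"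
  using qeval_conjugate[OF assms, of "monom 1 k - 1"] alpha_power_eq_1_iff by simp

text \<open>All conjugates are roots of unity, hence of value 1 at every prime. The coefficients are
  thus rationals that are integral at every prime.\<close>

lemma minpoly_integral: "coeff minpoly i \<in> \<int>"
proof (rule padic_integral_imp_Ints)
  fix p :: nat assume "prime p"
  then obtain w where "padic_value {x. algebraic x} w p" using ex_padic_value by blast
  then interpret padic_algebraic w p by (rule padic_algebraic.intro)
  have "w (coeff (\<Prod>z\<in>conjugates. [:- z, 1:]) i) \<le> 1"
    using w_root_of_unity[OF _ e_pos] conjugate_power_eq_1_iff[of _ e]
    by (intro coeff_prod_w_le[THEN conjunct1]) auto
  thus "padic_abs p (coeff minpoly i) \<le> 1"
    unfolding minpoly_eq_prod[symmetric] by (simp add: coeff_map_poly v_rat)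
qed

definition int_minpoly :: "int poly" where "int_minpoly = map_poly floor minpoly"

lemma int_minpoly: "map_poly of_int int_minpoly = minpoly"
proof (rule poly_eqI)
  fix i
  show "coeff (map_poly of_int int_minpoly) i = coeff minpoly i"
    using minpoly_integral[of i] by (simp add: int_minpoly_def coeff_map_poly)
qed

lemma int_minpoly_complex: "map_poly of_int int_minpoly = (\<Prod>z\<in>conjugates. [:- z, 1:] :: complex poly)"
proof -
  have "map_poly of_int int_minpoly = (map_poly of_rat (map_poly of_int int_minpoly :: rat poly) :: complex poly)"
    by (subst map_poly_map_poly) (auto simp: o_def)
  thus ?thesis unfolding int_minpoly minpoly_eq_prod .
qed

text \<open>If \<open>\<gamma>\<^sup>p\<close> were not conjugate to \<open>\<gamma>\<close>, then the value of the minimal polynomial at \<open>\<gamma>\<^sup>p\<close>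
  would be a product of differences of distinct roots of unity, hence a p-adic unit; but it is
  congruent to the p-th power of the value at \<open>\<gamma>\<close>, which is zero.\<close>

lemma conjugate_power_prime:
  assumes p: "prime p" "\<not> p dvd e" and \<gamma>: "\<gamma> \<in> conjugates"
  shows "\<gamma> ^ p \<in> conjugates"
proof (rule ccontr)
  assume notin: "\<gamma> ^ p \<notin> conjugates"
  obtain w where "padic_value {x. algebraic x} w p" using ex_padic_value[OF p(1)] by blast
  then interpret padic_algebraic w p by (rule padic_algebraic.intro)
  have unity: "\<delta> ^ e = 1" if "\<delta> \<in> conjugates" for \<delta> using conjugate_power_eq_1_iff[OF that] by simp
  have \<gamma>w: "algebraic \<gamma>" "w \<gamma> = 1" using w_root_of_unity[OF unity[OF \<gamma>] e_pos] .
  have \<gamma>p: "(\<gamma> ^ p) ^ e = 1" using unity[OF \<gamma>] by (metis mult.commute power_mult power_one)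
  note \<gamma>pw = w_root_of_unity[OF \<gamma>p e_pos]
  have P: "poly (map_poly of_int int_minpoly) z = (\<Prod>\<delta>\<in>conjugates. z - \<delta>)" for z :: complex
    unfolding int_minpoly_complex by (simp add: poly_prod)
  have "w (poly (map_poly of_int int_minpoly) (\<gamma> ^ p)) = (\<Prod>\<delta>\<in>conjugates. w (\<gamma> ^ p - \<delta>))"
    unfolding P using \<gamma>pw(1) conjugates_algebraic by (intro w_prod algebraic_diff) auto
  also have "\<dots> \<ge> (\<Prod>\<delta>\<in>conjugates. 1)"
    using roots_of_unity_apart[OF p(2) e_pos \<gamma>p unity] notin by (intro prod_mono) auto
  finally have ge: "w (poly (map_poly of_int int_minpoly) (\<gamma> ^ p)) \<ge> 1" by simp
  obtain R where R: "int_minpoly ^ p - pcompose int_minpoly (monom 1 p) = of_nat p * R"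
    using prime_dvd_poly_power[OF p(1), of int_minpoly] by (auto elim: dvdE)
  define ev where "ev = (\<lambda>Q::int poly. poly (map_poly of_int Q) \<gamma>)"
  have ev: "ev (Q - Q') = ev Q - ev Q'" "ev (Q * Q') = ev Q * ev Q'" "ev (Q ^ n) = ev Q ^ n" "ev (of_nat k) = of_nat k"
    for Q Q' n k
    by (simp_all add: ev_def of_int_poly_hom.hom_minus of_int_poly_hom.hom_mult of_int_poly_hom.hom_power
        of_nat_poly of_int_hom.map_poly_pCons_hom)
  have "ev int_minpoly = 0" unfolding ev_def P using \<gamma> finite_conjugates by auto
  moreover have "ev (pcompose int_minpoly (monom 1 p)) = poly (map_poly of_int int_minpoly) (\<gamma> ^ p)"
    by (simp add: ev_def of_int_hom.map_poly_pcompose poly_pcompose poly_monom)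
  ultimately have "- poly (map_poly of_int int_minpoly) (\<gamma> ^ p) = of_nat p * ev R"
    using arg_cong[OF R, of ev] prime_gt_0_nat[OF p(1)] by (simp add: ev power_0_left)
  moreover have evR: "algebraic (ev R)" "w (ev R) \<le> 1"
    unfolding ev_def poly_altdef using \<gamma>w v_int algebraic_int'
    by (auto intro!: algebraic_sum w_sum algebraic_mult algebraic_power simp: w_mult w_power algebraic_power)
  ultimately have "w (- poly (map_poly of_int int_minpoly) (\<gamma> ^ p)) = w (of_nat p) * w (ev R)"
    using w_mult algebraic_nat' by metis
  moreover have "algebraic (poly (map_poly of_int int_minpoly) (\<gamma> ^ p))"
    unfolding P using \<gamma>pw(1) conjugates_algebraic by (intro algebraic_prod algebraic_diff) auto
  moreover have "w (of_nat p) = inverse (real p)"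
    using v_rat[of "of_nat p"] padic_abs_self[OF p(1)] by simp
  ultimately have "w (poly (map_poly of_int int_minpoly) (\<gamma> ^ p)) = inverse (real p) * w (ev R)"
    by (simp add: w_minus)
  also have "\<dots> \<le> inverse (real p) * 1" using evR by (intro mult_left_mono) auto
  also have "\<dots> < 1" using prime_gt_1_nat[OF p(1)] by (simp add: inverse_less_1_iff)
  finally show False using ge by simp
qed

text \<open>The prime factors of \<open>b\<close> are peeled off one at a time; each intermediate
  power is again a conjugate, so the prime case applies to it.\<close>

lemma conjugate_power:
  assumes "coprime b e" "\<gamma> \<in> conjugates" "b \<ge> 1"
  shows "\<gamma> ^ b \<in> conjugates"
  using assms
proof (induction b arbitrary: \<gamma> rule: less_induct)
  case (less b)
  show ?case
  proof (cases "b = 1")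
    case False
    then obtain p where p: "prime p" "p dvd b" using prime_factor_nat by blast
    then obtain c where c: "b = p * c" by (elim dvdE)
    have "\<not> p dvd e" using p less.prems(1) by (metis coprime_common_divisor_nat not_prime_1)
    hence "\<gamma> ^ p \<in> conjugates" using conjugate_power_prime p less.prems by blast
    moreover have "c < b" "c \<ge> 1" "coprime c e"
      using c less.prems prime_gt_1_nat[OF p(1)] by auto
    ultimately have "(\<gamma> ^ p) ^ c \<in> conjugates" using less.IH by blast
    thus ?thesis by (simp add: c power_mult)
  qed (use less.prems in simp)
qed

text \<open>A conjugate has the same order \<open>e\<close> as \<alpha>, so it is
  \<open>\<zeta> ^ k\<close> with \<open>k\<close> prime to \<open>e\<close>. Conversely, if
  \<alpha> is \<open>\<zeta> ^ a\<close>, every primitive root \<open>\<zeta> ^ j\<close> is a power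
  of \<alpha> with exponent prime to \<open>e\<close>, hence a conjugate.\<close>

lemma cyclotomic_int_minpoly: "cyclotomic int_minpoly"
proof -
  define \<zeta> where "\<zeta> = cis (2 * pi / real e)"
  have \<zeta>_pow: "cis (2 * pi * real j / real e) = \<zeta> ^ j" for j
    unfolding \<zeta>_def Complex.DeMoivre by (rule arg_cong[of _ _ cis]) simp
  have \<zeta>e: "\<zeta> ^ e = 1" using \<zeta>_pow[of e] e_pos by simp
  have per: "\<zeta> ^ k = \<zeta> ^ (k mod e)" for k
  proof -
    have "\<zeta> ^ k = \<zeta> ^ (e * (k div e) + k mod e)" by simp
    also have "\<dots> = \<zeta> ^ (k mod e)" by (simp only: power_add power_mult \<zeta>e power_one mult_1)
    finally show ?thesis .
  qed
  have bij: "bij_betw (\<lambda>k. \<zeta> ^ k) {..<e} {z. z ^ e = 1}"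
    using Complex.bij_betw_roots_unity[of e] e_pos by (simp add: \<zeta>_pow)
  define Z where "Z = {j. j \<in> {1..e} \<and> coprime j e}"
  have exp: "\<exists>k<e. \<gamma> = \<zeta> ^ k \<and> coprime k e" if \<gamma>: "\<gamma> \<in> conjugates" for \<gamma>
  proof -
    have "\<gamma> ^ e = 1" using conjugate_power_eq_1_iff[OF \<gamma>] by simp
    then obtain k where k: "k < e" "\<gamma> = \<zeta> ^ k" using bij by (auto simp: bij_betw_def image_iff set_eq_iff)
    define g where "g = gcd k e"
    obtain k' e' where ke: "k = g * k'" "e = g * e'" unfolding g_def by (metis gcd_dvd1 gcd_dvd2 dvdE)
    have "\<gamma> ^ e' = \<zeta> ^ (e * k')" unfolding k(2) by (metis ke mult.assoc mult.commute power_mult)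
    hence "\<gamma> ^ e' = 1" by (simp add: power_mult \<zeta>e)
    hence "e dvd e'" using conjugate_power_eq_1_iff[OF \<gamma>] by simp
    hence "g * e' \<le> e'" using ke e_pos by (metis dvd_imp_le mult_0_right not_one_le_zero neq0_conv)
    hence "g = 1" using ke e_pos by (cases "e' = 0") auto
    thus ?thesis using k by (auto simp: g_def coprime_iff_gcd_eq_1)
  qed
  have "conjugates = (\<lambda>j. \<zeta> ^ j) ` Z"
  proof (intro equalityI subsetI)
    fix \<gamma> assume "\<gamma> \<in> conjugates"
    then obtain k where k: "k < e" "\<gamma> = \<zeta> ^ k" "coprime k e" using exp by blast
    show "\<gamma> \<in> (\<lambda>j. \<zeta> ^ j) ` Z"
    \<comment> \<open>Exponents here start at 0, those in \<open>cyclotomic\<close> at 1. The value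
      0 is prime to \<open>e\<close> only for \<open>e = 1\<close>, and then 1 takes its
      place.\<close>
    proof (cases "k = 0")
      case True
      hence "e = 1" using k by simp
      hence "1 \<in> Z" "\<zeta> ^ 1 = \<gamma>" using k True \<zeta>e by (auto simp: Z_def)
      thus ?thesis by blast
    next
      case False
      hence "k \<in> Z" using k by (auto simp: Z_def)
      thus ?thesis using k by blast
    qed
  next
    fix x assume "x \<in> (\<lambda>j. \<zeta> ^ j) ` Z"
    then obtain j where j: "x = \<zeta> ^ j" "coprime j e" "j \<ge> 1" by (auto simp: Z_def)
    obtain a where a: "\<alpha> = \<zeta> ^ a" "coprime a e" using exp[OF alpha_conjugate] by blast
    \<comment> \<open>\<open>y\<close> inverts \<open>a\<close> modulo \<open>e\<close>, so the
      exponent \<open>y * j\<close> takes \<alpha> to \<open>\<zeta> ^ j\<close>.\<close>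
    obtain y where y: "[a * y = 1] (mod e)" using cong_solve_coprime_nat[OF a(2)] by auto
    define b where "b = y * j"
    have "[a * y * j = 1 * j] (mod e)" using y by (intro cong_mult cong_refl)
    hence ab: "[a * b = j] (mod e)" by (simp add: b_def mult.assoc)
    hence "coprime (a * b) e" using j(2) by (metis cong_imp_coprime cong_sym)
    hence cb: "coprime b e" by simp
    have "\<alpha> ^ b = \<zeta> ^ (a * b)" by (simp add: a power_mult)
    also have "\<dots> = \<zeta> ^ j" using per[of "a * b"] per[of j] ab by (simp add: cong_def)
    finally have xb: "x = \<alpha> ^ b" using j by simp
    show "x \<in> conjugates"
    proof (cases "b = 0")
      case True
      hence "e = 1" using cb by simp
      hence "\<alpha> = 1" using alpha_e by simp
      thus ?thesis using xb alpha_conjugate by simp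
    next
      case False
      thus ?thesis using conjugate_power[OF cb alpha_conjugate] xb by simp
    qed
  qed
  moreover have "inj_on (\<lambda>j. \<zeta> ^ j) Z"
  proof (rule inj_onI)
    fix i j assume ij: "i \<in> Z" "j \<in> Z" "\<zeta> ^ i = \<zeta> ^ j"
    hence "\<zeta> ^ (i mod e) = \<zeta> ^ (j mod e)" using per by metis
    hence m: "i mod e = j mod e" using bij e_pos unfolding bij_betw_def inj_on_def by auto
    have "i \<le> e" "j \<le> e" "i \<ge> 1" "j \<ge> 1" using ij by (auto simp: Z_def)
    thus "i = j" using m by (metis le_neq_implies_less mod_less mod_self not_one_le_zero)
  qed
  ultimately have "(\<Prod>z\<in>conjugates. [:- z, 1:]) = (\<Prod>j\<in>Z. [:- (\<zeta> ^ j), 1:])"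
    by (simp add: prod.reindex)
  hence "map_poly of_int int_minpoly =
    (\<Prod>j | j \<in> {1..e} \<and> coprime j e. [:- cis (2 * pi * real j / real e), 1:] :: complex poly)"
    unfolding int_minpoly_complex Z_def \<zeta>_pow .
  thus ?thesis unfolding cyclotomic_def using e_pos by blast
qed

text \<open>As \<open>int_minpoly\<close> is monic, pseudo-division is genuine division with
  remainder over the integers, and a nonzero remainder would have too small a degree to vanish at
  \<alpha>.\<close>

lemma int_minpoly_dvd:
  fixes g :: "int poly"
  assumes "poly (map_poly of_int g) \<alpha> = 0"
  shows "int_minpoly dvd g"
proof -
  have deg: "degree int_minpoly = d" by (simp flip: int_minpoly)
  have lc: "lead_coeff int_minpoly = 1"
  proof -
    have "rat_of_int (lead_coeff int_minpoly) = lead_coeff minpoly"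
      using deg int_minpoly by (metis coeff_map_poly of_int_0)
    thus ?thesis using minpoly(1) by simp
  qed
  hence nz: "int_minpoly \<noteq> 0" by auto
  obtain q r where qr: "pseudo_divmod g int_minpoly = (q, r)" by (cases "pseudo_divmod g int_minpoly") blast
  have g: "g = int_minpoly * q + r" and r: "r = 0 \<or> degree r < degree int_minpoly"
    using pseudo_divmod[OF nz qr] lc by simp_all
  have "qeval (map_poly of_int g) \<alpha> = 0" using assms by (simp add: qeval_of_int_poly)
  hence "qeval (map_poly of_int r) \<alpha> = 0"
    unfolding g by (simp add: of_int_poly_hom.hom_add of_int_poly_hom.hom_mult int_minpoly minpoly(2))
  hence "r = 0"
    using qeval_small_degree[of "map_poly of_int r"] r deg by auto
  thus ?thesis using g by simp
qed

end

text \<open>Used in contrapositive form: without cyclotomic factors, no root of \<open>g\<close> is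
  a root of unity, so the auxiliary values at its roots are nonzero.\<close>

lemma root_of_unity_imp_cyclotomic_factor:
  fixes g :: "int poly" and \<alpha> :: complex
  assumes "poly (map_poly of_int g) \<alpha> = 0" "\<alpha> ^ k = 1" "k \<ge> 1"
  shows "\<exists>P. cyclotomic P \<and> P dvd g"
proof -
  define e where "e = (LEAST k. k \<ge> 1 \<and> \<alpha> ^ k = 1)"
  have e: "e \<ge> 1 \<and> \<alpha> ^ e = 1" unfolding e_def by (rule LeastI[of _ k]) (use assms in auto)
  have le: "e \<le> j" if "j \<ge> 1" "\<alpha> ^ j = 1" for j unfolding e_def using that by (intro Least_le) auto
  have "algebraic \<alpha>" by (rule root_of_unity_algebraic[OF assms(2,3)])
  then interpret root_of_unity \<alpha> e
    using e le by unfold_locales auto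
  show ?thesis using cyclotomic_int_minpoly int_minpoly_dvd[OF assms(1)] by blast
qed

section \<open>Polynomials congruent to a power of a binomial\<close>

text \<open>Writing \<open>y\<close> as (y - 1) + 1 keeps all signs positive, so p = 2 is treated
  like the other primes.\<close>

lemma prime_dvd_power_frobenius:
  fixes y :: "int poly"
  assumes p: "prime p"
  shows "of_nat p dvd (y ^ (p ^ k) - 1) - (y - 1) ^ (p ^ k)"
proof (induction k)
  case (Suc k)
  define q where "q = p ^ k"
  have "of_nat p dvd y ^ q - ((y - 1) ^ q + 1)"
    using Suc by (simp add: q_def algebra_simps)
  hence "of_nat p dvd (y ^ q) ^ p - ((y - 1) ^ q + 1) ^ p" by (rule dvd_power_diff)
  moreover have "of_nat p dvd ((y - 1) ^ q + 1) ^ p - (((y - 1) ^ q) ^ p + 1 ^ p)"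
    by (rule prime_dvd_binomial_power[OF p])
  ultimately have "of_nat p dvd ((y ^ q) ^ p - ((y - 1) ^ q + 1) ^ p) +
      (((y - 1) ^ q + 1) ^ p - (((y - 1) ^ q) ^ p + 1 ^ p))" by (rule dvd_add)
  also have "\<dots> = ((y ^ q) ^ p - 1) - ((y - 1) ^ q) ^ p" by simp
  also have "\<dots> = (y ^ (p ^ Suc k) - 1) - (y - 1) ^ (p ^ Suc k)"
    by (simp add: q_def mult.commute flip: power_mult)
  finally show ?case .
qed simp

lemma monom_power: "monom (1 :: 'a :: comm_semiring_1) n ^ k = monom 1 (n * k)"
  by (induction k) (auto simp: mult_monom)

lemma degree_le_smult_cancel:
  fixes H :: "int poly"
  assumes "p \<noteq> 0" "degree (smult p H) \<le> n" shows "degree H \<le> n"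
  using assms by simp

lemma degree_monom_minus_one: "degree (monom 1 n - 1 :: int poly) \<le> n"
  by (intro degree_diff_le degree_monom_le) simp

lemma of_nat_dvd_poly:
  fixes F :: "int poly"
  assumes "of_nat p dvd F"
  obtains H where "F = smult (int p) H"
  using assms by (auto simp: dvd_def of_nat_poly)

locale congruent_poly =
  fixes n r p :: nat and f h :: "int poly"
  assumes n: "n \<ge> 1" and r: "r \<ge> 1" and p: "prime p" and deg_f: "degree f = n * r"
    and f_eq: "f = (monom 1 n - 1) ^ r + smult (int p) h"
begin

abbreviation ev :: "int poly \<Rightarrow> complex \<Rightarrow> complex" where
  "ev Q z \<equiv> poly (map_poly of_int Q) z"

lemma ev_simps: "ev (Q - Q') z = ev Q z - ev Q' z" "ev (Q + Q') z = ev Q z + ev Q' z"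
  "ev (Q * Q') z = ev Q z * ev Q' z" "ev (Q ^ k) z = ev Q z ^ k"
  "ev (smult c Q) z = of_int c * ev Q z" "ev (monom c k) z = of_int c * z ^ k" "ev 1 z = 1"
  by (simp_all add: of_int_poly_hom.hom_minus of_int_poly_hom.hom_add of_int_poly_hom.hom_mult
      of_int_poly_hom.hom_power of_int_hom.map_poly_hom_smult map_poly_monom poly_monom)

lemma p_pos: "real p > 0" "of_nat p \<noteq> (0::complex)"
  using prime_gt_0_nat[OF p] by auto

lemma degree_base: "degree ((monom 1 n - 1 :: int poly) ^ k) \<le> n * k"
  using degree_power_le[of "monom 1 n - 1 :: int poly" k] degree_monom_minus_one[of n]
  by (meson mult_le_mono1 order.trans)

text \<open>The degree of \<open>f\<close> is what keeps the degree of \<open>h\<close>, and with it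
  the exponent in the height bound, under control.\<close>

lemma degree_h: "degree h \<le> n * r"
proof (rule degree_le_smult_cancel)
  have "smult (int p) h = f - (monom 1 n - 1) ^ r" using f_eq by simp
  thus "degree (smult (int p) h) \<le> n * r" using deg_f degree_base[of r] by (simp add: degree_diff_le)
qed (use prime_gt_0_nat[OF p] in auto)

lemma root_h: "ev f z = 0 \<Longrightarrow> (z ^ n - 1) ^ r = - (of_nat p * ev h z)"
  using arg_cong[OF f_eq, of "\<lambda>Q. ev Q z"] by (simp add: ev_simps poly_monom add_eq_0_iff)

lemma cmod_power_minus_one_le: "cmod (z ^ N - 1) \<le> 2 * max 1 (cmod z) ^ N"
proof -
  have "cmod (z ^ N - 1) \<le> cmod z ^ N + 1" by (metis norm_one norm_power norm_triangle_ineq4)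
  also have "\<dots> \<le> max 1 (cmod z) ^ N + max 1 (cmod z) ^ N"
    by (intro add_mono power_mono one_le_power) auto
  finally show ?thesis by simp
qed

text \<open>Modulo \<open>p\<close> the polynomial \<open>x\<^sup>n\<^sup>q - 1 = (x\<^sup>n - 1)\<^sup>q\<close> is a multiple of \<open>f\<close>
  as soon as the power \<open>q\<close> of \<open>p\<close> is at least \<open>r\<close>.\<close>

lemma unity_minus_one_dvd:
  assumes "r \<le> p ^ k"
  obtains H where "degree H \<le> n * p ^ k" "\<And>z. ev f z = 0 \<Longrightarrow> z ^ (n * p ^ k) - 1 = of_nat p * ev H z"
proof -
  define q where "q = p ^ k"
  define y where "y = (monom 1 n - 1 :: int poly)"
  obtain G where G: "(monom 1 n ^ q - 1) - y ^ q = smult (int p) G"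
    using of_nat_dvd_poly prime_dvd_power_frobenius[OF p, of "monom 1 n" k] unfolding q_def y_def by blast
  have p0: "int p \<noteq> 0" using prime_gt_0_nat[OF p] by simp
  have dG: "degree G \<le> n * q"
  proof (rule degree_le_smult_cancel[OF p0])
    show "degree (smult (int p) G) \<le> n * q"
      unfolding G[symmetric] monom_power y_def
      by (rule degree_diff_le[OF degree_monom_minus_one degree_base])
  qed
  \<comment> \<open>At a root of \<open>f\<close> the factor \<open>y ^ r\<close> of
    \<open>y ^ q\<close> equals \<open>- p * h\<close>; substituting this into \<open>G\<close>
    times p gives the correction term.\<close>
  define H where "H = G - h * y ^ (q - r)"
  have rq: "r \<le> q" using assms by (simp add: q_def)
  show ?thesis
  proof
    have "degree (h * y ^ (q - r)) \<le> n * r + n * (q - r)"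
      using degree_mult_le[of h "y ^ (q - r)"] degree_h degree_base[of "q - r"] unfolding y_def by linarith
    also have "\<dots> = n * q" using rq by (simp flip: distrib_left)
    finally show "degree H \<le> n * p ^ k" unfolding H_def q_def[symmetric] using dG by (intro degree_diff_le)
    fix z assume z: "ev f z = 0"
    have "z ^ (n * q) - 1 - (z ^ n - 1) ^ q = of_nat p * ev G z"
      using arg_cong[OF G, of "\<lambda>Q. ev Q z"] by (simp add: ev_simps poly_monom y_def power_mult)
    moreover have "(z ^ n - 1) ^ q = (z ^ n - 1) ^ r * (z ^ n - 1) ^ (q - r)"
      using rq by (simp flip: power_add)
    ultimately have "z ^ (n * q) - 1 = of_nat p * ev G z - of_nat p * ev h z * (z ^ n - 1) ^ (q - r)"
      using root_h[OF z] by (simp add: algebra_simps)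
    also have "\<dots> = of_nat p * ev H z" by (simp add: H_def ev_simps poly_monom y_def algebra_simps)
    finally show "z ^ (n * p ^ k) - 1 = of_nat p * ev H z" by (simp add: q_def)
  qed
qed

section \<open>Height bounds for a root of f that is not a root of unity\<close>

context
  fixes \<alpha> :: complex
  assumes root: "ev f \<alpha> = 0" and not_unity: "\<And>k. k \<ge> 1 \<Longrightarrow> \<alpha> ^ k \<noteq> 1"
begin

lemma alpha_algebraic: "algebraic_number \<alpha>"
proof
  have f0: "f \<noteq> 0" using deg_f n r by auto
  show "algebraic \<alpha>"
    by (rule qeval_root_imp_algebraic[of "map_poly of_int f"]) (use f0 root in \<open>auto simp: qeval_of_int_poly\<close>)
qed

interpretation algebraic_number \<alpha> by (rule alpha_algebraic)

lemma conjugates_root: "z \<in> conjugates \<Longrightarrow> ev f z = 0"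
  using qeval_conjugate[of z "map_poly of_int f"] root by (simp add: qeval_of_int_poly)

text \<open>Here \<open>h\<close> itself is the auxiliary polynomial: at the roots of
  \<open>f\<close>, p times \<open>h\<close> is (z^n - 1)^r up to sign, so \<open>L\<close> = 2^r /
  p. The bound is positive once p exceeds 2^r.\<close>

lemma height_large_prime: "ln (real p) - real r * ln 2 \<le> real (n * r) * weil_height \<alpha>"
proof -
  have "- ln (2 ^ r / real p) \<le> real (n * r) * weil_height \<alpha>"
  proof (rule height_lower_bound[OF degree_h])
    show "2 ^ r / real p > 0" using p_pos by simp
    show "cmod (ev h z) \<le> 2 ^ r / real p * max 1 (cmod z) ^ (n * r)" if z: "z \<in> conjugates" for z
    proof -
      have "real p * cmod (ev h z) = cmod (z ^ n - 1) ^ r"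
        using arg_cong[OF root_h[OF conjugates_root[OF z]], of cmod] by (simp add: norm_mult norm_power)
      also have "\<dots> \<le> (2 * max 1 (cmod z) ^ n) ^ r" by (intro power_mono cmod_power_minus_one_le) simp
      also have "\<dots> = 2 ^ r * max 1 (cmod z) ^ (n * r)" by (simp add: power_mult_distrib power_mult)
      finally show ?thesis using p_pos(1) by (simp add: field_simps)
    qed
    show "ev h \<alpha> \<noteq> 0" using root_h[OF root] not_unity[OF n] by auto
  qed
  moreover have "ln (2 ^ r / real p) = real r * ln 2 - ln (real p)"
    using p_pos by (simp add: ln_div ln_realpow)
  ultimately show ?thesis by simp
qed

text \<open>The archimedean factor drops from 2^r to 2, so that \<open>L\<close> = 2/p; the price is
  the exponent \<open>p ^ k\<close> in place of \<open>r\<close>.\<close>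

lemma height_power:
  assumes q: "r \<le> p ^ k"
  shows "ln (real p / 2) \<le> real (n * p ^ k) * weil_height \<alpha>"
proof -
  obtain H where H: "degree H \<le> n * p ^ k" "\<And>z. ev f z = 0 \<Longrightarrow> z ^ (n * p ^ k) - 1 = of_nat p * ev H z"
    using unity_minus_one_dvd[OF q] by blast
  have "- ln (2 / real p) \<le> real (n * p ^ k) * weil_height \<alpha>"
  proof (rule height_lower_bound[OF H(1)])
    show "2 / real p > 0" using p_pos by simp
    show "cmod (ev H z) \<le> 2 / real p * max 1 (cmod z) ^ (n * p ^ k)" if z: "z \<in> conjugates" for z
    proof -
      have "real p * cmod (ev H z) = cmod (z ^ (n * p ^ k) - 1)"
        using arg_cong[OF H(2)[OF conjugates_root[OF z]], of cmod] by (simp add: norm_mult)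
      also have "\<dots> \<le> 2 * max 1 (cmod z) ^ (n * p ^ k)" by (rule cmod_power_minus_one_le)
      finally show ?thesis using p_pos(1) by (simp add: field_simps)
    qed
    show "ev H \<alpha> \<noteq> 0"
    proof
      assume "ev H \<alpha> = 0"
      hence "\<alpha> ^ (n * p ^ k) = 1" using H(2)[OF root] by simp
      moreover have "n * p ^ k \<ge> 1" using n prime_gt_0_nat[OF p] by simp
      ultimately show False using not_unity by blast
    qed
  qed
  moreover have "- ln (2 / real p) = ln (real p / 2)" using p_pos by (simp add: ln_div)
  ultimately show ?thesis by simp
qed

text \<open>For p = 2 the bound with \<open>L\<close> = 2/p is trivial. Doubling the exponent gives
  the further factor z^N + 1 = 2 H + 2, so z^(2N) - 1 is 4 H (H + 1) and \<open>L\<close> =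
  1/2.\<close>

lemma height_power_two:
  assumes p2: "p = 2" and q: "r \<le> 2 ^ k"
  shows "ln 2 \<le> real (n * 2 ^ k * 2) * weil_height \<alpha>"
proof -
  define N where "N = n * 2 ^ k"
  obtain H where H: "degree H \<le> N" "\<And>z. ev f z = 0 \<Longrightarrow> z ^ N - 1 = 2 * ev H z"
    using unity_minus_one_dvd[of k] q p2 unfolding N_def by auto
  have eq: "z ^ (N * 2) - 1 = 4 * ev (H * (H + 1)) z" if z: "ev f z = 0" for z
  proof -
    have "z ^ (N * 2) - 1 = (z ^ N - 1) * (z ^ N - 1 + 2)"
      by (simp add: power_mult power2_eq_square algebra_simps)
    thus ?thesis unfolding H(2)[OF z] by (simp add: ev_simps algebra_simps)
  qed
  have "- ln (1 / 2) \<le> real (N * 2) * weil_height \<alpha>"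
  proof (rule height_lower_bound)
    have "degree (H + 1) \<le> N" using H(1) by (intro degree_add_le) auto
    thus "degree (H * (H + 1)) \<le> N * 2" using degree_mult_le[of H "H + 1"] H(1) by linarith
    show "cmod (ev (H * (H + 1)) z) \<le> 1 / 2 * max 1 (cmod z) ^ (N * 2)" if z: "z \<in> conjugates" for z
    proof -
      have "4 * cmod (ev (H * (H + 1)) z) = cmod (z ^ (N * 2) - 1)"
        using arg_cong[OF eq[OF conjugates_root[OF z]], of cmod] by (simp add: norm_mult)
      also have "\<dots> \<le> 2 * max 1 (cmod z) ^ (N * 2)" by (rule cmod_power_minus_one_le)
      finally show ?thesis by simp
    qed
    show "ev (H * (H + 1)) \<alpha> \<noteq> 0"
    proof
      assume "ev (H * (H + 1)) \<alpha> = 0"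
      hence "\<alpha> ^ (N * 2) = 1" using eq[OF root] by simp
      moreover have "N * 2 \<ge> 1" using n by (simp add: N_def)
      ultimately show False using not_unity by blast
    qed
  qed simp
  thus ?thesis by (simp add: ln_div N_def)
qed

lemma r_le_two_power: "real r \<le> 2 ^ r"
  using less_imp_le[OF less_exp[of r]] by (metis of_nat_le_iff of_nat_numeral of_nat_power)

text \<open>Large primes are handled by \<open>(x\<^sup>n - 1)\<^sup>r\<close> itself. For odd \<open>p < 2\<^sup>r\<^sup>+\<^sup>1\<close> it
  suffices that some power \<open>q \<ge> r\<close> of \<open>p\<close> satisfies \<open>c q \<le> 2\<^sup>r log (p/2)\<close>; one takes \<open>q = p\<close>
  if \<open>p \<ge> r\<close>, and otherwise the least power, which is at most \<open>(r - 1)\<^sup>2\<close>.\<close>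

lemma height_ge: "weil_height \<alpha> \<ge> mahler_const / (real n * 2 ^ r)"
proof -
  define c where "c = mahler_const"
  have c: "c > 0" "c < 0.22824" using mahler_const(1) mahler_const_bounds by (auto simp: c_def)
  have l2: "2 / 3 \<le> ln (2::real)" by (rule ln2_ge_two_thirds)
  have l32: "0.4 \<le> ln (3 / 2::real)" using ln_approx_bounds[of "3 / 2" 6] by (simp add: eval_nat_numeral)
  have n0: "real n > 0" using n by simp
  \<comment> \<open>Reduces every case to comparing \<open>c * N\<close> with
    \<open>2 ^ r * L\<close>, where \<open>n * N\<close> is the exponent used and \<open>L\<close>
    the logarithmic gain.\<close>
  have fin: "weil_height \<alpha> \<ge> c / (real n * 2 ^ r)" if "L \<le> real (n * N) * weil_height \<alpha>" "c * real N \<le> 2 ^ r * L"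
    "N > 0" for L :: real and N :: nat
  proof -
    have "c * real N \<le> 2 ^ r * (real n * real N * weil_height \<alpha>)"
      using that(1,2) by (simp add: order.trans[OF that(2)])
    hence "c \<le> 2 ^ r * (real n * weil_height \<alpha>)" using that(3) by (simp add: field_simps)
    thus ?thesis using n0 by (simp add: field_simps)
  qed
  consider "p = 2" | "p \<noteq> 2" "p \<ge> 2 ^ (r + 1)" | "p \<noteq> 2" "p < 2 ^ (r + 1)" "p \<ge> r" | "p \<noteq> 2" "p < r"
    by linarith
  hence "weil_height \<alpha> \<ge> c / (real n * 2 ^ r)"
  proof cases
    case 1
    \<comment> \<open>The choice \<open>k = r\<close> is good enough: what remains is 2 c \<le> ln
      2.\<close>
    have "r \<le> 2 ^ r" using less_exp[of r] by simp
    hence "ln 2 \<le> real (n * (2 ^ r * 2)) * weil_height \<alpha>" using height_power_two[OF 1] by (simp add: mult.assoc)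
    thus ?thesis by (rule fin) (use c l2 in auto)
  next
    case 2
    \<comment> \<open>The spare factor 2 in p leaves a gain of ln 2 after paying r ln 2, and c r
      \<le> 2^r ln 2 is generous.\<close>
    have "real p \<ge> 2 ^ (r + 1)" using 2 by (metis of_nat_le_iff of_nat_numeral of_nat_power)
    hence "ln (real p) \<ge> ln (2 ^ (r + 1))" using p_pos by simp
    also have "ln (2 ^ (r + 1)) = real (r + 1) * ln (2::real)" by (rule ln_realpow)
    finally have "ln 2 \<le> real (n * r) * weil_height \<alpha>" using height_large_prime by (simp add: algebra_simps)
    moreover have "c * real r \<le> 2 ^ r * ln 2"
      using r_le_two_power c l2 by (subst mult.commute[of c]) (intro mult_mono, auto)
    ultimately show ?thesis using fin[of "ln 2" r] r by simp
  next
    case 3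
    have p3: "p \<ge> 3" using 3(1) prime_ge_2_nat[OF p] by simp
    have "real p < 2 ^ (r + 1)" using 3(2) by (metis of_nat_less_iff of_nat_numeral of_nat_power)
    hence p_lt: "real p < 2 * 2 ^ r" by simp
    have h: "ln (real p / 2) \<le> real (n * p) * weil_height \<alpha>" using height_power[of 1] 3 by simp
    have "c * real p \<le> 2 ^ r * ln (real p / 2)"
    \<comment> \<open>For p > 3, p < 2^(r+1) and 2 c \<le> ln 2 \<le> ln (p/2) suffice. At p = 3 the
      last chain fails, since ln (3/2) < 2 c, and 3 c \<le> 2 ln (3/2) with 2 \<le> 2^r is used
      instead.\<close>
    proof (cases "p = 3")
      case True
      have "(2::real) ^ 1 \<le> 2 ^ r" using r by (intro power_increasing) auto
      hence "2 * 0.4 \<le> 2 ^ r * ln (3 / 2 :: real)" using l32 by (intro mult_mono) auto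
      thus ?thesis using True c by simp
    next
      case False
      hence "real p / 2 \<ge> 2" using p3 by simp
      hence "ln (real p / 2) \<ge> ln 2" by simp
      hence "ln (real p / 2) \<ge> 2 * c" using l2 c by simp
      hence le: "2 ^ r * (2 * c) \<le> 2 ^ r * ln (real p / 2)" by (intro mult_left_mono) auto
      have "c * real p \<le> c * (2 * 2 ^ r)" using p_lt c by (intro mult_left_mono) auto
      also have "\<dots> = 2 ^ r * (2 * c)" by simp
      finally show ?thesis using le by linarith
    qed
    thus ?thesis using fin[OF h] p3 by simp
  next
    case 4
    have p3: "p \<ge> 3" using 4(1) prime_ge_2_nat[OF p] by simp
    obtain k where k: "p ^ k < r" "r \<le> p ^ (k + 1)" using ex_power_ivl2[of p r] p3 4 by auto
    \<comment> \<open>Both \<open>p ^ k\<close> and \<open>p\<close> are below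
      \<open>r\<close>.\<close>
    have "p ^ (k + 1) \<le> (r - 1) * (r - 1)"
      using k(1) 4(2) by (simp add: mult_mono)
    also have "\<dots> \<le> 2 ^ r"
    proof -
      have "(s::nat) * s \<le> 2 ^ Suc s" for s
      proof (induction s rule: less_induct)
        case (less s)
        show ?case
        proof (cases "s \<le> 3")
          case True
          hence "s \<in> {0, 1, 2, 3}" by auto
          thus ?thesis by auto
        next
          case False
          then obtain t where t: "s = Suc t" "t \<ge> 3" by (cases s) auto
          have "s * s = t * t + 2 * t + 1" by (simp add: t)
          moreover have "2 * t + 1 \<le> t * t" using t(2) mult_le_mono1[of 3 t t] by linarith
          moreover have "t * t + t * t \<le> 2 ^ Suc s" using less.IH[of t] t by simp
          ultimately show ?thesis by linarith
        qed
      qed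
      from this[of "r - 1"] show ?thesis using r by simp
    qed
    finally have "real (p ^ (k + 1)) \<le> 2 ^ r" by (metis of_nat_le_iff of_nat_numeral of_nat_power)
    moreover have "ln (real p / 2) \<ge> ln (3 / 2)" using p3 by simp
    hence "ln (real p / 2) \<ge> c" using l32 c by simp
    ultimately have "c * real (p ^ (k + 1)) \<le> 2 ^ r * ln (real p / 2)"
      using c by (subst mult.commute[of c]) (intro mult_mono, auto)
    thus ?thesis using fin[OF height_power[OF k(2)]] p3 by simp
  qed
  thus ?thesis by (simp add: c_def)
qed

end

end

theorem theorem4p1:
  fixes n r :: nat and m :: int and f g :: "int poly"
  assumes "n \<ge> 1" and "r \<ge> 1"
    and "degree f = n * r"
    and "m \<ge> 2"
    and "\<forall>i. m dvd coeff (f - (monom 1 n - 1) ^ r) i"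
    and "g dvd f"
    and "\<not> (\<exists>P. cyclotomic P \<and> P dvd g)"
  shows "log_mahler_measure g \<ge> mahler_const * (real (degree g) / (real n * 2 ^ r))"
proof -
  have "nat m \<noteq> 1" using assms(4) by auto
  then obtain p where p: "prime p" "p dvd nat m" using prime_factor_nat by blast
  have "int p dvd m" using p(2) assms(4) by (metis int_dvd_int_iff int_nat_eq less_le_not_le zero_le_numeral order.trans)
  hence "[:int p:] dvd f - (monom 1 n - 1) ^ r"
    using assms(5) unfolding const_poly_dvd_iff by (meson dvd_trans)
  then obtain h where "f - (monom 1 n - 1) ^ r = [:int p:] * h" by (elim dvdE)
  hence f: "f = (monom 1 n - 1) ^ r + smult (int p) h" by (simp add: algebra_simps)
  interpret congruent_poly n r p f h
    using assms p f by unfold_locales auto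
  define B where "B = mahler_const / (real n * 2 ^ r)"
  define G where "G = (map_poly of_int g :: complex poly)"
  have "f \<noteq> 0" using assms(1-3) by auto
  hence "g \<noteq> 0" using assms(6) by auto
  hence G0: "G \<noteq> 0" "degree G = degree g" by (auto simp: G_def)
  have "B \<le> weil_height \<alpha>" if "\<alpha> \<in># proots G" for \<alpha>
  proof -
    have root: "poly (map_poly of_int g) \<alpha> = 0" using that G0 by (simp add: G_def)
    have "ev f \<alpha> = 0" using assms(6) root by (auto elim!: dvdE simp: ev_simps)
    moreover have "\<alpha> ^ k \<noteq> 1" if "k \<ge> 1" for k
      using root_of_unity_imp_cyclotomic_factor[OF root _ that] assms(7) by blast
    ultimately show ?thesis unfolding B_def by (rule height_ge)
  qed
  \<comment> \<open>Counted with multiplicity, a complex polynomial has as many roots as its degree,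
    so the left-hand side is \<open>degree g\<close> times \<open>B\<close>.\<close>
  hence "(\<Sum>\<alpha>\<in>#proots G. B) \<le> (\<Sum>\<alpha>\<in>#proots G. weil_height \<alpha>)" by (rule sum_mset_mono)
  hence "real (degree g) * B \<le> log_mahler_measure g"
    using size_proots_complex[of G] G0 by (simp add: log_mahler_measure_def G_def)
  thus ?thesis by (simp add: B_def mult.commute)
qed

end
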